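(* Let $n\ge 1$. Every cluster variable $P$ of $\mathcal P(n)$ has the form $$P=\Delta_T+P'$$ for some semi-standard Young tableau $T$ in the alphabet $[n]$ and some $P'\in\mathbb C[x_{ij}]^N$ which is smaller than $\Delta_T$ with respect to the total lexicographical order.
   Context: Notation. $[n]=\{1,\dots,n\}$. $N\subset GL_n(\mathbb C)$ is the group of unipotent upper-triangular matrices. $\mathbb C[x_{ij}]$ is the polynomial ring in the entries of a generic $n\times n$ matrix $x=(x_{ij})_{i,j\in[n]}$ ($i$ is the row index, $j$ the column index), and $\mathbb C[x_{ij}]^N$ (identified with $\mathbb C[GL_n/N]$) is the subring of polynomials $f$ with $f(xu)=f(x)$ for all $u\in N$. For nonempty $I\subset[n]$, the flag minor $\Delta_I\in\mathbb C[x_{ij}]^N$ is the minor of $x$ on the rows $I$ and the first $|I|$ columns. Seeds and mutations. A seed is a quiver with vertex set $V=V_1\sqcup V_2$ ($V_1$ frozen, $V_2$ mutable), with integer skew-symmetric edge multiplicities $w(u,v)=-w(v,u)$ ($w(u,v)>0$ means $w(u,v)$ edges from $u$ to $v$), together with algebraically independent elements $x_v$, $v\in V$, of the field $\mathbb C(x_{ij})$. For $v\in V$, $In(v)=\{v': w(v',v)>0\}$ and $Out(v)=\{v'': w(v,v'')>0\}$. The mutation $\mu_v$ at $v\in V_2$ gives a new seed with the same frozen/mutable vertices: (i) all edges incident to $v$ are reversed; (ii) for each $v'\in In(v)$, $v''\in Out(v)$ the multiplicity $w(v',v'')$ is replaced by $w(v',v'')+w(v',v)\,w(v,v'')$ (and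 skew-symmetrically for $(v'',v')$); (iii) all other multiplicities are unchanged; the variables $x_u$, $u\ne v$, are unchanged and $x_v$ is replaced by $x_v^{new}$ with $$x_v^{new}\,x_v=\prod_{v'\in In(v)}x_{v'}^{w(v',v)}+\prod_{v''\in Out(v)}x_{v''}^{w(v,v'')}.$$ The cluster algebra $\mathcal P(n)$. The initial seed has quiver $Q(n)$ with vertices $(i,j)$, $i,j\ge1$, $i+j\le n+1$, and edges (of multiplicity one, whenever both endpoints are vertices) $(i,j)\to(i+1,j)$, $(i,j)\to(i,j-1)$, $(i,j)\to(i-1,j+1)$. The frozen vertices are $(1,j)$, $1\le j\le n$, and $(i,j)$ with $i+j=n+1$; all other vertices are mutable. The variable at $(i,j)$ is the interval flag minor $\Delta_{\{i,i+1,\dots,i+j-1\}}$. The seeds of $\mathcal P(n)$ are all seeds obtained from the initial one by finite sequences of mutations at mutable vertices; the cluster variables of $\mathcal P(n)$ are all the elements $x_v\in\mathbb C(x_{ij})$ (including those at frozen vertices) occurring in these seeds. Tableaux. A semi-standard Young tableau in the alphabet $[n]$ is a filling of the boxes of a Young diagram (rows numbered from bottom to top, left-justified, of weakly decreasing lengths $\lambda_1\ge\lambda_2\ge\dots$) by elements of $[n]$ that is non-decreasing along rows (left to right) and strictly increasing along columns (bottom to top). If $T_1,\dots,T_{\lambda_1}\subset[n]$ are the sets of entries of the columns of $T$, then $\Delta_T:=\Delta_{T_1}\cdots\Delta_{T_{\lambda_1}}$. Order. Order the variables by $x_{ij}\succ x_{kl}$ if $i<k$, or $i=k$ and $j<l$,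 and let $\succ$ also denote the resulting lexicographic order on the monomials of $\mathbb C[x_{ij}]$. A polynomial $P'$ is smaller than $\Delta_T$ if $P'=0$ or the leading (largest) monomial of $P'$ is strictly smaller than the leading monomial of $\Delta_T$. *)

theory Defs
  imports
    Complex_Main
    "HOL-Library.Poly_Mapping"
    "HOL-Library.Product_Lexorder"
    "HOL-Computational_Algebra.Polynomial_Factorial"
    "Jordan_Normal_Form.Determinant"
begin

section \<open>Polynomials in the matrix entries\<close>

text \<open>
  A monomial in the variables \<open>x\<^sub>i\<^sub>j\<close> is its exponent function, a polynomial is the finitely supported
  function sending a monomial to its coefficient. The types provide variables for all \<open>i, j :: nat\<close>;
  \<open>poly_ring n\<close> below cuts out the polynomials in the \<open>x\<^sub>i\<^sub>j\<close> with \<open>i, j \<in> {1..n}\<close>.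

  Pairs \<open>(i, j)\<close> carry the lexicographic order of \<open>Product_Lexorder\<close>, in which the largest variable
  \<open>x\<^sub>1\<^sub>1\<close> has the smallest index. The library order on \<open>monomial\<close> compares exponents at the smallest
  index where two exponent functions differ. It is therefore exactly the lexicographic order of
  monomials for which \<open>x\<^sub>i\<^sub>j\<close> is larger than \<open>x\<^sub>k\<^sub>l\<close> iff \<open>i < k\<close>, or \<open>i = k\<close> and \<open>j < l\<close>
  (see \<open>monomial_less_iff\<close> and \<open>var_order\<close>).
\<close>

type_synonym monomial = "(nat \<times> nat) \<Rightarrow>\<^sub>0 nat"
type_synonym mpoly = "monomial \<Rightarrow>\<^sub>0 complex"
type_synonym ratfun = "mpoly fract"

definition Const :: "complex \<Rightarrow> mpoly" where
  "Const c = Poly_Mapping.single 0 c"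

definition Var :: "nat \<times> nat \<Rightarrow> mpoly" where
  "Var v = Poly_Mapping.single (Poly_Mapping.single v 1) 1"

definition poly_ring :: "nat \<Rightarrow> mpoly set" where
  "poly_ring n =
    {f. \<forall>m \<in> Poly_Mapping.keys f. Poly_Mapping.keys m \<subseteq> {1..n} \<times> {1..n}}"

lemma monomial_less_iff:
  fixes m m' :: monomial
  shows "m < m' \<longleftrightarrow> (\<exists>v. Poly_Mapping.lookup m v < Poly_Mapping.lookup m' v \<and>
    (\<forall>v' < v. Poly_Mapping.lookup m v' = Poly_Mapping.lookup m' v'))"
  by (simp add: less_poly_mapping.rep_eq less_fun_def)

lemma var_order:
  "(Poly_Mapping.single (k, l) 1 :: monomial) < Poly_Mapping.single (i, j) 1 \<longleftrightarrow>
    i < k \<or> (i = k \<and> j < l)"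
proof -
  have "(Poly_Mapping.single v 1 :: monomial) < Poly_Mapping.single w 1 \<longleftrightarrow> w < v" for v w
  proof
    assume "(Poly_Mapping.single v 1 :: monomial) < Poly_Mapping.single w 1"
    then show "w < v"
      unfolding monomial_less_iff lookup_single when_def
      by (metis less_nat_zero_code linorder_neqE less_irrefl zero_neq_one)
  next
    assume "w < v"
    then show "(Poly_Mapping.single v 1 :: monomial) < Poly_Mapping.single w 1"
      unfolding monomial_less_iff lookup_single when_def by (intro exI[of _ w]) auto
  qed
  then show ?thesis by (auto simp: less_prod_def')
qed

definition lead_monomial :: "mpoly \<Rightarrow> monomial" where
  "lead_monomial f = Max (Poly_Mapping.keys f)"

definition smaller :: "mpoly \<Rightarrow> mpoly \<Rightarrow> bool" where
  "smaller f g \<longleftrightarrow> f = 0 \<or> lead_monomial f < lead_monomial g"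


section \<open>The ring of \<open>N\<close>-invariants\<close>

text \<open>
  Matrices are indexed from 0, the variables from 1. \<open>poly_at f A\<close> is the value \<open>f(A)\<close> of a
  polynomial \<open>f\<close> at a matrix \<open>A\<close> whose entries are themselves polynomials.
\<close>

definition poly_at :: "mpoly \<Rightarrow> mpoly mat \<Rightarrow> mpoly" where
  "poly_at f A = (\<Sum>m \<in> Poly_Mapping.keys f. Const (Poly_Mapping.lookup f m) *
     (\<Prod>(i, j) \<in> Poly_Mapping.keys m. (A $$ (i - 1, j - 1)) ^ Poly_Mapping.lookup m (i, j)))"

definition generic_mat :: "nat \<Rightarrow> mpoly mat" where
  "generic_mat n = mat n n (\<lambda>(i, j). Var (i + 1, j + 1))"

definition unipotent_group :: "nat \<Rightarrow> complex mat set" where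
  "unipotent_group n =
    {u \<in> carrier_mat n n. upper_triangular u \<and> (\<forall>i < n. u $$ (i, i) = 1)}"

definition invariant_ring :: "nat \<Rightarrow> mpoly set" where
  "invariant_ring n =
    {f \<in> poly_ring n. \<forall>u \<in> unipotent_group n. poly_at f (generic_mat n * map_mat Const u) = f}"

definition flag_minor :: "nat set \<Rightarrow> mpoly" where
  "flag_minor I =
    det (mat (card I) (card I) (\<lambda>(a, b). Var (sorted_list_of_set I ! a, b + 1)))"


section \<open>Seeds and mutations\<close>

text \<open>
  Algebraic independence of the variables is not recorded in the type: it holds for the initial seed
  below and is preserved by mutation. In particular the variable by which \<open>mutate\<close> divides is nonzero
  in every seed that occurs, so that \<open>mutate\<close> solves the exchange relation.
\<close>

record ('v, 'k) seed =
  frozen_verts :: "'v set"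
  mutable_verts :: "'v set"
  mult :: "'v \<Rightarrow> 'v \<Rightarrow> int"
  cvar :: "'v \<Rightarrow> 'k"

definition verts :: "('v, 'k) seed \<Rightarrow> 'v set" where
  "verts S = frozen_verts S \<union> mutable_verts S"

definition in_nbrs :: "('v, 'k) seed \<Rightarrow> 'v \<Rightarrow> 'v set" where
  "in_nbrs S v = {v' \<in> verts S. mult S v' v > 0}"

definition out_nbrs :: "('v, 'k) seed \<Rightarrow> 'v \<Rightarrow> 'v set" where
  "out_nbrs S v = {v' \<in> verts S. mult S v v' > 0}"

definition mutate :: "'v \<Rightarrow> ('v, 'k :: field) seed \<Rightarrow> ('v, 'k) seed" where
  "mutate v S = S \<lparr>
     mult := (\<lambda>a b.
       if a = v \<or> b = v then - mult S a b
       else if a \<in> in_nbrs S v \<and> b \<in> out_nbrs S v then mult S a b + mult S a v * mult S v b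
       else if a \<in> out_nbrs S v \<and> b \<in> in_nbrs S v then mult S a b - mult S b v * mult S v a
       else mult S a b),
     cvar := (cvar S)(v :=
       ((\<Prod>v' \<in> in_nbrs S v. cvar S v' ^ nat (mult S v' v)) +
        (\<Prod>v' \<in> out_nbrs S v. cvar S v' ^ nat (mult S v v'))) / cvar S v) \<rparr>"

lemma exchange_relation:
  assumes "cvar S v \<noteq> 0"
  shows "cvar (mutate v S) v * cvar S v =
    (\<Prod>v' \<in> in_nbrs S v. cvar S v' ^ nat (mult S v' v)) +
    (\<Prod>v' \<in> out_nbrs S v. cvar S v' ^ nat (mult S v v'))"
  using assms by (simp add: mutate_def)

inductive_set mutation_class :: "('v, 'k :: field) seed \<Rightarrow> ('v, 'k) seed set"
  for S0 :: "('v, 'k) seed" where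
  initial: "S0 \<in> mutation_class S0"
| mutation: "S \<in> mutation_class S0 \<Longrightarrow> v \<in> mutable_verts S \<Longrightarrow> mutate v S \<in> mutation_class S0"

definition cluster_vars :: "('v, 'k :: field) seed \<Rightarrow> 'k set" where
  "cluster_vars S0 = {cvar S v | S v. S \<in> mutation_class S0 \<and> v \<in> verts S}"


section \<open>The cluster algebra \<open>P(n)\<close>\<close>

definition Q_verts :: "nat \<Rightarrow> (nat \<times> nat) set" where
  "Q_verts n = {(i, j). i \<ge> 1 \<and> j \<ge> 1 \<and> i + j \<le> n + 1}"

definition Q_frozen :: "nat \<Rightarrow> (nat \<times> nat) set" where
  "Q_frozen n = {(i, j) \<in> Q_verts n. i = 1 \<or> i + j = n + 1}"

text \<open>The alternatives are \<open>(i, j) \<rightarrow> (i + 1, j)\<close>, \<open>(i, j) \<rightarrow> (i, j - 1)\<close> and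
  \<open>(i, j) \<rightarrow> (i - 1, j + 1)\<close>, phrased without truncated subtraction.\<close>

definition Q_edge :: "nat \<Rightarrow> nat \<times> nat \<Rightarrow> nat \<times> nat \<Rightarrow> bool" where
  "Q_edge n = (\<lambda>(i, j) (k, l). (i, j) \<in> Q_verts n \<and> (k, l) \<in> Q_verts n \<and>
     (k = i + 1 \<and> l = j \<or> k = i \<and> j = l + 1 \<or> i = k + 1 \<and> l = j + 1))"

definition initial_seed :: "nat \<Rightarrow> (nat \<times> nat, ratfun) seed" where
  "initial_seed n = \<lparr>
     frozen_verts = Q_frozen n,
     mutable_verts = Q_verts n - Q_frozen n,
     mult = (\<lambda>a b. if Q_edge n a b then 1 else if Q_edge n b a then - 1 else 0),
     cvar = (\<lambda>(i, j). to_fract (flag_minor {i..<i + j})) \<rparr>"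

lemma Q_edge_asym: "Q_edge n a b \<Longrightarrow> \<not> Q_edge n b a"
  by (auto simp: Q_edge_def)

lemma mult_skew_symmetric:
  assumes "S \<in> mutation_class (initial_seed n)"
  shows "mult S a b = - mult S b a"
  using assms
proof (induction arbitrary: a b)
  case initial
  show ?case using Q_edge_asym[of n a b] by (auto simp: initial_seed_def)
next
  case (mutation S v)
  have "\<not> (a \<in> in_nbrs S v \<and> a \<in> out_nbrs S v)" for a
    using mutation.IH[of a v] by (auto simp: in_nbrs_def out_nbrs_def)
  then show ?case
    using mutation.IH[of a b] mutation.IH[of a v] mutation.IH[of b v]
    by (auto simp: mutate_def)
qed


section \<open>Semi-standard Young tableaux\<close>

text \<open>A tableau is the list of its rows, from bottom to top.\<close>

type_synonym tableau = "nat list list"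

definition ssyt :: "nat \<Rightarrow> tableau \<Rightarrow> bool" where
  "ssyt n T \<longleftrightarrow>
     (\<forall>r \<in> set T. r \<noteq> [] \<and> set r \<subseteq> {1..n} \<and> sorted r) \<and>
     sorted_wrt (\<ge>) (map length T) \<and>
     (\<forall>r c. Suc r < length T \<and> c < length (T ! Suc r) \<longrightarrow> T ! r ! c < T ! Suc r ! c)"

definition num_cols :: "tableau \<Rightarrow> nat" where
  "num_cols T = (case T of [] \<Rightarrow> 0 | r # _ \<Rightarrow> length r)"

definition col :: "tableau \<Rightarrow> nat \<Rightarrow> nat set" where
  "col T c = {T ! r ! c | r. r < length T \<and> c < length (T ! r)}"

definition tableau_minor :: "tableau \<Rightarrow> mpoly" where
  "tableau_minor T = (\<Prod>c < num_cols T. flag_minor (col T c))"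

end

theory Submission
  imports Defs
begin

text \<open>
  All cluster variables have a leading monomial with coefficient 1. In each seed the leading exponent
  vectors of the variables are linearly independent, and the columns of the exchange matrix are
  nonzero because it has full rank. So the two monomials of an exchange relation have different
  leading monomials, no leading coefficient 2 arises, and the new leading exponents are again
  independent.

  Cluster variables are polynomials by the Laurent phenomenon, proved along three mutations at
  \<open>k, j, k\<close> as by Fomin and Zelevinsky. The frozen variables do not occur in denominators because the
  initial quiver is the mutable part of the quiver of intervals in \<open>{0..n+1}\<close>. There the Laurent
  expansions in the initial seed and its neighbours have coprime denominators, since the interval
  minors have coprime leading monomials for a suitable monomial order.

  Finally the leading monomial of an \<open>N\<close>-invariant satisfies the inequalities of a Gelfand-Tsetlin
  pattern. For the columns \<open>j\<close> and \<open>j + 1\<close> this is a statement on polynomials invariant under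
  translation, obtained by substituting \<open>b\<^sub>k x\<^sub>k\<^sub>j\<close> for \<open>x\<^sub>k\<^sub>,\<^sub>j\<^sub>+\<^sub>1\<close>. Such a pattern is a semi-standard tableau
  \<open>T\<close>, and \<open>\<Delta>\<^sub>T\<close> has the same leading monomial.
\<close>

text \<open>A cluster variable is given only as a rational function, so polynomiality, invariance
  and the leading coefficient 1 need separate arguments. Unique factorization is avoided:
  \<open>f\<close> and \<open>g\<close> are coprime in a subring \<open>L\<close> of a field if
  \<open>f * y\<close> and \<open>g * y\<close> in \<open>L\<close> force \<open>y\<close> in
  \<open>L\<close>. This is the form in which two expansions of one element are compared, in Laurent
  rings and in the polynomial ring alike.

  Invariance cannot be passed along mutations by applying a substitution to fractions, since a
  substitution may send a denominator to 0. Cluster variables are followed as quotients of fixed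
  polynomials instead; a polynomial that is such a quotient is fixed itself. The enlarged quiver
  brings in variables outside the \<open>n * n\<close> matrix. Their absence is shown in the same
  way, by the substitution that sends them to 0.

  The pattern inequalities come from unipotent matrices with a single off-diagonal entry, just above
  the diagonal.\<close>

abbreviation "lookup \<equiv> Poly_Mapping.lookup"
abbreviation "keys \<equiv> Poly_Mapping.keys"
abbreviation "single \<equiv> Poly_Mapping.single"

section \<open>Evaluating poly mappings\<close>

text \<open>Coefficients go through \<open>h\<close> and exponents through \<open>e\<close>. The
  evaluation of integer Laurent polynomials at cluster variables and the substitutions into
  \<open>mpoly\<close> are both instances.\<close>

definition pm_eval :: "('c::zero \<Rightarrow> 'k) \<Rightarrow> ('m \<Rightarrow> 'k::comm_ring_1) \<Rightarrow> ('m \<Rightarrow>\<^sub>0 'c) \<Rightarrow> 'k" where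
  "pm_eval h e f = (\<Sum>m \<in> keys f. h (lookup f m) * e m)"

lemma poly_mapping_sum_singles:
  "f = (\<Sum>m \<in> keys f. single m (lookup f m))"
proof (rule poly_mapping_eqI)
  fix k
  have "(\<Sum>m \<in> keys f. lookup (single m (lookup f m)) k)
      = (\<Sum>m \<in> keys f. if m = k then lookup f m else 0)"
    by (rule sum.cong) (auto simp: lookup_single)
  then show "lookup f k =
      lookup (\<Sum>m \<in> keys f. single m (lookup f m)) k"
    by (simp add: lookup_sum in_keys_iff)
qed

locale pm_hom =
  fixes h :: "'c::comm_ring_1 \<Rightarrow> 'k::comm_ring_1" and e :: "'m::comm_monoid_add \<Rightarrow> 'k"
  assumes h_0: "h 0 = 0" and h_1: "h 1 = 1" and h_add: "h (a + b) = h a + h b"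
    and h_mult: "h (a * b) = h a * h b"
    and e_0: "e 0 = 1" and e_add: "e (m + m') = e m * e m'"
begin

abbreviation "ev \<equiv> pm_eval h e"

lemma ev_superset:
  assumes "finite A" "keys f \<subseteq> A"
  shows "ev f = (\<Sum>m \<in> A. h (lookup f m) * e m)"
  unfolding pm_eval_def
  by (rule sum.mono_neutral_left) (use assms in \<open>auto simp: in_keys_iff h_0\<close>)

lemma ev_0: "ev 0 = 0"
  by (simp add: pm_eval_def)

lemma ev_single: "ev (single m c) = h c * e m"
  by (simp add: pm_eval_def h_0)

lemma ev_1: "ev 1 = 1"
  using ev_single[of 0 1] by (simp add: h_1 e_0)

lemma ev_add: "ev (f + g) = ev f + ev g"
proof -
  let ?A = "keys f \<union> keys g"
  have "ev (f + g) = (\<Sum>m \<in> ?A. h (lookup (f + g) m) * e m)"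
    by (rule ev_superset) (auto simp: Poly_Mapping.keys_add)
  also have "\<dots> = (\<Sum>m \<in> ?A. h (lookup f m) * e m) + (\<Sum>m \<in> ?A. h (lookup g m) * e m)"
    by (simp add: lookup_add h_add algebra_simps sum.distrib)
  also have "\<dots> = ev f + ev g"
    by (subst (1 2) ev_superset[of ?A]) auto
  finally show ?thesis .
qed

lemma ev_sum: "ev (\<Sum>a \<in> A. F a) = (\<Sum>a \<in> A. ev (F a))"
  by (induction A rule: infinite_finite_induct) (auto simp: ev_0 ev_add)

lemma ev_mult: "ev (f * g) = ev f * ev g"
proof -
  have "f * g = (\<Sum>a \<in> keys f. single a (lookup f a))
      * (\<Sum>b \<in> keys g. single b (lookup g b))"
    using poly_mapping_sum_singles[of f] poly_mapping_sum_singles[of g] by simp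
  also have "\<dots> = (\<Sum>a \<in> keys f. \<Sum>b \<in> keys g.
      single (a + b) (lookup f a * lookup g b))"
    by (simp add: sum_product mult_single)
  finally have "ev (f * g) = (\<Sum>a \<in> keys f. \<Sum>b \<in> keys g.
      h (lookup f a * lookup g b) * e (a + b))"
    by (simp add: ev_sum ev_single)
  also have "\<dots> = ev f * ev g"
    by (simp add: pm_eval_def sum_product h_mult e_add mult_ac)
  finally show ?thesis .
qed

lemma ev_uminus: "ev (- f) = - ev f"
  by (metis add.right_inverse add_eq_0_iff ev_0 ev_add)

lemma ev_diff: "ev (f - g) = ev f - ev g"
  by (metis ev_add ev_uminus uminus_add_conv_diff add.commute)

lemma ev_prod: "ev (\<Prod>a \<in> A. F a) = (\<Prod>a \<in> A. ev (F a))"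
  by (induction A rule: infinite_finite_induct) (auto simp: ev_1 ev_mult)

lemma ev_power: "ev (f ^ k) = ev f ^ k"
  by (induction k) (auto simp: ev_1 ev_mult)

end


section \<open>Coprimality in subrings of a field\<close>

definition is_subring :: "'k::field set \<Rightarrow> bool" where
  "is_subring L \<longleftrightarrow> 1 \<in> L \<and> (\<forall>a \<in> L. \<forall>b \<in> L. a + b \<in> L \<and> a * b \<in> L \<and> - a \<in> L)"

text \<open>Here \<open>y\<close> ranges over the whole field. For nonzero elements of a factorial
  ring and \<open>y\<close> in its fraction field this is ordinary coprimality, but no factorization
  is involved.\<close>

definition coprime_in :: "'k::field set \<Rightarrow> 'k \<Rightarrow> 'k \<Rightarrow> bool" where
  "coprime_in L f g \<longleftrightarrow> (\<forall>y. f * y \<in> L \<and> g * y \<in> L \<longrightarrow> y \<in> L)"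

lemma coprime_inD: "coprime_in L f g \<Longrightarrow> f * y \<in> L \<Longrightarrow> g * y \<in> L \<Longrightarrow> y \<in> L"
  unfolding coprime_in_def by blast

lemma coprime_in_commute: "coprime_in L f g \<longleftrightarrow> coprime_in L g f"
  unfolding coprime_in_def by blast

context
  fixes L :: "'k::field set"
  assumes L: "is_subring L"
begin

lemma subring_1: "1 \<in> L"
  and subring_add: "a \<in> L \<Longrightarrow> b \<in> L \<Longrightarrow> a + b \<in> L"
  and subring_mult: "a \<in> L \<Longrightarrow> b \<in> L \<Longrightarrow> a * b \<in> L"
  and subring_uminus: "a \<in> L \<Longrightarrow> - a \<in> L"
  using L by (auto simp: is_subring_def)

lemma subring_diff: "a \<in> L \<Longrightarrow> b \<in> L \<Longrightarrow> a - b \<in> L"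
  using subring_add[of a "- b"] subring_uminus by simp

lemma subring_0: "0 \<in> L"
  using subring_diff[OF subring_1 subring_1] by simp

lemma subring_power: "a \<in> L \<Longrightarrow> a ^ k \<in> L"
  by (induction k) (auto intro: subring_1 subring_mult)

lemma subring_prod: "(\<And>i. i \<in> A \<Longrightarrow> f i \<in> L) \<Longrightarrow> (\<Prod>i \<in> A. f i) \<in> L"
  by (induction A rule: infinite_finite_induct) (auto intro: subring_1 subring_mult)

lemma subring_sum: "(\<And>i. i \<in> A \<Longrightarrow> f i \<in> L) \<Longrightarrow> (\<Sum>i \<in> A. f i) \<in> L"
  by (induction A rule: infinite_finite_induct) (auto intro: subring_0 subring_add)

lemma subring_of_nat: "of_nat k \<in> L"
  by (induction k) (auto intro: subring_0 subring_1 subring_add)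

lemma subring_of_int: "of_int k \<in> L"
  by (cases k) (auto intro: subring_of_nat subring_uminus simp del: of_nat_Suc)

text \<open>The denominator is cleared one factor at a time: \<open>f\<close> and \<open>g'\<close>
  put \<open>g * y\<close> into \<open>L\<close>, then \<open>f\<close> and \<open>g\<close> put
  \<open>y\<close> into \<open>L\<close>.\<close>

lemma coprime_in_mult:
  assumes "coprime_in L f g" "coprime_in L f g'" "g \<in> L"
  shows "coprime_in L f (g * g')"
  unfolding coprime_in_def
proof (intro allI impI)
  fix y assume y: "f * y \<in> L \<and> g * g' * y \<in> L"
  have "g * (f * y) \<in> L" using assms(3) y subring_mult by blast
  then have "f * (g * y) \<in> L" by (simp add: mult_ac)
  moreover have "g' * (g * y) \<in> L" using y by (simp add: mult_ac)
  ultimately have "g * y \<in> L" using assms(2) coprime_inD by blast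
  then show "y \<in> L" using assms(1) y coprime_inD by blast
qed

lemma coprime_in_1: "coprime_in L f 1"
  by (simp add: coprime_in_def)

lemma coprime_in_power: "coprime_in L f g \<Longrightarrow> g \<in> L \<Longrightarrow> coprime_in L f (g ^ k)"
  by (induction k) (auto intro: coprime_in_1 coprime_in_mult)

lemma coprime_in_powers:
  assumes "coprime_in L f g" "f \<in> L" "g \<in> L"
  shows "coprime_in L (f ^ k) (g ^ l)"
  using assms coprime_in_power coprime_in_commute by blast

lemma coprime_in_prod:
  assumes "\<And>i. i \<in> A \<Longrightarrow> coprime_in L f (g i)" "\<And>i. i \<in> A \<Longrightarrow> g i \<in> L"
  shows "coprime_in L f (\<Prod>i \<in> A. g i)"
  using assms by (induction A rule: infinite_finite_induct) (auto intro: coprime_in_1 coprime_in_mult)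

text \<open>A Bezout identity whose right side has its inverse in \<open>L\<close>, multiplied by
  \<open>y\<close>, exhibits \<open>y\<close> as an element of \<open>L\<close>.\<close>

lemma coprime_in_comaximal:
  assumes "a * f + b * g = u" "inverse u \<in> L" "u \<noteq> 0" "a \<in> L" "b \<in> L"
  shows "coprime_in L f g"
  unfolding coprime_in_def
proof (intro allI impI)
  fix y assume y: "f * y \<in> L \<and> g * y \<in> L"
  have "y = inverse u * (a * (f * y) + b * (g * y))"
    using assms(3) by (simp add: assms(1)[symmetric] field_simps)
  then show "y \<in> L"
    using y assms by (metis subring_add subring_mult)
qed

lemma coprime_in_unit_left:
  assumes "coprime_in L f g" "u \<noteq> 0" "inverse u \<in> L"
  shows "coprime_in L (u * f) g"
  unfolding coprime_in_def
proof (intro allI impI)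
  fix y assume y: "u * f * y \<in> L \<and> g * y \<in> L"
  have "f * y = inverse u * (u * f * y)" using assms(2) by simp
  then have "f * y \<in> L" using y assms(3) subring_mult by metis
  then show "y \<in> L" using y assms(1) coprime_inD by blast
qed

lemma coprime_in_unit:
  assumes "u \<noteq> 0" "inverse u \<in> L"
  shows "coprime_in L f u"
  by (rule coprime_in_comaximal[of 0 _ 1 _ u]) (use assms subring_0 subring_1 in auto)

end


section \<open>Rings of Laurent polynomials\<close>

inductive_set laurent :: "('v \<Rightarrow> 'k::field) \<Rightarrow> 'v set \<Rightarrow> 'k set" for x V where
  one: "1 \<in> laurent x V"
| gen: "u \<in> V \<Longrightarrow> x u \<in> laurent x V"
| inv: "u \<in> V \<Longrightarrow> inverse (x u) \<in> laurent x V"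
| add: "a \<in> laurent x V \<Longrightarrow> b \<in> laurent x V \<Longrightarrow> a + b \<in> laurent x V"
| mult: "a \<in> laurent x V \<Longrightarrow> b \<in> laurent x V \<Longrightarrow> a * b \<in> laurent x V"
| uminus: "a \<in> laurent x V \<Longrightarrow> - a \<in> laurent x V"

lemma is_subring_laurent: "is_subring (laurent x V)"
  by (auto simp: is_subring_def intro: laurent.intros)

text \<open>Each inverse generator costs one factor \<open>Q\<close>, and the powers needed for two
  elements add up to one that serves their sum and their product.\<close>

lemma laurent_denominator:
  assumes L: "is_subring L" and gen: "\<And>u. u \<in> V \<Longrightarrow> x u \<in> L" and Q: "Q \<in> L"
    and inv: "\<And>u. u \<in> V \<Longrightarrow> inverse (x u) * Q \<in> L" and y: "y \<in> laurent x V"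
  shows "\<exists>N. y * Q ^ N \<in> L"
  using y
proof induction
  case one
  show ?case by (rule exI[of _ 0]) (simp add: subring_1[OF L])
next
  case (gen u)
  then show ?case using assms(2) by (intro exI[of _ 0]) simp
next
  case (inv u)
  then show ?case using assms(4) by (intro exI[of _ 1]) simp
next
  case (add a b)
  then obtain M N where "a * Q ^ M \<in> L" "b * Q ^ N \<in> L" by blast
  then have "(a * Q ^ M) * Q ^ N + (b * Q ^ N) * Q ^ M \<in> L"
    using subring_add[OF L] subring_mult[OF L] subring_power[OF L Q] by blast
  then show ?case by (intro exI[of _ "M + N"]) (simp add: power_add algebra_simps)
next
  case (mult a b)
  then obtain M N where "a * Q ^ M \<in> L" "b * Q ^ N \<in> L" by blast
  then have "(a * Q ^ M) * (b * Q ^ N) \<in> L" using subring_mult[OF L] by blast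
  then show ?case by (intro exI[of _ "M + N"]) (simp add: power_add algebra_simps)
next
  case (uminus a)
  then obtain M where "a * Q ^ M \<in> L" by blast
  then show ?case using subring_uminus[OF L] by (intro exI[of _ M]) fastforce
qed

section \<open>Integer Laurent polynomials and their values\<close>

definition laurent_monom :: "('v \<Rightarrow> 'k::field) \<Rightarrow> 'v set \<Rightarrow> ('v \<Rightarrow>\<^sub>0 int) \<Rightarrow> 'k" where
  "laurent_monom x V g = (\<Prod>u \<in> V. x u powi lookup g u)"

definition laurent_polys :: "'v set \<Rightarrow> (('v \<Rightarrow>\<^sub>0 int) \<Rightarrow>\<^sub>0 int) set" where
  "laurent_polys V = {f. \<forall>g \<in> keys f. keys g \<subseteq> V}"

abbreviation laurent_eval :: "('v \<Rightarrow> 'k::field) \<Rightarrow> 'v set \<Rightarrow> (('v \<Rightarrow>\<^sub>0 int) \<Rightarrow>\<^sub>0 int) \<Rightarrow> 'k" where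
  "laurent_eval x V \<equiv> pm_eval of_int (laurent_monom x V)"

text \<open>For nonzero \<open>x u\<close> this agrees with independence tested on polynomials,
  since a monomial clears negative exponents. Constants are among the test polynomials, so the field
  has characteristic 0.\<close>

definition alg_independent :: "('v \<Rightarrow> 'k::field) \<Rightarrow> 'v set \<Rightarrow> bool" where
  "alg_independent x V \<longleftrightarrow> (\<forall>u \<in> V. x u \<noteq> 0) \<and>
     (\<forall>f \<in> laurent_polys V. laurent_eval x V f = 0 \<longrightarrow> f = 0)"

lemma laurent_polys_single:
  "keys g \<subseteq> V \<Longrightarrow> single g c \<in> laurent_polys V"
  by (auto simp: laurent_polys_def split: if_splits)

lemma laurent_polys_1: "1 \<in> laurent_polys V"
  using laurent_polys_single[of 0 V 1] by simp

lemma laurent_polys_add: "f \<in> laurent_polys V \<Longrightarrow> g \<in> laurent_polys V \<Longrightarrow> f + g \<in> laurent_polys V"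
  using Poly_Mapping.keys_add[of f g] by (auto simp: laurent_polys_def)

lemma laurent_polys_uminus: "f \<in> laurent_polys V \<Longrightarrow> - f \<in> laurent_polys V"
  by (simp add: laurent_polys_def)

lemma laurent_polys_diff: "f \<in> laurent_polys V \<Longrightarrow> g \<in> laurent_polys V \<Longrightarrow> f - g \<in> laurent_polys V"
  using laurent_polys_add[of f V "- g"] laurent_polys_uminus[of g V] by simp

lemma laurent_polys_mult:
  assumes "f \<in> laurent_polys V" "g \<in> laurent_polys V" shows "f * g \<in> laurent_polys V"
  unfolding laurent_polys_def
proof (intro CollectI ballI)
  fix m assume "m \<in> keys (f * g)"
  then obtain a b where ab: "a \<in> keys f" "b \<in> keys g" "m = a + b"
    using Poly_Mapping.keys_mult[of f g] by blast
  then show "keys m \<subseteq> V"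
    using assms Poly_Mapping.keys_add[of a b] by (fastforce simp: laurent_polys_def)
qed

lemma laurent_polys_power: "f \<in> laurent_polys V \<Longrightarrow> f ^ k \<in> laurent_polys V"
  by (induction k) (auto intro: laurent_polys_1 laurent_polys_mult)

lemma laurent_polys_sum: "(\<And>i. i \<in> A \<Longrightarrow> f i \<in> laurent_polys V) \<Longrightarrow> (\<Sum>i \<in> A. f i) \<in> laurent_polys V"
proof (induction A rule: infinite_finite_induct)
  case (insert a A)
  then show ?case by (auto intro: laurent_polys_add)
qed (auto simp: laurent_polys_def)

context
  fixes x :: "'v \<Rightarrow> 'k::field" and V :: "'v set"
  assumes fin: "finite V" and nz: "\<And>u. u \<in> V \<Longrightarrow> x u \<noteq> 0"
begin

lemma pm_hom_laurent: "pm_hom (of_int :: int \<Rightarrow> 'k) (laurent_monom x V)"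
proof
  fix a b :: "'v \<Rightarrow>\<^sub>0 int"
  show "laurent_monom x V (a + b) = laurent_monom x V a * laurent_monom x V b"
    unfolding laurent_monom_def
    by (subst prod.distrib[symmetric], rule prod.cong) (auto simp: lookup_add power_int_add nz)
qed (auto simp: laurent_monom_def)

interpretation pm_hom "of_int :: int \<Rightarrow> 'k" "laurent_monom x V" by (rule pm_hom_laurent)

lemma laurent_monom_single:
  assumes "u \<in> V" shows "laurent_monom x V (single u k) = x u powi k"
proof -
  have "laurent_monom x V (single u k) = (\<Prod>v \<in> V. if v = u then x u powi k else 1)"
    unfolding laurent_monom_def by (rule prod.cong) (auto simp: lookup_single when_def)
  then show ?thesis using fin assms by simp
qed

lemma laurent_monom_in: "laurent_monom x V g \<in> laurent x V"
  unfolding laurent_monom_def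
proof (rule subring_prod[OF is_subring_laurent])
  fix u assume u: "u \<in> V"
  have "x u ^ k \<in> laurent x V" "inverse (x u) ^ k \<in> laurent x V" for k
    using u by (auto intro: subring_power[OF is_subring_laurent] laurent.intros)
  then show "x u powi lookup g u \<in> laurent x V"
    by (auto simp: power_int_def)
qed

lemma laurent_eval_in: "laurent_eval x V f \<in> laurent x V"
  unfolding pm_eval_def
  by (intro subring_sum[OF is_subring_laurent] subring_mult[OF is_subring_laurent]
      subring_of_int[OF is_subring_laurent] laurent_monom_in)

lemma laurent_eval_surj:
  assumes "y \<in> laurent x V" shows "\<exists>f \<in> laurent_polys V. y = laurent_eval x V f"
  using assms
proof induction
  case one
  show ?case using ev_1 laurent_polys_1 by metis
next
  case (gen u)
  have "laurent_eval x V (single (single u 1) 1) = x u"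
    by (simp add: ev_single laurent_monom_single gen)
  then show ?case using gen laurent_polys_single[of "single u 1" V 1]
    by (metis empty_subsetI insert_subset keys_single one_neq_zero)
next
  case (inv u)
  have "laurent_eval x V (single (single u (-1)) 1) = inverse (x u)"
    by (simp add: ev_single laurent_monom_single inv power_int_minus)
  then show ?case using inv laurent_polys_single[of "single u (-1)" V 1]
    by (metis empty_subsetI insert_subset keys_single zero_neq_neg_one)
next
  case (add a b)
  then show ?case by (metis ev_add laurent_polys_add)
next
  case (mult a b)
  then show ?case by (metis ev_mult laurent_polys_mult)
next
  case (uminus a)
  then show ?case by (metis ev_uminus laurent_polys_uminus)
qed

end

text \<open>Modulo \<open>1 + t\<^sup>\<alpha>\<close> the polynomial \<open>H\<close> equals \<open>(- t\<^sup>\<beta>)\<^sup>k H\<close>. For suitable \<open>k\<close> the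
  supports of the two lie in different cosets of the exponents modulo \<open>\<int> \<alpha>\<close>; restricting the quotient
  of their difference by \<open>1 + t\<^sup>\<alpha>\<close> to the cosets meeting the support of \<open>H\<close> divides \<open>H\<close> itself.\<close>

lemma binomial_divides:
  fixes H G :: "('v \<Rightarrow>\<^sub>0 int) \<Rightarrow>\<^sub>0 int"
  assumes indep: "\<forall>i j. frag_cmul i \<alpha> = frag_cmul j \<beta> \<longrightarrow> j = 0"
    and eq: "(1 + single \<beta> 1) * H = (1 + single \<alpha> 1) * G"
    and V: "keys \<beta> \<subseteq> V" "G \<in> laurent_polys V"
  shows "\<exists>H' \<in> laurent_polys V. H = (1 + single \<alpha> 1) * H'"
proof -
  define s :: "('v \<Rightarrow>\<^sub>0 int) \<Rightarrow>\<^sub>0 int" where "s = single \<beta> 1"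
  define t :: "('v \<Rightarrow>\<^sub>0 int) \<Rightarrow>\<^sub>0 int" where "t = single \<alpha> 1"
  \<comment> \<open>\<open>bad (a, b)\<close> collects the shifts \<open>k\<close> for which
    \<open>a\<close> moved by \<open>k\<close> times \<beta> lands in the coset of \<open>b\<close>
    modulo \<alpha>. By \<open>indep\<close> each pair has at most one, so some \<open>k\<close> is
    bad for no pair of exponents of \<open>H\<close>.\<close>
  define bad where "bad = (\<lambda>(a, b). {k::nat. \<exists>i. frag_cmul (int k) \<beta> + a - b = frag_cmul i \<alpha>})"
  have bad: "finite (bad p)" for p
  proof -
    obtain a b where p: "p = (a, b)" by force
    have "k = l" if "k \<in> bad p" "l \<in> bad p" for k l
    proof -
      obtain i j where ij: "frag_cmul (int k) \<beta> + a - b = frag_cmul i \<alpha>"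
        "frag_cmul (int l) \<beta> + a - b = frag_cmul j \<alpha>"
        using \<open>k \<in> bad p\<close> \<open>l \<in> bad p\<close> by (auto simp: bad_def p)
      have "frag_cmul (i - j) \<alpha> = frag_cmul (int k - int l) \<beta>"
        unfolding frag_cmul_diff_distrib ij[symmetric] frag_cmul_distrib
        by (simp add: left_diff_distrib poly_mapping_eq_iff fun_eq_iff lookup_minus)
      then show ?thesis using indep by force
    qed
    then have "bad p = {} \<or> (\<exists>k. bad p \<subseteq> {k})" by blast
    then show ?thesis using finite_subset by fastforce
  qed
  have "finite (\<Union>p \<in> keys H \<times> keys H. bad p)"
    using bad by auto
  then obtain k where k: "k \<notin> (\<Union>p \<in> keys H \<times> keys H. bad p)"
    using ex_new_if_finite infinite_UNIV_nat by blast
  define Gk where "Gk = (\<Sum>i<k. (- s) ^ i) * G"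
  have "(1 - (- s) ^ k) = (1 + s) * (\<Sum>i<k. (- s) ^ i)"
    using one_diff_power_eq[of "- s" k] by simp
  then have "(1 - (- s) ^ k) * H = (\<Sum>i<k. (- s) ^ i) * ((1 + s) * H)"
    by (simp add: mult_ac)
  also have "\<dots> = (1 + t) * Gk"
    using eq by (simp add: Gk_def s_def t_def mult_ac)
  finally have HG: "H - (- s) ^ k * H = (1 + t) * Gk"
    by (simp add: algebra_simps)
  have sk: "(- s) ^ k = single (frag_cmul (int k) \<beta>) ((-1) ^ k)" for k
  proof (induction k)
    case (Suc k)
    then show ?case
      by (simp add: s_def single_uminus mult_single frag_cmul_distrib[of 1 "int k"] add.commute flip: single_uminus)
  qed simp
  \<comment> \<open>The union of the cosets that meet the support of \<open>H\<close>. It is stable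
    under translation by \<alpha>, so discarding all terms outside \<open>C\<close> commutes with
    multiplication by \<open>1 + t\<close>.\<close>
  define C where "C = {c. \<exists>b \<in> keys H. \<exists>i. c = b + frag_cmul i \<alpha>}"
  have C: "c + \<alpha> \<in> C \<longleftrightarrow> c \<in> C" for c
  proof
    assume "c + \<alpha> \<in> C"
    then obtain b i where bi: "b \<in> keys H" "c + \<alpha> = b + frag_cmul i \<alpha>" by (auto simp: C_def)
    then have "c = b + frag_cmul (i - 1) \<alpha>"
      by (simp add: frag_cmul_diff_distrib poly_mapping_eq_iff fun_eq_iff lookup_add lookup_minus algebra_simps)
    then show "c \<in> C" using bi by (auto simp: C_def)
  next
    assume "c \<in> C"
    then obtain b i where bi: "b \<in> keys H" "c = b + frag_cmul i \<alpha>" by (auto simp: C_def)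
    then have "c + \<alpha> = b + frag_cmul (i + 1) \<alpha>" by (simp add: frag_cmul_distrib add_ac)
    then show "c + \<alpha> \<in> C" using bi(1) unfolding C_def by blast
  qed
  define H' where "H' = Poly_Mapping.mapp (\<lambda>c a. if c \<in> C then a else 0) Gk"
  have lookup_H': "lookup H' c = (if c \<in> C then lookup Gk c else 0)" for c
    by (simp add: H'_def lookup_mapp in_keys_iff when_def)
  have lookup_single_mult: "lookup (single a q * F) c = q * lookup F (c - a)"
    for a q c and F :: "('v \<Rightarrow>\<^sub>0 int) \<Rightarrow>\<^sub>0 int"
  proof -
    have "(\<Sum>r. lookup F r when c = l + r) = lookup F (c - l)" for l
    proof -
      have "(\<Sum>r. lookup F r when c = l + r) = (\<Sum>r. lookup F r when r = c - l)"
        by (rule Sum_any.cong) (auto simp: when_def algebra_simps)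
      then show ?thesis by simp
    qed
    then show ?thesis
      by (simp add: lookup_mult lookup_single when_mult)
  qed
  have "H = (1 + t) * H'"
  proof (rule poly_mapping_eqI)
    fix c
    have 1: "lookup ((1 + t) * F) c = lookup F c + lookup F (c - \<alpha>)" for F
      by (simp add: distrib_right lookup_add t_def lookup_single_mult)
    show "lookup H c = lookup ((1 + t) * H') c"
    proof (cases "c \<in> C")
      case True
      then have "c - \<alpha> \<in> C" using C[of "c - \<alpha>"] by simp
      then have "lookup ((1 + t) * H') c = lookup ((1 + t) * Gk) c"
        using True by (simp add: 1 lookup_H')
      also have "\<dots> = lookup H c - (-1) ^ k * lookup H (c - frag_cmul (int k) \<beta>)"
        by (simp add: HG[symmetric] lookup_minus sk lookup_single_mult)
      also have "lookup H (c - frag_cmul (int k) \<beta>) = 0"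
      proof (rule ccontr)
        assume "lookup H (c - frag_cmul (int k) \<beta>) \<noteq> 0"
        then have a: "c - frag_cmul (int k) \<beta> \<in> keys H" by (simp add: in_keys_iff)
        obtain b i where b: "b \<in> keys H" "c = b + frag_cmul i \<alpha>" using True by (auto simp: C_def)
        have "frag_cmul (int k) \<beta> + (c - frag_cmul (int k) \<beta>) - b = frag_cmul i \<alpha>"
          using b(2) by simp
        then have "k \<in> bad (c - frag_cmul (int k) \<beta>, b)" by (auto simp: bad_def)
        then show False using k a b(1) by blast
      qed
      finally show ?thesis by simp
    next
      case False
      then have "c - \<alpha> \<notin> C" using C[of "c - \<alpha>"] by simp
      moreover have "lookup H c = 0"
      proof (rule ccontr)
        assume "lookup H c \<noteq> 0"
        then have "c \<in> keys H" by (simp add: in_keys_iff)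
        moreover have "c = c + frag_cmul 0 \<alpha>" by simp
        ultimately have "c \<in> C" unfolding C_def by blast
        then show False using False by simp
      qed
      ultimately show ?thesis using False by (simp add: 1 lookup_H')
    qed
  qed
  moreover have "H' \<in> laurent_polys V"
  proof -
    have "s \<in> laurent_polys V" unfolding s_def using V(1) by (rule laurent_polys_single)
    then have "Gk \<in> laurent_polys V"
      unfolding Gk_def by (intro laurent_polys_mult laurent_polys_sum laurent_polys_power laurent_polys_uminus V(2))
    then show ?thesis
      using keys_mapp_subset[of "\<lambda>c a. if c \<in> C then a else 0" Gk] unfolding H'_def laurent_polys_def by blast
  qed
  ultimately show ?thesis by (auto simp: t_def)
qed

text \<open>Let \<open>H\<close> and \<open>G\<close> represent the two products with
  \<open>y\<close>. Independence of the variables lifts the crosswise equation between them to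
  Laurent polynomials; then \<open>binomial_divides\<close> divides \<open>H\<close> by its
  binomial, and the quotient represents \<open>y\<close>.\<close>

lemma coprime_in_laurent_binomials:
  fixes x :: "'v \<Rightarrow> 'k::field"
  assumes fin: "finite V" and ind: "alg_independent x V"
    and V: "keys \<alpha> \<subseteq> V" "keys \<beta> \<subseteq> V"
    and nz: "\<alpha> \<noteq> 0"
    and indep: "\<forall>i j. frag_cmul i \<alpha> = frag_cmul j \<beta> \<longrightarrow> j = 0"
  shows "coprime_in (laurent x V) (1 + laurent_monom x V \<alpha>) (1 + laurent_monom x V \<beta>)"
  unfolding coprime_in_def
proof (intro allI impI)
  fix y assume y: "(1 + laurent_monom x V \<alpha>) * y \<in> laurent x V \<and> (1 + laurent_monom x V \<beta>) * y \<in> laurent x V"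
  have x0: "x u \<noteq> 0" if "u \<in> V" for u using ind that by (auto simp: alg_independent_def)
  interpret pm_hom "of_int :: int \<Rightarrow> 'k" "laurent_monom x V" by (rule pm_hom_laurent[of V x, OF fin x0])
  obtain H where H: "H \<in> laurent_polys V" "(1 + laurent_monom x V \<alpha>) * y = ev H"
    using laurent_eval_surj[of V x, OF fin x0, where y = "(1 + laurent_monom x V \<alpha>) * y"] y by blast
  obtain G where G: "G \<in> laurent_polys V" "(1 + laurent_monom x V \<beta>) * y = ev G"
    using laurent_eval_surj[of V x, OF fin x0, where y = "(1 + laurent_monom x V \<beta>) * y"] y by blast
  let ?t = "1 + single \<alpha> 1" and ?s = "1 + single \<beta> 1"
  have t: "?t \<in> laurent_polys V" "?s \<in> laurent_polys V"
    using V by (auto intro: laurent_polys_add laurent_polys_1 laurent_polys_single)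
  have evt: "ev ?t = 1 + laurent_monom x V \<alpha>" "ev ?s = 1 + laurent_monom x V \<beta>"
    by (auto simp: ev_add ev_1 ev_single)
  have "ev (?s * H - ?t * G) = 0"
    by (simp add: ev_diff ev_mult evt H(2)[symmetric] G(2)[symmetric])
  moreover have "?s * H - ?t * G \<in> laurent_polys V"
    using t H G by (intro laurent_polys_diff laurent_polys_mult)
  ultimately have "?s * H - ?t * G = 0"
    using ind unfolding alg_independent_def by blast
  then have "?s * H = ?t * G" by simp
  from binomial_divides[of \<alpha> \<beta>, OF indep this V(2) G(1)] obtain H' where H': "H' \<in> laurent_polys V" "H = ?t * H'"
    by blast
  have "lookup ?t 0 = 1" using nz by (simp add: lookup_add lookup_single when_def)
  then have "?t \<noteq> 0" by (metis lookup_zero zero_neq_one)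
  then have "ev ?t \<noteq> 0" using ind t unfolding alg_independent_def by blast
  moreover have "ev ?t * y = ev ?t * ev H'" using H H' by (simp add: evt ev_mult)
  ultimately have "y = ev H'" by simp
  then show "y \<in> laurent x V" using laurent_eval_in[of V x, OF fin x0] by simp
qed


section \<open>The Laurent phenomenon\<close>

lemma verts_mutate [simp]: "verts (mutate v S) = verts S"
  and mutable_mutate [simp]: "mutable_verts (mutate v S) = mutable_verts S"
  by (auto simp: mutate_def verts_def)

lemma cvar_mutate_other: "u \<noteq> v \<Longrightarrow> cvar (mutate v S) u = cvar S u"
  by (simp add: mutate_def)

lemma mutable_subset_verts: "mutable_verts S \<subseteq> verts S"
  by (auto simp: verts_def)

definition skew :: "('v, 'k) seed \<Rightarrow> bool" where
  "skew S \<longleftrightarrow> (\<forall>a b. mult S a b = - mult S b a)"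

lemma skewD: "skew S \<Longrightarrow> mult S a b = - mult S b a"
  unfolding skew_def by blast

lemma skew_diag: "skew S \<Longrightarrow> mult S a a = 0"
  using skewD[of S a a] by simp

text \<open>The two monomials of the exchange relation at \<open>v\<close> are those for \<open>e = 1\<close> (arrows into \<open>v\<close>) and
  \<open>e = - 1\<close> (arrows out of \<open>v\<close>).\<close>

definition exchange_monom :: "int \<Rightarrow> ('v, 'k::field) seed \<Rightarrow> 'v \<Rightarrow> 'v set \<Rightarrow> 'k" where
  "exchange_monom e S v W = (\<Prod>u \<in> W. cvar S u ^ nat (e * mult S u v))"

lemma exchange_monoms:
  assumes "finite (verts S)" "skew S"
  shows "cvar (mutate v S) v =
    (exchange_monom 1 S v (verts S) + exchange_monom (-1) S v (verts S)) / cvar S v"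
proof -
  have sk: "mult S v = (\<lambda>u. - mult S u v)" using skewD[OF assms(2)] by blast
  have "(\<Prod>u \<in> in_nbrs S v. cvar S u ^ nat (mult S u v)) = exchange_monom 1 S v (verts S)"
    unfolding exchange_monom_def in_nbrs_def
    by (rule prod.mono_neutral_cong_left) (use assms in \<open>auto simp: not_less\<close>)
  moreover have "(\<Prod>u \<in> out_nbrs S v. cvar S u ^ nat (mult S v u)) = exchange_monom (-1) S v (verts S)"
    unfolding exchange_monom_def out_nbrs_def
    unfolding sk by (rule prod.mono_neutral_cong_left) (use assms in \<open>auto simp: not_less\<close>)
  ultimately show ?thesis by (simp add: mutate_def)
qed

lemma exchange_monoms_signed:
  assumes "finite (verts S)" "skew S" "e = 1 \<or> e = -1" "cvar S v \<noteq> 0"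
  shows "cvar (mutate v S) v * cvar S v =
    exchange_monom e S v (verts S) + exchange_monom (- e) S v (verts S)"
  using assms(3,4) by (auto simp: exchange_monoms[OF assms(1,2)] add.commute)

lemma mult_mutate_diag: "mult (mutate v S) v b = - mult S v b" "mult (mutate v S) a v = - mult S a v"
  by (auto simp: mutate_def)

text \<open>If the entries \<open>mult S a v\<close> and \<open>mult S v b\<close> have opposite
  signs, the two correction terms cancel; if the signs agree, exactly one of them survives. This is
  the condition on paths through \<open>v\<close>, free of case distinctions.\<close>

lemma mult_mutate:
  assumes "skew S" "a \<in> verts S" "b \<in> verts S" "a \<noteq> v" "b \<noteq> v"
  shows "mult (mutate v S) a b = mult S a b + int (nat (mult S a v)) * mult S v b
    + mult S a v * int (nat (- mult S v b))"
proof -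
  have "mult S a v = - mult S v a" "mult S v b = - mult S b v" using skewD[OF assms(1)] by blast+
  then show ?thesis
    using assms by (auto simp: mutate_def in_nbrs_def out_nbrs_def)
qed

text \<open>Reversing all arrows commutes with mutation. The sign \<open>e\<close> therefore allows
  the arrows between \<open>j\<close> and \<open>k\<close> to be treated as if their orientation
  were fixed.\<close>

lemma mult_mutate_signed:
  assumes "skew S" "u \<in> verts S" "k \<in> verts S" "u \<noteq> j" "k \<noteq> j"
    and e: "e = 1 \<or> e = -1" "e * mult S k j > 0"
  shows "e * mult (mutate j S) u k = e * mult S u k - (e * mult S k j) * int (nat (e * mult S j u))"
proof -
  have "mult S u j = - mult S j u" "mult S j k = - mult S k j" using skewD[OF assms(1)] by blast+
  then show ?thesis
    using mult_mutate[OF assms(1-5)] e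
    by (cases "mult S j u" "0::int" rule: linorder_cases) (auto simp: algebra_simps)
qed

lemma skew_mutate:
  assumes "skew S" shows "skew (mutate v S)"
proof -
  have "\<not> (a \<in> in_nbrs S v \<and> a \<in> out_nbrs S v)" for a
    using skewD[OF assms, of a v] by (auto simp: in_nbrs_def out_nbrs_def)
  then have "mult (mutate v S) a b = - mult (mutate v S) b a" for a b
    using skewD[OF assms, of a b] skewD[OF assms, of a v] skewD[OF assms, of b v]
    by (auto simp: mutate_def)
  then show ?thesis unfolding skew_def by blast
qed

lemma mutate_involution:
  fixes S :: "('a, 'b::field) seed"
  assumes "skew S" "cvar S v \<noteq> 0" "cvar (mutate v S) v \<noteq> 0" "finite (verts S)"
  shows "mutate v (mutate v S) = S"
proof -
  let ?S' = "mutate v S"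
  have sk: "mult S u v < 0 \<longleftrightarrow> mult S v u > 0" for u using skewD[OF assms(1), of u v] by linarith
  have sk': "mult S v u < 0 \<longleftrightarrow> mult S u v > 0" for u using skewD[OF assms(1), of u v] by linarith
  have in': "in_nbrs ?S' v = out_nbrs S v" and out': "out_nbrs ?S' v = in_nbrs S v"
    by (auto simp: in_nbrs_def out_nbrs_def mult_mutate_diag sk sk')
  have "mult (mutate v ?S') a b = mult S a b" for a b
  proof -
    have "mult S a v = - mult S v a" "mult S v b = - mult S b v" using skewD[OF assms(1)] by blast+
    moreover have "\<not> (a \<in> in_nbrs S v \<and> a \<in> out_nbrs S v)" "\<not> (b \<in> in_nbrs S v \<and> b \<in> out_nbrs S v)"
      using skewD[OF assms(1), of a v] skewD[OF assms(1), of b v] by (auto simp: in_nbrs_def out_nbrs_def)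
    ultimately show ?thesis
      unfolding mutate_def[of v ?S'] in' out' by (auto simp: mutate_def mult_ac)
  qed
  moreover have "cvar (mutate v ?S') u = cvar S u" for u
  proof (cases "u = v")
    case False
    then show ?thesis by (simp add: cvar_mutate_other)
  next
    case True
    have e: "exchange_monom e ?S' v (verts S) = exchange_monom (- e) S v (verts S)" for e
      unfolding exchange_monom_def
    proof (rule prod.cong[OF refl])
      fix u
      show "cvar ?S' u ^ nat (e * mult ?S' u v) = cvar S u ^ nat (- e * mult S u v)"
        by (cases "u = v") (auto simp: cvar_mutate_other mult_mutate_diag skew_diag[OF assms(1)])
    qed
    have "cvar (mutate v ?S') v = (exchange_monom 1 S v (verts S) + exchange_monom (-1) S v (verts S)) / cvar ?S' v"
      using exchange_monoms[of ?S' v] skew_mutate[OF assms(1)] assms(4) by (simp add: e add.commute)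
    moreover have "a \<noteq> 0 \<Longrightarrow> b \<noteq> 0 \<Longrightarrow> a / (a / b) = b" for a b :: 'b by simp
    ultimately show ?thesis
      using True assms(2,3) exchange_monoms[OF assms(4,1), of v] by (metis div_0)
  qed
  ultimately show ?thesis
    by (intro seed.equality) (auto simp: fun_eq_iff mutate_def)
qed

section \<open>Rank of the exchange matrix\<close>

definition full_rank :: "('v, 'k) seed \<Rightarrow> bool" where
  "full_rank S \<longleftrightarrow> (\<forall>c :: 'v \<Rightarrow> int. (\<forall>u \<in> verts S. (\<Sum>j \<in> mutable_verts S. mult S u j * c j) = 0)
     \<longrightarrow> (\<forall>j \<in> mutable_verts S. c j = 0))"

text \<open>Mutation multiplies the exchange matrix on both sides by invertible integer matrices.
  The column operation carries a relation between the new columns to one between the old columns,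
  and the equation of row \<open>k\<close> absorbs the row operation.\<close>

lemma full_rank_mutate:
  assumes "skew S" "finite (verts S)" "full_rank S" and k: "k \<in> mutable_verts S"
  shows "full_rank (mutate k S)"
  unfolding full_rank_def
proof (intro allI impI)
  fix c :: "'a \<Rightarrow> int"
  let ?M = "mutable_verts S" and ?b = "mult S"
  assume "\<forall>u \<in> verts (mutate k S). (\<Sum>j \<in> mutable_verts (mutate k S). mult (mutate k S) u j * c j) = 0"
  then have c: "(\<Sum>j \<in> ?M. mult (mutate k S) u j * c j) = 0" if "u \<in> verts S" for u
    using that by simp
  have finM: "finite ?M" using assms(2) mutable_subset_verts finite_subset by metis
  have kV: "k \<in> verts S" using k by (auto simp: verts_def)
  define M' where "M' = ?M - {k}"
  have M: "?M = insert k M'" "k \<notin> M'" "finite M'" using k finM by (auto simp: M'_def)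
  have k0: "(\<Sum>j \<in> M'. ?b k j * c j) = 0"
    using c[OF kV] skew_diag[OF assms(1), of k] by (simp add: M mult_mutate_diag sum_negf)
  \<comment> \<open>The column operation: up to row operations, the new column \<open>k\<close> is
    minus the old one, and the new column \<open>j\<close> contains the old column \<open>k\<close>
    with coefficient \<open>[- b_kj]_+\<close>.\<close>
  define c' where "c' = c(k := - c k + (\<Sum>j \<in> M'. int (nat (- ?b k j)) * c j))"
  have c': "(\<Sum>j \<in> M'. ?b u j * c' j) = (\<Sum>j \<in> M'. ?b u j * c j)" for u
    by (rule sum.cong) (use M in \<open>auto simp: c'_def\<close>)
  have "\<forall>u \<in> verts S. (\<Sum>j \<in> ?M. ?b u j * c' j) = 0"
  proof
    fix u assume u: "u \<in> verts S"
    show "(\<Sum>j \<in> ?M. ?b u j * c' j) = 0"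
    proof (cases "u = k")
      case True
      then show ?thesis using k0 skew_diag[OF assms(1), of k] by (simp add: M c')
    next
      case False
      have "0 = - ?b u k * c k + (\<Sum>j \<in> M'. mult (mutate k S) u j * c j)"
        using c[OF u] by (simp add: M mult_mutate_diag)
      also have "(\<Sum>j \<in> M'. mult (mutate k S) u j * c j)
          = (\<Sum>j \<in> M'. ?b u j * c j + int (nat (?b u k)) * (?b k j * c j) + ?b u k * (int (nat (- ?b k j)) * c j))"
      proof (rule sum.cong)
        fix j assume "j \<in> M'"
        then have "j \<in> verts S" "j \<noteq> k" using mutable_subset_verts[of S] by (auto simp: M'_def)
        then show "mult (mutate k S) u j * c j = ?b u j * c j + int (nat (?b u k)) * (?b k j * c j) + ?b u k * (int (nat (- ?b k j)) * c j)"
          using mult_mutate[OF assms(1) u _ False] by (simp add: algebra_simps)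
      qed simp
      also have "\<dots> = (\<Sum>j \<in> M'. ?b u j * c j) + ?b u k * (\<Sum>j \<in> M'. int (nat (- ?b k j)) * c j)"
        by (simp add: sum.distrib sum_distrib_left[symmetric] k0)
      finally have "?b u k * (- c k + (\<Sum>j \<in> M'. int (nat (- ?b k j)) * c j)) + (\<Sum>j \<in> M'. ?b u j * c j) = 0"
        by (simp add: algebra_simps)
      then show ?thesis using c'[of u] by (simp add: M c'_def)
    qed
  qed
  then have all0: "\<forall>j \<in> ?M. c' j = 0" using assms(3) unfolding full_rank_def by blast
  then have "c j = 0" if "j \<in> M'" for j using that M by (auto simp: c'_def split: if_splits)
  moreover from this have "c k = 0" using all0 k by (auto simp: c'_def)
  ultimately show "\<forall>j \<in> mutable_verts (mutate k S). c j = 0" by (auto simp: M)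
qed

lemma power_add_divides:
  assumes "is_subring L" "c \<in> L" "e \<in> L"
  shows "\<exists>q \<in> L. (c + e) ^ n = c ^ n + e * q"
proof (induction n)
  case 0
  show ?case by (rule bexI[of _ 0]) (auto simp: subring_0[OF assms(1)])
next
  case (Suc n)
  then obtain q where q: "q \<in> L" "(c + e) ^ n = c ^ n + e * q" by blast
  have "(c + e) ^ Suc n = c ^ Suc n + e * (c ^ n + c * q + e * q)"
    by (simp add: q(2) algebra_simps)
  moreover have "c ^ n + c * q + e * q \<in> L"
    using assms(2,3) q(1) by (intro subring_add[OF assms(1)] subring_mult[OF assms(1)] subring_power[OF assms(1)])
  ultimately show ?case by blast
qed

text \<open>Three consecutive exchange relations at \<open>k, j, k\<close>, where \<open>b\<close> is the number of arrows between
  \<open>j\<close> and \<open>k\<close>. The hypothesis on the monomials expresses the mutation rule for the arrows at \<open>k\<close>.\<close>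

lemma three_exchanges:
  assumes L: "is_subring L"
    and units: "\<And>a. a \<in> {x, y, A1, A2, B1, B2, C1, C2} \<Longrightarrow> a \<noteq> 0 \<and> a \<in> L \<and> inverse a \<in> L"
    and z: "z * x = y ^ b * A1 + A2" "z \<noteq> 0"
    and w: "w * y = z ^ b * B1 + B2"
    and x3: "x3 * z = w ^ b * C1 + C2"
    and mutation: "C1 * A1 * B2 ^ b = C2 * A2"
    and b: "b \<ge> 1"
  shows "z \<in> L" "w \<in> L" "x3 \<in> L" "coprime_in L z w" "b \<ge> 2 \<Longrightarrow> coprime_in L z x3"
    "b = 1 \<Longrightarrow> x3 * (y * A1 * B2) = C2 * (A2 * B1 + B2 * x)"
proof -
  note sub = subring_add[OF L] subring_mult[OF L] subring_power[OF L] subring_uminus[OF L] subring_diff[OF L]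
  have nz: "x \<noteq> 0" "y \<noteq> 0" "A1 \<noteq> 0" "A2 \<noteq> 0" "B1 \<noteq> 0" "B2 \<noteq> 0" "C1 \<noteq> 0" "C2 \<noteq> 0" using units by auto
  have inL: "x \<in> L" "y \<in> L" "A1 \<in> L" "A2 \<in> L" "B1 \<in> L" "B2 \<in> L" "C1 \<in> L" "C2 \<in> L" using units by auto
  have inv: "inverse x \<in> L" "inverse y \<in> L" "inverse A1 \<in> L" "inverse A2 \<in> L" "inverse B1 \<in> L" "inverse B2 \<in> L"
    "inverse C1 \<in> L" "inverse C2 \<in> L" using units by auto
  have "z = (y ^ b * A1 + A2) * inverse x" using z(1) nz by (simp add: field_simps)
  then show zL: "z \<in> L" using inL inv by (simp add: sub)
  have "w = (z ^ b * B1 + B2) * inverse y" using w nz by (simp add: field_simps)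
  then show wL: "w \<in> L" using inL inv zL by (simp add: sub)
  obtain b' where b': "b = Suc b'" using b by (cases b) auto
  \<comment> \<open>Modulo \<open>z\<close> the product \<open>y * w\<close> is the unit
    \<open>B2\<close>, because \<open>b\<close> is positive.\<close>
  have "- (z ^ b' * B1) * z + y * w = B2" using w by (simp add: b' algebra_simps)
  then show zw: "coprime_in L z w"
    by (rule coprime_in_comaximal[OF L]) (use nz inL inv zL in \<open>auto intro!: sub\<close>)
  have yw: "y * w \<in> L" "- (z ^ b * B1) \<in> L" by (intro sub inL zL wL)+
  \<comment> \<open>The relation for \<open>w\<close> raised to the power \<open>b\<close>:
    \<open>B2^b\<close> agrees with \<open>(y * w)^b\<close> modulo \<open>z^b\<close>. The power
    \<open>b\<close> is the one in which \<open>B2\<close> enters the mutation rule.\<close>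
  obtain q where q: "q \<in> L" "(y * w + - (z ^ b * B1)) ^ b = (y * w) ^ b + - (z ^ b * B1) * q"
    using power_add_divides[OF L, of "y * w" "- (z ^ b * B1)" b] yw by blast
  have B2b: "B2 ^ b = (y * w) ^ b - z ^ b * B1 * q"
    using q(2) w by (simp add: mult.commute)
  \<comment> \<open>Multiplication by the unit \<open>A1 * B2^b\<close> makes a factor
    \<open>z\<close> visible on the right: modulo \<open>z^b\<close> the bracket becomes
    \<open>w^b * (A2 + y^b * A1) = w^b * (z * x)\<close>.\<close>
  have "x3 * z * (A1 * B2 ^ b) = C2 * (w ^ b * A2 + A1 * B2 ^ b)"
  proof -
    have "x3 * z * (A1 * B2 ^ b) = w ^ b * (C1 * A1 * B2 ^ b) + C2 * A1 * B2 ^ b"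
      unfolding x3 by (simp add: algebra_simps)
    then show ?thesis unfolding mutation by (simp add: algebra_simps)
  qed
  also have "w ^ b * A2 + A1 * B2 ^ b = w ^ b * (z * x) - A1 * (z ^ b * B1 * q)"
    unfolding B2b using z(1) by (simp add: power_mult_distrib algebra_simps)
  finally have "z * (x3 * (A1 * B2 ^ b)) = z * (C2 * (w ^ b * x - A1 * B1 * z ^ b' * q))"
    by (simp add: b' algebra_simps)
  then have x3q: "x3 * (A1 * B2 ^ b) = C2 * (w ^ b * x - A1 * B1 * z ^ b' * q)"
    using z(2) by simp
  then have "x3 = C2 * (w ^ b * x - A1 * B1 * z ^ b' * q) * inverse A1 * inverse B2 ^ b"
    using nz by (simp add: field_simps)
  moreover have "\<dots> \<in> L" by (intro sub inL inv zL wL q)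
  ultimately show x3L: "x3 \<in> L" by simp
  \<comment> \<open>For these \<open>b\<close> the correction term in \<open>x3q\<close> still
    contains \<open>z\<close>, so modulo \<open>z\<close> the variable \<open>x3\<close> is a unit
    times \<open>w^b\<close>.\<close>
  show "coprime_in L z x3" if b2: "b \<ge> 2"
    unfolding coprime_in_def
  proof (intro allI impI)
    fix u assume u: "z * u \<in> L \<and> x3 * u \<in> L"
    obtain b'' where b'': "b' = Suc b''" using b2 b' by (cases b') auto
    have "C2 * w ^ b * x * u = x3 * u * (A1 * B2 ^ b) + C2 * A1 * B1 * z ^ b'' * q * (z * u)"
      using arg_cong[OF x3q, of "\<lambda>a. a * u"] by (simp add: b'' algebra_simps)
    then have "w ^ b * u = (x3 * u * (A1 * B2 ^ b) + C2 * A1 * B1 * z ^ b'' * q * (z * u)) * inverse C2 * inverse x"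
      using nz by (simp add: field_simps)
    moreover have "(p * (A1 * B2 ^ b) + C2 * A1 * B1 * z ^ b'' * q * r) * inverse C2 * inverse x \<in> L"
      if "p \<in> L" "r \<in> L" for p r
      by (intro sub inL inv zL wL q that)
    ultimately have "w ^ b * u \<in> L" using u by simp
    moreover have "coprime_in L z (w ^ b)" using coprime_in_power[OF L zw wL] .
    ultimately show "u \<in> L" using u coprime_inD by blast
  qed
  \<comment> \<open>For \<open>b = 1\<close> the correction term has no factor \<open>z\<close>
    left. Instead \<open>x3\<close> is a unit times a sum of two monomials, whose exponents are
    compared with those of \<open>z\<close> in \<open>three_mutations\<close>.\<close>
  show "x3 * (y * A1 * B2) = C2 * (A2 * B1 + B2 * x)" if "b = 1"
  proof -
    have "z * (x3 * (y * A1 * B2)) = z * (C2 * (A2 * B1 + B2 * x))"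
    proof -
      have eqs: "z * x = y * A1 + A2" "w * y = z * B1 + B2" "x3 * z = w * C1 + C2" "C1 * A1 * B2 = C2 * A2"
        using z(1) w x3 mutation that by simp_all
      have "z * (x3 * (y * A1 * B2)) = (w * y) * (C1 * A1 * B2) + C2 * y * A1 * B2"
        using arg_cong[OF eqs(3), of "\<lambda>a. a * (y * A1 * B2)"] by (simp add: algebra_simps)
      also have "\<dots> = C2 * (z * B1 * A2 + B2 * (y * A1 + A2))"
        unfolding eqs(2,4) by (simp add: algebra_simps)
      also have "\<dots> = z * (C2 * (A2 * B1 + B2 * x))"
        unfolding eqs(1)[symmetric] by (simp add: algebra_simps)
      finally show ?thesis .
    qed
    then show ?thesis using z(2) by simp
  qed
qed

section \<open>Coprime denominators after two and three mutations\<close>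

definition pm_of :: "'v set \<Rightarrow> ('v \<Rightarrow> int) \<Rightarrow> ('v \<Rightarrow>\<^sub>0 int)" where
  "pm_of V f = (\<Sum>u \<in> V. single u (f u))"

lemma lookup_pm_of: "finite V \<Longrightarrow> lookup (pm_of V f) u = (if u \<in> V then f u else 0)"
  by (simp add: pm_of_def lookup_sum lookup_single when_def)

lemma keys_pm_of: "finite V \<Longrightarrow> keys (pm_of V f) \<subseteq> V"
  by (auto simp: in_keys_iff lookup_pm_of split: if_splits)

lemma laurent_monom_pm_of: "finite V \<Longrightarrow> laurent_monom x V (pm_of V f) = (\<Prod>u \<in> V. x u powi f u)"
  by (simp add: laurent_monom_def lookup_pm_of)

lemma powi_nat_diff: "a \<noteq> 0 \<Longrightarrow> (a::'k::field) powi i = a ^ nat i / a ^ nat (- i)"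
  by (simp add: power_int_def field_simps)

definition good_seed :: "('v, 'k::field) seed \<Rightarrow> bool" where
  "good_seed S \<longleftrightarrow> finite (verts S) \<and> skew S \<and> full_rank S \<and> alg_independent (cvar S) (verts S)"

abbreviation seed_ring :: "('v, 'k::field) seed \<Rightarrow> 'k set" where
  "seed_ring S \<equiv> laurent (cvar S) (verts S)"

lemma good_seedD:
  assumes "good_seed S"
  shows "finite (verts S)" "skew S" "full_rank S" "alg_independent (cvar S) (verts S)"
    "\<And>u. u \<in> verts S \<Longrightarrow> cvar S u \<noteq> 0"
  using assms by (auto simp: good_seed_def alg_independent_def)

text \<open>Meant for a later seed \<open>S'\<close> that shares with \<open>S\<close> the variables
  on \<open>W\<close>: this part of its exchange monomials is then a unit in the Laurent ring of
  \<open>S\<close>.\<close>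

lemma exchange_monom_unit:
  assumes "good_seed S" "W \<subseteq> verts S" "\<And>u. u \<in> W \<Longrightarrow> cvar S' u = cvar S u"
  shows "exchange_monom e S' v W \<noteq> 0 \<and> exchange_monom e S' v W \<in> seed_ring S \<and>
    inverse (exchange_monom e S' v W) \<in> seed_ring S"
proof -
  note L = is_subring_laurent[of "cvar S" "verts S"]
  have 1: "exchange_monom e S' v W = (\<Prod>u \<in> W. cvar S u ^ nat (e * mult S' u v))"
    unfolding exchange_monom_def by (rule prod.cong) (use assms in auto)
  have 2: "inverse (exchange_monom e S' v W) = (\<Prod>u \<in> W. inverse (cvar S u) ^ nat (e * mult S' u v))"
    by (simp add: 1 prod_inversef[symmetric] power_inverse o_def)
  have "finite W" using assms(2) good_seedD(1)[OF assms(1)] finite_subset by blast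
  then have "exchange_monom e S' v W \<noteq> 0"
    unfolding 1 using good_seedD(5)[OF assms(1)] assms(2) by auto
  then show ?thesis
    unfolding 2 unfolding 1 using assms(2)
    by (auto intro!: subring_prod[OF L] subring_power[OF L] laurent.gen laurent.inv)
qed

lemma exchange_monom_insert2:
  assumes "finite W" "j \<notin> W" "k \<notin> W" "j \<noteq> k"
  shows "exchange_monom e S v (insert j (insert k W)) =
    cvar S j ^ nat (e * mult S j v) * cvar S k ^ nat (e * mult S k v) * exchange_monom e S v W"
  using assms by (simp add: exchange_monom_def mult.assoc)

text \<open>Up to a unit, the right side of an exchange relation is a binomial whose exponent is the
  column of \<open>v\<close> in the exchange matrix, with sign \<open>e\<close>. Coprimality of such
  binomials thus becomes a question about columns.\<close>

lemma exchange_sum_factor: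
  assumes S: "good_seed S" and v: "v \<in> mutable_verts S" and e: "e = 1 \<or> e = -1"
  shows "exchange_monom e S v (verts S) + exchange_monom (- e) S v (verts S) =
    exchange_monom (- e) S v (verts S) * (1 + laurent_monom (cvar S) (verts S) (pm_of (verts S) (\<lambda>u. e * mult S u v)))"
proof -
  have "laurent_monom (cvar S) (verts S) (pm_of (verts S) (\<lambda>u. e * mult S u v))
      = (\<Prod>u \<in> verts S. cvar S u ^ nat (e * mult S u v) / cvar S u ^ nat (- e * mult S u v))"
    unfolding laurent_monom_pm_of[OF good_seedD(1)[OF S]]
    by (rule prod.cong) (auto simp: powi_nat_diff good_seedD(5)[OF S])
  also have "\<dots> = exchange_monom e S v (verts S) / exchange_monom (- e) S v (verts S)"
    by (simp add: exchange_monom_def prod_dividef)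
  finally show ?thesis
    using exchange_monom_unit[OF S subset_refl, of S "- e" v] by (simp add: field_simps)
qed

text \<open>Seen from \<open>S\<close>, an expansion after the first mutation has denominator
  \<open>z\<close>, and one after the third has denominators \<open>w\<close> and \<open>x3\<close>.
  If arrows join \<open>j\<close> and \<open>k\<close>, this is an instance of
  \<open>three_exchanges\<close>, with an extra argument for a single arrow; otherwise coprimality
  of \<open>z\<close> and \<open>w\<close> comes from the rank.\<close>

lemma three_mutations:
  fixes S :: "('v, 'k::field) seed"
  assumes S: "good_seed S" and j: "j \<in> mutable_verts S" and k: "k \<in> mutable_verts S" and jk: "j \<noteq> k"
    and nz: "cvar (mutate k S) k \<noteq> 0" "cvar (mutate j (mutate k S)) j \<noteq> 0"
  defines "z \<equiv> cvar (mutate k S) k" and "w \<equiv> cvar (mutate j (mutate k S)) j"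
    and "x3 \<equiv> cvar (mutate k (mutate j (mutate k S))) k"
  shows "z \<in> seed_ring S" "w \<in> seed_ring S" "x3 \<in> seed_ring S"
    "coprime_in (seed_ring S) z w" "coprime_in (seed_ring S) z x3"
proof -
  let ?L = "seed_ring S" and ?V = "verts S"
  define S1 where "S1 = mutate k S"
  define S2 where "S2 = mutate j S1"
  define W where "W = ?V - {j, k}"
  define x where "x = cvar S k"
  define y where "y = cvar S j"
  note sk = good_seedD(2)[OF S]
  note fin = good_seedD(1)[OF S]
  note L = is_subring_laurent[of "cvar S" "verts S"]
  have jV: "j \<in> ?V" and kV: "k \<in> ?V" using j k by (auto simp: verts_def)
  have V: "?V = insert j (insert k W)" "j \<notin> W" "k \<notin> W" "finite W" "W \<subseteq> ?V"
    using jV kV fin by (auto simp: W_def)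
  have sk1: "skew S1" and sk2: "skew S2" using sk by (auto simp: S1_def S2_def skew_mutate)
  have V12: "verts S1 = ?V" "verts S2 = ?V" by (auto simp: S1_def S2_def)
  have cv: "cvar S1 k = z" "cvar S1 j = y" "cvar S2 k = z" "cvar S2 j = w"
    using jk by (auto simp: S1_def S2_def z_def w_def y_def cvar_mutate_other)
  have cvW: "cvar S1 u = cvar S u" "cvar S2 u = cvar S u" if "u \<in> W" for u
    using that by (auto simp: S1_def S2_def W_def cvar_mutate_other)
  have xy: "x \<noteq> 0" "y \<noteq> 0" using good_seedD(5)[OF S] jV kV by (auto simp: x_def y_def)
  have xyL: "x \<in> ?L" "y \<in> ?L" "inverse x \<in> ?L" "inverse y \<in> ?L"
    using jV kV by (auto simp: x_def y_def intro: laurent.intros)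
  have m1: "mult S1 j k = - mult S j k" by (simp add: S1_def mult_mutate_diag)
  have m1': "mult S1 k j = mult S j k" using skewD[OF sk1, of k j] m1 by simp
  have m2: "mult S2 j k = mult S j k" using m1 by (simp add: S2_def mult_mutate_diag)
  have m0: "mult S k k = 0" "mult S1 j j = 0" "mult S2 k k = 0" using skew_diag[OF sk] skew_diag[OF sk1] skew_diag[OF sk2] by auto
  have split: "exchange_monom e S k ?V = y ^ nat (e * mult S j k) * exchange_monom e S k W"
    "exchange_monom e S1 j ?V = z ^ nat (e * mult S j k) * exchange_monom e S1 j W"
    "exchange_monom e S2 k ?V = w ^ nat (e * mult S j k) * exchange_monom e S2 k W" for e
    by (simp_all add: V(1) exchange_monom_insert2[OF V(4,2,3) jk] m0 m1' m2 cv y_def[symmetric])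
  have z0: "z \<noteq> 0" and w0: "w \<noteq> 0" using nz by (auto simp: z_def w_def)
  have z: "z * x = exchange_monom e S k ?V + exchange_monom (- e) S k ?V" if "e = 1 \<or> e = -1" for e
    using exchange_monoms_signed[OF fin sk that] xy by (simp add: z_def x_def)
  have w: "w * y = exchange_monom e S1 j ?V + exchange_monom (- e) S1 j ?V" if "e = 1 \<or> e = -1" for e
    using exchange_monoms_signed[OF _ sk1 that, of j] xy fin by (simp add: V12 cv S2_def[symmetric])
  have x3': "x3 = cvar (mutate k S2) k" by (simp add: x3_def S1_def S2_def)
  have x3: "x3 * z = exchange_monom e S2 k ?V + exchange_monom (- e) S2 k ?V" if "e = 1 \<or> e = -1" for e
    using exchange_monoms_signed[OF _ sk2 that, of k] z0 fin by (simp add: V12 cv x3'[symmetric])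
  have unit: "exchange_monom e S v W \<noteq> 0 \<and> exchange_monom e S v W \<in> ?L \<and> inverse (exchange_monom e S v W) \<in> ?L"
    "exchange_monom e S1 v W \<noteq> 0 \<and> exchange_monom e S1 v W \<in> ?L \<and> inverse (exchange_monom e S1 v W) \<in> ?L"
    "exchange_monom e S2 v W \<noteq> 0 \<and> exchange_monom e S2 v W \<in> ?L \<and> inverse (exchange_monom e S2 v W) \<in> ?L" for e v
    using exchange_monom_unit[OF S V(5)] cvW by auto
  have "z \<in> ?L \<and> w \<in> ?L \<and> x3 \<in> ?L \<and> coprime_in ?L z w \<and> coprime_in ?L z x3"
  proof (cases "mult S j k = 0")
    case True
    \<comment> \<open>Without arrows between \<open>j\<close> and \<open>k\<close>, mutation at one
      of them does not affect the arrows from other vertices to the other one. So the third mutation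
      undoes the first and \<open>x3 = x\<close> is a unit.\<close>
    have "mult S1 u j = mult S u j" if "u \<in> W" for u
      using mult_mutate[OF sk, of u j k] that jV jk skewD[OF sk, of k j] V(5) True
      by (auto simp: S1_def W_def)
    then have e1: "exchange_monom e S1 j W = exchange_monom e S j W" for e
      unfolding exchange_monom_def by (intro prod.cong) (auto simp: cvW)
    have "mult S2 u k = - mult S u k" if "u \<in> W" for u
      using mult_mutate[OF sk1, of u k j] that kV jk m1 m1' V(5) True V12
      by (auto simp: S1_def S2_def W_def mult_mutate_diag)
    then have e2: "exchange_monom e S2 k W = exchange_monom (- e) S k W" for e
      unfolding exchange_monom_def by (intro prod.cong) (auto simp: cvW)
    have "x3 * z = z * x" using x3[of 1] z[of "-1"] by (simp add: split True e2)
    then have "x3 = x" using z0 by simp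
    have zx_cop: "coprime_in ?L z x" by (rule coprime_in_unit[OF L]) (use xy xyL in auto)
    define \<alpha> where "\<alpha> = pm_of ?V (\<lambda>u. 1 * mult S u k)"
    define \<beta> where "\<beta> = pm_of ?V (\<lambda>u. 1 * mult S u j)"
    have "w * y = exchange_monom 1 S j ?V + exchange_monom (- 1) S j ?V"
      using w[of 1] skewD[OF sk, of k j] skew_diag[OF sk, of j] True
      by (simp add: split e1) (simp add: V(1) exchange_monom_insert2[OF V(4,2,3) jk])
    then have "w * y = exchange_monom (- 1) S j ?V * (1 + laurent_monom (cvar S) ?V \<beta>)"
      using exchange_sum_factor[OF S j, of 1] by (simp add: \<beta>_def)
    then have wy: "w = exchange_monom (- 1) S j ?V * inverse y * (1 + laurent_monom (cvar S) ?V \<beta>)"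
      using xy(2) by (simp add: eq_divide_eq divide_inverse[symmetric] times_divide_eq_left)
    have "z * x = exchange_monom (- 1) S k ?V * (1 + laurent_monom (cvar S) ?V \<alpha>)"
      using exchange_sum_factor[OF S k, of 1] z[of 1] by (simp add: \<alpha>_def)
    then have zx: "z = exchange_monom (- 1) S k ?V * inverse x * (1 + laurent_monom (cvar S) ?V \<alpha>)"
      using xy(1) by (simp add: eq_divide_eq divide_inverse[symmetric] times_divide_eq_left)
    have keys: "keys \<alpha> \<subseteq> ?V" "keys \<beta> \<subseteq> ?V"
      using keys_pm_of[OF fin] by (auto simp: \<alpha>_def \<beta>_def)
    have finM: "finite (mutable_verts S)" using fin by (simp add: verts_def)
    have rank: "i = 0 \<and> i' = 0" if "frag_cmul i \<alpha> = frag_cmul i' \<beta>" for i i'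
    proof -
      \<comment> \<open>A proportionality between \<alpha> and \<beta> is a linear relation between
        the columns \<open>k\<close> and \<open>j\<close>.\<close>
      define c where "c = (\<lambda>v. if v = k then i else if v = j then - i' else 0)"
      have "(\<Sum>v \<in> mutable_verts S. mult S u v * c v) = 0" if "u \<in> ?V" for u
      proof -
        have "(\<Sum>v \<in> mutable_verts S. mult S u v * c v) = (\<Sum>v \<in> {j, k}. mult S u v * c v)"
          by (rule sum.mono_neutral_right) (use j k finM in \<open>auto simp: c_def\<close>)
        also have "\<dots> = i * mult S u k - i' * mult S u j" using jk by (simp add: c_def)
        also have "\<dots> = 0"
          using arg_cong[OF \<open>frag_cmul i \<alpha> = frag_cmul i' \<beta>\<close>, of "\<lambda>g. lookup g u"] \<open>u \<in> ?V\<close> fin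
          by (simp add: \<alpha>_def \<beta>_def lookup_pm_of)
        finally show ?thesis .
      qed
      then have "c j = 0 \<and> c k = 0" using good_seedD(3)[OF S] j k unfolding full_rank_def by blast
      then show ?thesis using jk by (auto simp: c_def split: if_splits)
    qed
    have "\<alpha> \<noteq> 0"
    proof
      assume "\<alpha> = 0"
      then show False using rank[of 1 0] by simp
    qed
    then have "coprime_in ?L (1 + laurent_monom (cvar S) ?V \<alpha>) (1 + laurent_monom (cvar S) ?V \<beta>)"
      using rank by (intro coprime_in_laurent_binomials[OF fin good_seedD(4)[OF S] keys]) auto
    moreover have un: "exchange_monom e S v ?V * inverse a \<noteq> 0 \<and> inverse (exchange_monom e S v ?V * inverse a) \<in> ?L \<and>
        exchange_monom e S v ?V * inverse a \<in> ?L"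
      if "a \<noteq> 0" "a \<in> ?L" "inverse a \<in> ?L" for a e v
      using exchange_monom_unit[OF S subset_refl, of S e v] that by (auto intro: laurent.intros)
    ultimately have "coprime_in ?L z w"
      unfolding wy zx using xy xyL coprime_in_unit_left[OF L] coprime_in_commute by metis
    moreover have "laurent_monom (cvar S) ?V g \<in> ?L" for g
      by (rule laurent_monom_in) (use fin good_seedD(5)[OF S] in auto)
    then have "z \<in> ?L" "w \<in> ?L"
      unfolding wy zx using exchange_monom_unit[OF S subset_refl, of S "-1"] xyL
      by (auto intro!: subring_mult[OF L] subring_add[OF L] subring_1[OF L])
    ultimately show ?thesis using \<open>x3 = x\<close> xyL zx_cop by simp
  next
    case False
    \<comment> \<open>With this sign \<open>y\<close>, \<open>z\<close> and \<open>w\<close> occur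
      in the first monomials of the three relations, each with the same exponent
      \<open>b\<close>.\<close>
    define e where "e = sgn (mult S j k)"
    define b where "b = nat (e * mult S j k)"
    have e: "e = 1 \<or> e = -1" and eb: "e * mult S j k > 0" using False by (auto simp: e_def sgn_if)
    then have b: "b \<ge> 1" "int b = e * mult S j k" "nat (- (e * mult S j k)) = 0" by (auto simp: b_def)
    define A1 A2 where "A1 = exchange_monom e S k W" and "A2 = exchange_monom (- e) S k W"
    define B1 B2 where "B1 = exchange_monom e S1 j W" and "B2 = exchange_monom (- e) S1 j W"
    define C1 C2 where "C1 = exchange_monom e S2 k W" and "C2 = exchange_monom (- e) S2 k W"
    have rel: "z * x = y ^ b * A1 + A2" "w * y = z ^ b * B1 + B2" "x3 * z = w ^ b * C1 + C2"
      unfolding z[OF e] w[OF e] x3[OF e] split A1_def A2_def B1_def B2_def C1_def C2_def b_def[symmetric]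
      using b(3) by simp_all
    have mutation: "C1 * A1 * B2 ^ b = C2 * A2"
    proof -
      \<comment> \<open>The monomial identity is checked vertex by vertex: it is the mutation rule
        for the arrows between \<open>u\<close> and \<open>k\<close>, written with nonnegative
        exponents only.\<close>
      have "cvar S2 u ^ nat (e * mult S2 u k) * cvar S u ^ nat (e * mult S u k) * (cvar S1 u ^ nat (- e * mult S1 u j)) ^ b
          = cvar S2 u ^ nat (- e * mult S2 u k) * cvar S u ^ nat (- e * mult S u k)" if u: "u \<in> W" for u
      proof -
        have u': "u \<in> verts S1" "u \<noteq> j" "u \<noteq> k" "k \<in> verts S1" using u V(5) kV by (auto simp: W_def V12)
        have "e * mult S2 u k = e * mult S1 u k - (e * mult S1 k j) * int (nat (e * mult S1 j u))"
          unfolding S2_def by (rule mult_mutate_signed[OF sk1 u'(1,4,2)]) (use jk e eb m1' in auto)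
        also have "mult S1 u k = - mult S u k" by (simp add: S1_def mult_mutate_diag)
        also have "mult S1 j u = - mult S1 u j" using skewD[OF sk1] by blast
        finally have *: "e * mult S2 u k = - (e * mult S u k) - int b * int (nat (- e * mult S1 u j))"
          by (simp add: m1' b(2))
        have pos: "0 \<le> int b * int (nat (- e * mult S1 u j))" by simp
        have "nat (e * mult S2 u k) + nat (e * mult S u k) + nat (- e * mult S1 u j) * b
            = nat (- e * mult S2 u k) + nat (- e * mult S u k)"
        proof -
          have "int (nat (- e * mult S1 u j) * b) = int b * int (nat (- e * mult S1 u j))" by simp
          then show ?thesis using * pos by linarith
        qed
        then show ?thesis by (simp only: cvW[OF u] power_mult[symmetric] power_add[symmetric])
      qed
      then show ?thesis
        unfolding A1_def A2_def B2_def C1_def C2_def exchange_monom_def prod_power_distrib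
          prod.distrib[symmetric] by (rule prod.cong[OF refl])
    qed
    have units: "a \<noteq> 0 \<and> a \<in> ?L \<and> inverse a \<in> ?L" if "a \<in> {x, y, A1, A2, B1, B2, C1, C2}" for a
      using that xy xyL unit(1)[of e k] unit(1)[of "- e" k] unit(2)[of e j] unit(2)[of "- e" j]
        unit(3)[of e k] unit(3)[of "- e" k]
      by (fold A1_def A2_def B1_def B2_def C1_def C2_def) auto
    note * = three_exchanges[OF L units rel(1) z0 rel(2,3) mutation b(1)]
    have "coprime_in ?L z x3"
    proof (cases "b = 1")
      case False
      then show ?thesis using * b(1) by simp
    next
      case b1: True
      define \<alpha> where "\<alpha> = pm_of ?V (\<lambda>u. e * mult S u k)"
      \<comment> \<open>\<open>f\<close> is the exponent of \<open>B2 / (A2 * B1)\<close>, so that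
        \<beta> is the exponent of \<open>x * B2 / (A2 * B1)\<close>, the quotient of the two
        summands in the formula for \<open>x3\<close>.\<close>
      define f where "f = (\<lambda>u. int (nat (- e * mult S1 u j)) - int (nat (- e * mult S u k) + nat (e * mult S1 u j)))"
      define \<beta> where "\<beta> = pm_of ?V (\<lambda>u. if u = k then 1 else if u = j then 0 else f u)"
      have "laurent_monom (cvar S) ?V \<beta> = x * (\<Prod>u \<in> W. cvar S u powi f u)"
        unfolding \<beta>_def laurent_monom_pm_of[OF fin] using V(2,3,4) jk
        by (simp add: V(1) x_def) (rule disjI2, rule prod.cong, auto)
      also have "(\<Prod>u \<in> W. cvar S u powi f u) = (\<Prod>u \<in> W. cvar S1 u ^ nat (- e * mult S1 u j) /
          (cvar S u ^ nat (- e * mult S u k) * cvar S1 u ^ nat (e * mult S1 u j)))"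
      proof (rule prod.cong[OF refl])
        fix u assume u: "u \<in> W"
        then have u0: "cvar S u \<noteq> 0" using good_seedD(5)[OF S] V(5) by blast
        show "cvar S u powi f u = cvar S1 u ^ nat (- e * mult S1 u j) /
          (cvar S u ^ nat (- e * mult S u k) * cvar S1 u ^ nat (e * mult S1 u j))"
          by (simp only: f_def power_int_diff[OF disjI1[OF u0]] power_int_of_nat cvW[OF u] power_add)
      qed
      also have "\<dots> = B2 / (A2 * B1)"
        unfolding A2_def B1_def B2_def exchange_monom_def by (simp add: prod_dividef prod.distrib)
      finally have \<beta>: "laurent_monom (cvar S) ?V \<beta> = x * (B2 / (A2 * B1))" .
      have nz': "A1 \<noteq> 0" "A2 \<noteq> 0" "B1 \<noteq> 0" "B2 \<noteq> 0" "C2 \<noteq> 0" using units by auto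
      define m where "m = C2 * A2 * B1 * inverse (y * A1 * B2)"
      have "x3 * (y * A1 * B2) = C2 * (A2 * B1 + B2 * x)" using *(6) b1 by simp
      then have x3': "x3 = m * (1 + laurent_monom (cvar S) ?V \<beta>)"
      proof -
        assume *: "x3 * (y * A1 * B2) = C2 * (A2 * B1 + B2 * x)"
        have "m * (1 + x * (B2 / (A2 * B1))) = C2 * (A2 * B1 + B2 * x) * inverse (y * A1 * B2)"
          unfolding m_def using nz' xy by (simp add: field_simps)
        moreover have "y * A1 * B2 * inverse (y * A1 * B2) = 1" using nz' xy by (intro right_inverse) simp
        ultimately show ?thesis unfolding \<beta> *[symmetric] by (simp only: mult.assoc mult_1_right)
      qed
      have z': "z = exchange_monom (- e) S k ?V * inverse x * (1 + laurent_monom (cvar S) ?V \<alpha>)"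
        using exchange_sum_factor[OF S k e] z[OF e] xy by (simp add: \<alpha>_def field_simps)
      have keys: "keys \<alpha> \<subseteq> ?V" "keys \<beta> \<subseteq> ?V"
        using keys_pm_of[OF fin] by (auto simp: \<alpha>_def \<beta>_def)
      \<comment> \<open>The coordinates at \<open>j\<close> and \<open>k\<close> already show
        independence: \<alpha> contains \<open>y\<close> once and no \<open>x\<close>, \<beta>
        contains \<open>x\<close> once and no \<open>y\<close>.\<close>
      have lk: "lookup \<alpha> j = 1" "lookup \<alpha> k = 0"
        "lookup \<beta> j = 0" "lookup \<beta> k = 1"
        using jk jV kV b b1 m0 by (auto simp: \<alpha>_def \<beta>_def lookup_pm_of[OF fin])
      have indep: "i' = 0" if "frag_cmul i \<alpha> = frag_cmul i' \<beta>" for i i'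
        using arg_cong[OF that, of "\<lambda>g. lookup g k"] lk by simp
      have "\<alpha> \<noteq> 0" using lk by auto
      then have "coprime_in ?L (1 + laurent_monom (cvar S) ?V \<alpha>) (1 + laurent_monom (cvar S) ?V \<beta>)"
        using indep by (intro coprime_in_laurent_binomials[OF fin good_seedD(4)[OF S] keys]) auto
      moreover have "exchange_monom (- e) S k ?V * inverse x \<noteq> 0" "inverse (exchange_monom (- e) S k ?V * inverse x) \<in> ?L"
        using exchange_monom_unit[OF S subset_refl, of S "- e" k] xy xyL by (auto intro: laurent.intros)
      moreover have "m \<noteq> 0" using nz' xy by (simp add: m_def)
      moreover have "inverse m = y * A1 * B2 * inverse C2 * inverse A2 * inverse B1"
        by (simp add: m_def mult_ac)
      then have "inverse m \<in> ?L" using units xyL by (auto intro!: subring_mult[OF L])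
      ultimately show ?thesis
        unfolding z' x3' using coprime_in_unit_left[OF L] coprime_in_commute by metis
    qed
    then show ?thesis using * by simp
  qed
  then show "z \<in> ?L" "w \<in> ?L" "x3 \<in> ?L" "coprime_in ?L z w" "coprime_in ?L z x3" by auto
qed

text \<open>Induction on the number of mutations; the family \<open>\<S>\<close> guarantees that no
  variable met on the way is 0. For a word \<open>k # j # rest\<close> the same element is reached
  by shorter words from two other seeds: from the one after \<open>k\<close>, and from the one after
  \<open>k, j, k\<close>, since one more mutation at \<open>k\<close> leads from there to the seed
  after \<open>k, j\<close>. Seen from \<open>S\<close>, the two expansions have coprime
  denominators.\<close>

theorem laurent_phenomenon:
  fixes \<S> :: "('v, 'k::field) seed set"
  assumes good: "\<And>S. S \<in> \<S> \<Longrightarrow> good_seed S"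
    and closed: "\<And>S v. S \<in> \<S> \<Longrightarrow> v \<in> mutable_verts S \<Longrightarrow> mutate v S \<in> \<S>"
    and "S \<in> \<S>" "set vs \<subseteq> mutable_verts S" "u \<in> verts S"
  shows "cvar (fold mutate vs S) u \<in> seed_ring S"
  using assms(3-5)
proof (induction "length vs" arbitrary: vs S rule: less_induct)
  case less
  note L = is_subring_laurent[of "cvar S" "verts S"]
  have gS: "good_seed S" using good less.prems by blast
  have nz: "cvar (mutate v S) v \<noteq> 0" if "S \<in> \<S>" "v \<in> mutable_verts S" for S v
    using good_seedD(5)[OF good[OF closed[OF that]], of v] that mutable_subset_verts[of S] by auto
  show ?case
  proof (cases vs)
    case Nil
    then show ?thesis using less.prems by (auto intro: laurent.gen)
  next
    case (Cons k vs')
    have k: "k \<in> mutable_verts S" using less.prems Cons by auto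
    have S1: "mutate k S \<in> \<S>" using closed less.prems(1) k by blast
    have kV: "k \<in> verts S" using k by (auto simp: verts_def)
    have inv_k: "mutate k (mutate k S) = S"
      using mutate_involution[OF good_seedD(2)[OF gS] _ nz[OF less.prems(1) k] good_seedD(1)[OF gS]]
        good_seedD(5)[OF gS kV] by blast
    have z_in: "cvar (mutate k S) k \<in> seed_ring S"
    proof -
      have "cvar (mutate k S) k = (exchange_monom 1 S k (verts S) + exchange_monom (-1) S k (verts S)) * inverse (cvar S k)"
        using exchange_monoms[OF good_seedD(1)[OF gS] good_seedD(2)[OF gS], of k] by (simp add: divide_inverse)
      then show ?thesis
        using exchange_monom_unit[OF gS subset_refl, of S] kV by (auto intro!: laurent.intros)
    qed
    show ?thesis
    proof (cases vs')
      case Nil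
      then show ?thesis using Cons z_in less.prems(3) cvar_mutate_other[of u k S]
        by (cases "u = k") (auto intro: laurent.gen)
    next
      case vs': (Cons j rest)
      have j: "j \<in> mutable_verts S" using less.prems Cons vs' by auto
      have rest: "set rest \<subseteq> mutable_verts S" using less.prems Cons vs' by auto
      show ?thesis
      proof (cases "j = k")
        case True
        then show ?thesis
          using less.hyps[of rest S] less.prems rest by (simp add: Cons vs' inv_k)
      next
        case False
        let ?S1 = "mutate k S" let ?S2 = "mutate j ?S1" let ?S3 = "mutate k ?S2"
        let ?z = "cvar ?S1 k" and ?w = "cvar ?S2 j" and ?x3 = "cvar ?S3 k"
        have S2: "?S2 \<in> \<S>" using closed S1 j by simp
        have S3: "?S3 \<in> \<S>" using closed S2 k by simp
        have kV: "k \<in> verts S" and jV: "j \<in> verts S" using k j by (auto simp: verts_def)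
        have inv3: "mutate k ?S3 = ?S2"
          using good_seedD[OF good[OF S2]] kV nz[OF S2] k by (intro mutate_involution) auto
        define y where "y = cvar (fold mutate vs S) u"
        have "y \<in> seed_ring ?S1"
          using less.hyps[of "j # rest" ?S1] S1 j rest less.prems(3) by (simp add: y_def Cons vs')
        moreover have "y \<in> seed_ring ?S3"
          using less.hyps[of "k # rest" ?S3] S3 k rest less.prems(3) inv3 by (simp add: y_def Cons vs')
        moreover note T = three_mutations[OF gS j k False nz[OF less.prems(1) k]]
        have w0: "?w \<noteq> 0" and x30: "?x3 \<noteq> 0" and z0: "?z \<noteq> 0"
          using nz[OF S1] nz[OF S2] nz[OF less.prems(1)] j k by auto
        note T = T[OF w0]
        have gen: "cvar S v \<in> seed_ring S" "inverse (cvar S v) \<in> seed_ring S" if "v \<in> verts S" for v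
          using that by (auto intro: laurent.intros)
        \<comment> \<open>The seed after \<open>k\<close> differs from \<open>S\<close> only in the
          variable \<open>z\<close>, which lies in the ring of \<open>S\<close>. So powers of
          \<open>z\<close> are the only denominators.\<close>
        have "\<exists>N. y * ?z ^ N \<in> seed_ring S"
        proof (rule laurent_denominator[OF L _ T(1) _ \<open>y \<in> seed_ring ?S1\<close>])
          fix v assume v: "v \<in> verts ?S1"
          show "cvar ?S1 v \<in> seed_ring S"
            using v T(1) gen by (cases "v = k") (auto simp: cvar_mutate_other)
          show "inverse (cvar ?S1 v) * ?z \<in> seed_ring S"
            using v T(1) gen z0 by (cases "v = k") (auto simp: cvar_mutate_other intro: laurent.intros)
        qed
        then obtain N where N: "?z ^ N * y \<in> seed_ring S" by (auto simp: mult.commute)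
        have wx: "?w * ?x3 \<in> seed_ring S" using T by (auto intro: laurent.intros)
        have "\<exists>M. y * (?w * ?x3) ^ M \<in> seed_ring S"
        proof (rule laurent_denominator[OF L _ wx _ \<open>y \<in> seed_ring ?S3\<close>])
          fix v assume v: "v \<in> verts ?S3"
          have c: "cvar ?S3 v = (if v = k then ?x3 else if v = j then ?w else cvar S v)"
            by (simp add: cvar_mutate_other)
          show "cvar ?S3 v \<in> seed_ring S" unfolding c using v T gen by auto
          have "inverse ?x3 * (?w * ?x3) = ?w" "inverse ?w * (?w * ?x3) = ?x3"
            using w0 x30 by (auto simp: field_simps)
          then have "inverse ?x3 * (?w * ?x3) \<in> seed_ring S" "inverse ?w * (?w * ?x3) \<in> seed_ring S"
            using T(2,3) by metis+
          moreover have "inverse (cvar S v) * (?w * ?x3) \<in> seed_ring S"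
            using gen(2)[of v] v wx by (auto intro: laurent.mult)
          ultimately show "inverse (cvar ?S3 v) * (?w * ?x3) \<in> seed_ring S"
            unfolding c by presburger
        qed
        then obtain M where M: "(?w * ?x3) ^ M * y \<in> seed_ring S" by (auto simp: mult.commute)
        have "coprime_in (seed_ring S) (?z ^ N) ((?w * ?x3) ^ M)"
          by (rule coprime_in_powers[OF L coprime_in_mult[OF L T(4,5,2)] T(1) wx])
        then show ?thesis using N M coprime_inD unfolding y_def[symmetric] by blast
      qed
    qed
  qed
qed


section \<open>Leading monomials\<close>

text \<open>Precomposition with a bijection \<open>p\<close> of the variables turns the lexicographic order of the
  monomials into the lexicographic order for another order of the variables.\<close>

definition is_lead :: "(nat \<times> nat \<Rightarrow> nat \<times> nat) \<Rightarrow> mpoly \<Rightarrow> monomial \<Rightarrow> bool" where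
  "is_lead p f m \<longleftrightarrow> m \<in> keys f \<and>
     (\<forall>k \<in> keys f. k \<noteq> m \<longrightarrow> Poly_Mapping.map_key p k < Poly_Mapping.map_key p m)"

lemma lookup_map_key: "inj p \<Longrightarrow> lookup (Poly_Mapping.map_key p m) v = lookup m (p v)"
  by (simp add: map_key.rep_eq)

lemma map_key_id_eq: "Poly_Mapping.map_key id m = m"
  by (rule poly_mapping_eqI) (simp add: lookup_map_key)

lemma map_key_less_iff:
  fixes m m' :: monomial and p :: "nat \<times> nat \<Rightarrow> nat \<times> nat"
  assumes "inj p"
  shows "Poly_Mapping.map_key p m < Poly_Mapping.map_key p m' \<longleftrightarrow>
    (\<exists>v. lookup m (p v) < lookup m' (p v) \<and>
      (\<forall>v' < v. lookup m (p v') = lookup m' (p v')))"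
  by (simp add: monomial_less_iff lookup_map_key[OF assms])

lemma map_key_inject:
  assumes "bij p" "Poly_Mapping.map_key p m = Poly_Mapping.map_key p m'" shows "m = m'"
proof (rule poly_mapping_eqI)
  fix v
  obtain u where "v = p u" using assms(1) by (metis bij_pointE)
  then show "lookup m v = lookup m' v"
    using arg_cong[OF assms(2), of "\<lambda>a. lookup a u"] assms(1)
    by (simp add: lookup_map_key bij_is_inj)
qed

lemma lookup_mult_unique:
  fixes f g :: mpoly
  assumes "\<And>a b. a \<in> keys f \<Longrightarrow> b \<in> keys g \<Longrightarrow> a + b = m + m' \<Longrightarrow> a = m \<and> b = m'"
  shows "lookup (f * g) (m + m') = lookup f m * lookup g m'"
proof -
  let ?f = "lookup f" and ?g = "lookup g"
  have "f * g = (\<Sum>a \<in> keys f. single a (?f a)) *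
      (\<Sum>b \<in> keys g. single b (?g b))"
    using poly_mapping_sum_singles[of f] poly_mapping_sum_singles[of g] by simp
  also have "\<dots> = (\<Sum>a \<in> keys f. \<Sum>b \<in> keys g. single (a + b) (?f a * ?g b))"
    by (simp add: sum_product mult_single)
  finally have "lookup (f * g) (m + m') =
      (\<Sum>a \<in> keys f. \<Sum>b \<in> keys g. if a + b = m + m' then ?f a * ?g b else 0)"
    by (simp add: lookup_sum lookup_single when_def)
  also have "\<dots> = (\<Sum>a \<in> keys f. \<Sum>b \<in> keys g. if a = m \<and> b = m' then ?f a * ?g b else 0)"
    by (intro sum.cong refl) (use assms in auto)
  also have "\<dots> = (\<Sum>a \<in> keys f. if a = m then (\<Sum>b \<in> keys g. if b = m' then ?f m * ?g b else 0) else 0)"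
    by (intro sum.cong refl) (auto intro: sum.cong)
  also have "\<dots> = ?f m * ?g m'"
    by (simp add: in_keys_iff)
  finally show ?thesis .
qed

context
  fixes p :: "nat \<times> nat \<Rightarrow> nat \<times> nat"
  assumes p: "bij p"
begin

lemma is_lead_unique: "is_lead p f m \<Longrightarrow> is_lead p f m' \<Longrightarrow> m = m'"
  unfolding is_lead_def using less_asym by blast

lemma is_lead_exists:
  assumes "f \<noteq> 0" shows "\<exists>m. is_lead p f m"
proof -
  let ?K = "Poly_Mapping.map_key p ` keys f"
  have K: "finite ?K" "?K \<noteq> {}" using assms by auto
  then obtain m where m: "m \<in> keys f" "Poly_Mapping.map_key p m = Max ?K"
    using Max_in[OF K] by (metis (no_types, lifting) imageE)
  have "Poly_Mapping.map_key p k < Poly_Mapping.map_key p m" if "k \<in> keys f" "k \<noteq> m" for k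
  proof -
    have "Poly_Mapping.map_key p k \<le> Poly_Mapping.map_key p m" using m K that by auto
    then show ?thesis using map_key_inject[OF p] that by (metis order_le_less)
  qed
  then show ?thesis using m by (auto simp: is_lead_def)
qed

lemma is_lead_mult:
  assumes "is_lead p f m" "is_lead p g m'"
  shows "is_lead p (f * g) (m + m')"
    "lookup (f * g) (m + m') = lookup f m * lookup g m'"
proof -
  have plus: "Poly_Mapping.map_key p (a + b) = Poly_Mapping.map_key p a + Poly_Mapping.map_key p b" for a b :: monomial
    using p by (simp add: map_key_plus bij_is_inj)
  have le: "Poly_Mapping.map_key p (a + b) < Poly_Mapping.map_key p (m + m')"
    if "a \<in> keys f" "b \<in> keys g" "a \<noteq> m \<or> b \<noteq> m'" for a b
    using assms that unfolding plus is_lead_def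
    by (cases "a = m"; cases "b = m'") (auto intro: add_strict_mono add_strict_left_mono add_strict_right_mono)
  then show lk: "lookup (f * g) (m + m') = lookup f m * lookup g m'"
    by (intro lookup_mult_unique) (metis order_less_irrefl)
  have "m + m' \<in> keys (f * g)"
    using lk assms by (simp add: in_keys_iff is_lead_def)
  moreover have "Poly_Mapping.map_key p k < Poly_Mapping.map_key p (m + m')"
    if k: "k \<in> keys (f * g)" "k \<noteq> m + m'" for k
  proof -
    obtain a b where "a \<in> keys f" "b \<in> keys g" "k = a + b"
      using k(1) Poly_Mapping.keys_mult[of f g] by blast
    then show ?thesis using le k(2) by blast
  qed
  ultimately show "is_lead p (f * g) (m + m')" by (simp add: is_lead_def)
qed

text \<open>Finiteness of \<open>W\<close> is essential: infinitely many variables form an infinite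
  descending chain. Over a finite set, the exponents listed in order are words of fixed length over
  the natural numbers, compared lexicographically.\<close>

lemma wf_monomials:
  assumes "finite W"
  shows "wf {(a :: monomial, b). keys a \<subseteq> W \<and> keys b \<subseteq> W \<and>
    Poly_Mapping.map_key p a < Poly_Mapping.map_key p b}"
proof -
  let ?W = "p -` W"
  have fin: "finite ?W" using assms p by (simp add: finite_vimageI bij_is_inj)
  let ?xs = "sorted_list_of_set ?W"
  let ?l = "\<lambda>a :: monomial. map (\<lambda>v. lookup a (p v)) ?xs"
  have "(?l a, ?l b) \<in> lex less_than"
    if ab: "keys a \<subseteq> W" "keys b \<subseteq> W" "Poly_Mapping.map_key p a < Poly_Mapping.map_key p b"
    for a b :: monomial
  proof -
    obtain v where v: "lookup a (p v) < lookup b (p v)"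
      "\<forall>v' < v. lookup a (p v') = lookup b (p v')"
      using ab(3) by (auto simp: map_key_less_iff[OF bij_is_inj[OF p]])
    have "p v \<in> keys b" using v(1) by (simp add: in_keys_iff)
    then have "v \<in> set ?xs" using ab(2) fin by auto
    then obtain ys zs where s: "?xs = ys @ v # zs" by (meson split_list)
    have "sorted_wrt (<) ?xs" by (simp add: strict_sorted_list_of_set)
    then have "\<forall>y \<in> set ys. y < v" unfolding s by (simp add: sorted_wrt_append)
    then have "map (\<lambda>v. lookup a (p v)) ys = map (\<lambda>v. lookup b (p v)) ys"
      using v(2) by auto
    then show ?thesis unfolding s lex_conv using v(1) by fastforce
  qed
  then have "{(a :: monomial, b). keys a \<subseteq> W \<and> keys b \<subseteq> W \<and>
    Poly_Mapping.map_key p a < Poly_Mapping.map_key p b} \<subseteq> inv_image (lex less_than) ?l"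
    by auto
  then show ?thesis using wf_subset[OF wf_inv_image[OF wf_lex[OF wf_less_than]]] by blast
qed

text \<open>Division by \<open>f\<close>: as the leading monomials of \<open>f\<close> and
  \<open>g\<close> share no variable, that of \<open>f\<close> divides the leading monomial of
  \<open>h\<close>. Subtracting a multiple of \<open>f\<close> removes this term, preserves the
  hypothesis and introduces no variable outside \<open>W\<close>.\<close>

lemma dvd_of_lead_coprime:
  assumes f: "is_lead p f m" and g: "is_lead p g m'" and disj: "keys m \<inter> keys m' = {}"
    and dvd: "f dvd g * h"
  shows "f dvd h"
proof -
  define W where "W = (\<Union>a \<in> keys f. keys a) \<union> (\<Union>a \<in> keys h. keys a)"
  have W: "finite W" by (simp add: W_def)
  have fW: "\<forall>a \<in> keys f. keys a \<subseteq> W" by (auto simp: W_def)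
  have f0: "f \<noteq> 0" and g0: "g \<noteq> 0" using f g by (auto simp: is_lead_def)
  let ?c = "lookup f m"
  have c0: "?c \<noteq> 0" using f by (auto simp: is_lead_def in_keys_iff)
  have main: "f dvd h" if "is_lead p h mh" "\<forall>a \<in> keys h. keys a \<subseteq> W" "f dvd g * h" for h mh
    using wf_monomials[OF W] that
  proof (induction mh arbitrary: h rule: wf_induct_rule)
    case (less mh)
    obtain k where k: "g * h = f * k" using less.prems(3) by (auto elim: dvdE)
    have "h \<noteq> 0" using less.prems(1) by (auto simp: is_lead_def)
    then have "k \<noteq> 0" using k g0 by auto
    then obtain mk where mk: "is_lead p k mk" using is_lead_exists by blast
    have eq: "m' + mh = m + mk"
      using is_lead_mult(1)[OF g less.prems(1)] is_lead_mult(1)[OF f mk] is_lead_unique unfolding k by blast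
    have le: "lookup m v \<le> lookup mh v" for v
    proof (cases "v \<in> keys m")
      case True
      then have "lookup m' v = 0" using disj by (auto simp: in_keys_iff)
      then show ?thesis
        using arg_cong[OF eq, of "\<lambda>a. lookup a v"] by (simp add: lookup_add)
    qed (simp add: in_keys_iff)
    define d where "d = mh - m"
    have d: "mh = d + m" by (rule poly_mapping_eqI) (simp add: d_def lookup_add lookup_minus le)
    define t where "t = single d (lookup h mh / ?c)"
    define h1 where "h1 = h - t * f"
    have tl: "is_lead p t d"
      using c0 less.prems(1) by (simp add: is_lead_def t_def in_keys_iff)
    have tf: "is_lead p (t * f) mh" "lookup (t * f) mh = lookup h mh"
      using is_lead_mult[OF tl f] c0 unfolding d[symmetric] by (simp_all add: t_def)
    have "f dvd g * h1" unfolding h1_def using less.prems(3) by (simp add: right_diff_distrib)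
    have keys1: "keys h1 \<subseteq> keys h \<union> keys (t * f)"
      by (auto simp: h1_def in_keys_iff lookup_minus)
    have keysd: "keys d \<subseteq> keys mh"
      by (auto simp: d_def in_keys_iff lookup_minus)
    have h1W: "\<forall>a \<in> keys h1. keys a \<subseteq> W"
    proof
      fix a assume "a \<in> keys h1"
      then consider "a \<in> keys h" | "a \<in> keys (t * f)" using keys1 by blast
      then show "keys a \<subseteq> W"
      proof cases
        case 2
        then obtain b where b: "b \<in> keys f" "a = d + b"
          using Poly_Mapping.keys_mult[of t f] by (auto simp: t_def split: if_splits)
        have "keys mh \<subseteq> W" using less.prems(1,2) by (auto simp: is_lead_def)
        then show ?thesis using b fW keysd Poly_Mapping.keys_add[of d b] by blast
      qed (use less.prems(2) in auto)
    qed
    have "f dvd h1"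
    proof (cases "h1 = 0")
      case False
      then obtain m1 where m1: "is_lead p h1 m1" using is_lead_exists by blast
      then have m1k: "m1 \<in> keys h1" by (simp add: is_lead_def)
      have "m1 \<noteq> mh" using m1k tf(2) by (auto simp: h1_def in_keys_iff lookup_minus)
      moreover have "m1 \<in> keys h \<union> keys (t * f)" using m1k keys1 by blast
      ultimately have "Poly_Mapping.map_key p m1 < Poly_Mapping.map_key p mh"
        using tf(1) less.prems(1) by (auto simp: is_lead_def)
      moreover have "keys m1 \<subseteq> W" "keys mh \<subseteq> W"
        using h1W m1k less.prems(1,2) by (auto simp: is_lead_def)
      ultimately show ?thesis using less.IH[OF _ m1 h1W \<open>f dvd g * h1\<close>] by auto
    qed simp
    then have "f dvd h1 + t * f" by simp
    then show ?case by (simp add: h1_def)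
  qed
  show ?thesis
  proof (cases "h = 0")
    case False
    then obtain mh where "is_lead p h mh" using is_lead_exists by blast
    then show ?thesis using main dvd by (auto simp: W_def)
  qed simp
qed

lemma coprime_in_of_leads:
  assumes "is_lead p f m" "is_lead p g m'" "keys m \<inter> keys m' = {}"
  shows "coprime_in (range to_fract) (to_fract f) (to_fract g)"
  unfolding coprime_in_def
proof (intro allI impI)
  fix y assume "to_fract f * y \<in> range to_fract \<and> to_fract g * y \<in> range to_fract"
  then obtain a b where ab: "to_fract f * y = to_fract a" "to_fract g * y = to_fract b" by auto
  have f0: "f \<noteq> 0" using assms(1) by (auto simp: is_lead_def)
  have "to_fract (g * a) = to_fract (f * b)" by (simp add: ab[symmetric])
  then have "g * a = f * b" by (rule to_fract_eq_iff[THEN iffD1])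
  then have "f dvd g * a" by simp
  then have "f dvd a" by (rule dvd_of_lead_coprime[OF assms])
  then obtain c where "a = f * c" by (auto elim: dvdE)
  then have "y = to_fract c" using ab(1) f0 by simp
  then show "y \<in> range to_fract" by simp
qed

end

lemma is_subring_range_to_fract: "is_subring (range (to_fract :: 'a::idom \<Rightarrow> 'a fract))"
  unfolding is_subring_def
proof (intro conjI ballI)
  show "1 \<in> range (to_fract :: 'a \<Rightarrow> 'a fract)" by (metis rangeI to_fract_1)
  fix a b :: "'a fract" assume "a \<in> range to_fract" "b \<in> range to_fract"
  then show "a + b \<in> range to_fract" "a * b \<in> range to_fract" "- a \<in> range to_fract"
    by (metis (no_types, lifting) rangeE rangeI to_fract_add to_fract_mult to_fract_uminus)+
qed


section \<open>Leading monomials of rational functions\<close>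

text \<open>In contrast to \<open>is_lead\<close>, the order is fixed to that of
  \<open>smaller\<close>, and the leading coefficient is recorded, as it has to stay 1 through all
  exchanges.\<close>

definition plead :: "mpoly \<Rightarrow> complex \<Rightarrow> monomial \<Rightarrow> bool" where
  "plead f c m \<longleftrightarrow> c \<noteq> 0 \<and> lookup f m = c \<and> (\<forall>k \<in> keys f. k \<le> m)"

lemma plead_iff: "plead f c m \<longleftrightarrow> is_lead id f m \<and> lookup f m = c"
  by (auto simp: plead_def is_lead_def map_key_id_eq in_keys_iff order_le_less)

lemma plead_mult: "plead f c m \<Longrightarrow> plead g c' m' \<Longrightarrow> plead (f * g) (c * c') (m + m')"
  unfolding plead_iff using is_lead_mult[OF bij_id, of f m g m'] by auto

lemma plead_nonzero: "plead f c m \<Longrightarrow> f \<noteq> 0"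
  by (auto simp: plead_def)

lemma plead_exists: "f \<noteq> 0 \<Longrightarrow> \<exists>c m. plead f c m"
  unfolding plead_iff using is_lead_exists[OF bij_id] by blast

lemma plead_unique: "plead f c m \<Longrightarrow> plead f c' m' \<Longrightarrow> c = c' \<and> m = m'"
  unfolding plead_iff using is_lead_unique[OF bij_id, of f m m'] by auto

lemma plead_lead_monomial: "plead f c m \<Longrightarrow> lead_monomial f = m"
  unfolding lead_monomial_def plead_def by (intro Max_eqI) (auto simp: in_keys_iff)

lemma plead_add:
  assumes "plead f c m" "plead g c' m'" "m' < m"
  shows "plead (f + g) c m"
proof -
  have "m \<notin> keys g" using assms by (auto simp: plead_def)
  then have "lookup (f + g) m = c" using assms by (simp add: lookup_add plead_def in_keys_iff)
  moreover have "k \<le> m" if "k \<in> keys (f + g)" for k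
    using that Poly_Mapping.keys_add[of f g] assms unfolding plead_def by fastforce
  ultimately show ?thesis using assms by (simp add: plead_def)
qed

definition int_monomial :: "monomial \<Rightarrow> (nat \<times> nat) \<Rightarrow>\<^sub>0 int" where
  "int_monomial = Poly_Mapping.map int"

lemma lookup_int_monomial: "lookup (int_monomial m) v = int (lookup m v)"
  by (simp add: int_monomial_def map.rep_eq when_def)

lemma int_monomial_add: "int_monomial (m + m') = int_monomial m + int_monomial m'"
  by (rule poly_mapping_eqI) (simp add: lookup_int_monomial lookup_add)

lemma int_monomial_0 [simp]: "int_monomial 0 = 0"
  by (rule poly_mapping_eqI) (simp add: lookup_int_monomial)

lemma int_monomial_less: "int_monomial m < int_monomial m' \<longleftrightarrow> m < m'"
  by (simp add: less_poly_mapping.rep_eq less_fun_def lookup_int_monomial)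

text \<open>Leading exponents of fractions are integer vectors under the same lexicographic rule.
  The denominator is normalized to leading coefficient 1, which every nonzero fraction
  permits.\<close>

definition leads :: "ratfun \<Rightarrow> complex \<Rightarrow> ((nat \<times> nat) \<Rightarrow>\<^sub>0 int) \<Rightarrow> bool" where
  "leads x c \<mu> \<longleftrightarrow> (\<exists>f g m m'. plead f c m \<and> plead g 1 m' \<and> x = to_fract f / to_fract g \<and>
     \<mu> = int_monomial m - int_monomial m')"

lemma leadsI:
  "plead f c m \<Longrightarrow> plead g 1 m' \<Longrightarrow> leads (to_fract f / to_fract g) c (int_monomial m - int_monomial m')"
  unfolding leads_def by blast

lemma leads_nonzero: "leads x c \<mu> \<Longrightarrow> x \<noteq> 0"
  unfolding leads_def using plead_nonzero by force

lemma plead_Const: "c \<noteq> 0 \<Longrightarrow> plead (single m c) c m"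
  by (simp add: plead_def)

lemma plead_1: "plead 1 1 0"
  using plead_Const[of 1 0] by simp

lemma leads_to_fract: "plead f c m \<Longrightarrow> leads (to_fract f) c (int_monomial m)"
  using leadsI[of f c m 1 0] plead_1 by simp

lemma leads_1: "leads 1 1 0"
  using leads_to_fract[OF plead_1] by simp

lemma leads_mult:
  assumes "leads x c \<mu>" "leads y d \<nu>" shows "leads (x * y) (c * d) (\<mu> + \<nu>)"
proof -
  obtain f g m m' where 1: "plead f c m" "plead g 1 m'" "x = to_fract f / to_fract g" "\<mu> = int_monomial m - int_monomial m'"
    using assms(1) by (auto simp: leads_def)
  obtain f' g' k k' where 2: "plead f' d k" "plead g' 1 k'" "y = to_fract f' / to_fract g'" "\<nu> = int_monomial k - int_monomial k'"
    using assms(2) by (auto simp: leads_def)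
  have "leads (to_fract (f * f') / to_fract (g * g')) (c * d) (int_monomial (m + k) - int_monomial (m' + k'))"
    using plead_mult[OF 1(1) 2(1)] plead_mult[OF 1(2) 2(2)] by (intro leadsI) auto
  then show ?thesis by (simp add: 1 2 int_monomial_add algebra_simps)
qed

lemma leads_inverse:
  assumes "leads x 1 \<mu>" shows "leads (inverse x) 1 (- \<mu>)"
proof -
  obtain f g m m' where 1: "plead f 1 m" "plead g 1 m'" "x = to_fract f / to_fract g" "\<mu> = int_monomial m - int_monomial m'"
    using assms by (auto simp: leads_def)
  show ?thesis using leadsI[OF 1(2,1)] by (simp add: 1)
qed

lemma leads_divide: "leads x c \<mu> \<Longrightarrow> leads y 1 \<nu> \<Longrightarrow> leads (x / y) c (\<mu> - \<nu>)"
  using leads_mult[OF _ leads_inverse, of x c \<mu> y \<nu>] by (simp add: divide_inverse)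

lemma leads_add:
  assumes "leads x c \<mu>" "leads y d \<nu>" "\<nu> < \<mu>" shows "leads (x + y) c \<mu>"
proof -
  obtain f g m m' where 1: "plead f c m" "plead g 1 m'" "x = to_fract f / to_fract g" "\<mu> = int_monomial m - int_monomial m'"
    using assms(1) by (auto simp: leads_def)
  obtain f' g' k k' where 2: "plead f' d k" "plead g' 1 k'" "y = to_fract f' / to_fract g'" "\<nu> = int_monomial k - int_monomial k'"
    using assms(2) by (auto simp: leads_def)
  have "int_monomial (k + m') < int_monomial (m + k')"
    using assms(3) unfolding 1 2 int_monomial_add by (simp add: algebra_simps)
  then have "k + m' < m + k'" by (simp add: int_monomial_less)
  moreover have "plead (f * g') c (m + k')" "plead (f' * g) d (k + m')" "plead (g * g') 1 (m' + k')"
    using plead_mult[OF 1(1) 2(2)] plead_mult[OF 2(1) 1(2)] plead_mult[OF 1(2) 2(2)] by auto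
  ultimately have "leads (to_fract (f * g' + f' * g) / to_fract (g * g')) c (int_monomial (m + k') - int_monomial (m' + k'))"
    by (intro leadsI plead_add)
  moreover have "x + y = to_fract (f * g' + f' * g) / to_fract (g * g')"
    using plead_nonzero[OF 1(2)] plead_nonzero[OF 2(2)] by (simp add: 1 2 field_simps)
  ultimately show ?thesis by (simp add: 1 int_monomial_add)
qed

text \<open>Comparing leading terms in \<open>f * b = a\<close> shows that the difference of
  exponents is the leading monomial of \<open>f\<close>, hence without negative entries.\<close>

lemma leads_to_fractD:
  assumes "leads (to_fract f) c \<mu>" shows "\<exists>m. plead f c m \<and> \<mu> = int_monomial m"
proof -
  obtain a b m m' where 1: "plead a c m" "plead b 1 m'" "to_fract f = to_fract a / to_fract b" "\<mu> = int_monomial m - int_monomial m'"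
    using assms by (auto simp: leads_def)
  have "b \<noteq> 0" using plead_nonzero 1(2) by blast
  then have "to_fract (f * b) = to_fract a" using 1(3) by simp
  then have fb: "f * b = a" by (rule to_fract_eq_iff[THEN iffD1])
  have "f \<noteq> 0" using assms leads_nonzero by force
  then obtain c' k where k: "plead f c' k" using plead_exists by blast
  have "c' * 1 = c \<and> k + m' = m" using plead_mult[OF k 1(2)] 1(1) plead_unique unfolding fb by blast
  then show ?thesis using k 1(4) by (auto simp: int_monomial_add)
qed

lemma leads_power: "leads x 1 \<mu> \<Longrightarrow> leads (x ^ k) 1 (frag_cmul (int k) \<mu>)"
proof (induction k)
  case (Suc k)
  have "frag_cmul (1 + int k) \<mu> = \<mu> + frag_cmul (int k) \<mu>" unfolding frag_cmul_distrib by simp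
  then show ?case using leads_mult[OF Suc.prems Suc.IH[OF Suc.prems]] by simp
qed (simp add: leads_1)

lemma leads_power_int: "leads x 1 \<mu> \<Longrightarrow> leads (x powi k) 1 (frag_cmul k \<mu>)"
proof (cases "k \<ge> 0")
  case True
  assume "leads x 1 \<mu>"
  from leads_power[OF this, of "nat k"] show ?thesis using True by (simp add: power_int_def)
next
  case False
  assume "leads x 1 \<mu>"
  from leads_inverse[OF leads_power[OF this, of "nat (- k)"]] show ?thesis
    using False by (simp add: power_int_def power_inverse)
qed

lemma leads_prod:
  "(\<And>u. u \<in> A \<Longrightarrow> leads (x u) 1 (\<mu> u)) \<Longrightarrow> leads (\<Prod>u \<in> A. x u) 1 (\<Sum>u \<in> A. \<mu> u)"
proof (induction A rule: infinite_finite_induct)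
  case (insert a A)
  then show ?case using leads_mult[of "x a" 1 "\<mu> a" "\<Prod>u \<in> A. x u" 1] by simp
qed (auto simp: leads_1)

lemma leads_of_int:
  assumes "k \<noteq> 0" shows "leads (of_int k) (of_int k) 0"
proof -
  have "to_fract (of_nat j :: mpoly) = of_nat j" for j by (induction j) auto
  then have "to_fract (of_int k :: mpoly) = of_int k" by (cases k) auto
  moreover have "plead (of_int k) (of_int k) 0"
    using plead_Const[of "of_int k" 0] assms by simp
  ultimately show ?thesis using leads_to_fract[of "of_int k" "of_int k" 0] by simp
qed

lemma leads_sum:
  assumes "finite A" "A \<noteq> {}" "\<And>i. i \<in> A \<Longrightarrow> leads (y i) (c i) (\<mu> i)" "inj_on \<mu> A"
  shows "\<exists>i \<in> A. leads (\<Sum>i \<in> A. y i) (c i) (\<mu> i)"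
  using assms
proof (induction A rule: finite_ne_induct)
  case (insert a A)
  then obtain i where i: "i \<in> A" "leads (\<Sum>i \<in> A. y i) (c i) (\<mu> i)" by auto
  have a: "leads (y a) (c a) (\<mu> a)" using insert.prems by blast
  have "\<mu> a \<noteq> \<mu> i" using insert.prems(2) insert.hyps i(1) by (auto simp: inj_on_def)
  then consider "\<mu> a < \<mu> i" | "\<mu> i < \<mu> a" using less_linear by blast
  then show ?case
  proof cases
    case 1
    then show ?thesis using leads_add[OF i(2) a] i(1) insert.hyps by (auto simp: add.commute)
  next
    case 2
    then show ?thesis using leads_add[OF a i(2)] insert.hyps by auto
  qed
qed simp


section \<open>Leading monomials of seeds\<close>

definition seed_leads :: "('v, ratfun) seed \<Rightarrow> ('v \<Rightarrow> ((nat \<times> nat) \<Rightarrow>\<^sub>0 int)) \<Rightarrow> bool" where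
  "seed_leads S \<mu> \<longleftrightarrow> (\<forall>u \<in> verts S. leads (cvar S u) 1 (\<mu> u)) \<and>
     (\<forall>c. (\<Sum>u \<in> verts S. frag_cmul (c u) (\<mu> u)) = 0 \<longrightarrow> (\<forall>u \<in> verts S. c u = 0))"

text \<open>Linear independence of the leading exponents gives different Laurent monomials different
  leading exponents. The largest one cannot cancel in a combination with nonzero integer
  coefficients, as these remain nonzero in the complex numbers.\<close>

lemma alg_independent_of_leads:
  assumes fin: "finite (verts S)" and S: "seed_leads S \<mu>"
  shows "alg_independent (cvar S) (verts S)"
  unfolding alg_independent_def
proof (intro conjI ballI impI)
  show "cvar S u \<noteq> 0" if "u \<in> verts S" for u
    using S that leads_nonzero unfolding seed_leads_def by blast
  fix F assume F: "F \<in> laurent_polys (verts S)" and F0: "laurent_eval (cvar S) (verts S) F = 0"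
  let ?\<nu> = "\<lambda>g. \<Sum>u \<in> verts S. frag_cmul (lookup g u) (\<mu> u)"
  have lead: "leads (laurent_monom (cvar S) (verts S) g) 1 (?\<nu> g)" for g
    unfolding laurent_monom_def using S by (intro leads_prod leads_power_int) (auto simp: seed_leads_def)
  have inj: "inj_on ?\<nu> (keys F)"
  proof (rule inj_onI)
    fix g g' assume g: "g \<in> keys F" "g' \<in> keys F" "?\<nu> g = ?\<nu> g'"
    then have "(\<Sum>u \<in> verts S. frag_cmul (lookup g u - lookup g' u) (\<mu> u)) = 0"
      by (simp add: frag_cmul_diff_distrib sum_subtractf)
    then have "\<forall>u \<in> verts S. lookup g u = lookup g' u"
      using S unfolding seed_leads_def by fastforce
    moreover have "keys g \<subseteq> verts S" "keys g' \<subseteq> verts S"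
      using F g by (auto simp: laurent_polys_def)
    ultimately show "g = g'" by (intro poly_mapping_eqI) (metis in_keys_iff subsetD)
  qed
  show "F = 0"
  proof (rule ccontr)
    assume "F \<noteq> 0"
    then have ne: "keys F \<noteq> {}" by simp
    have "leads (of_int (lookup F g) * laurent_monom (cvar S) (verts S) g)
        (of_int (lookup F g)) (?\<nu> g)" if "g \<in> keys F" for g
      using leads_mult[OF leads_of_int lead, of "lookup F g" g] that by (simp add: in_keys_iff)
    from leads_sum[OF finite_keys ne this inj] leads_nonzero F0
    show False unfolding pm_eval_def by blast
  qed
qed

lemma seed_leads_mutate:
  assumes fin: "finite (verts S)" and sk: "skew S" and rank: "full_rank S"
    and v: "v \<in> mutable_verts S" and S: "seed_leads S \<mu>"
  shows "\<exists>\<mu>'. seed_leads (mutate v S) \<mu>'"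
proof -
  let ?V = "verts S"
  have vV: "v \<in> ?V" using v by (auto simp: verts_def)
  have lead: "leads (cvar S u) 1 (\<mu> u)" if "u \<in> ?V" for u using S that by (simp add: seed_leads_def)
  define d where "d = (\<lambda>e u. int (nat (e * mult S u v)))"
  define M where "M = (\<lambda>e. \<Sum>u \<in> ?V. frag_cmul (d e u) (\<mu> u))"
  have leadM: "leads (exchange_monom e S v ?V) 1 (M e)" for e
    unfolding exchange_monom_def M_def d_def by (intro leads_prod leads_power lead)
  \<comment> \<open>The difference is the combination of the exponents \<open>\<mu> u\<close> with
    coefficients from column \<open>v\<close>. That column is nonzero, as \<open>full_rank\<close>
    shows when applied to a unit vector.\<close>
  have "M 1 \<noteq> M (-1)"
  proof
    assume "M 1 = M (-1)"
    then have "0 = M 1 - M (-1)" by simp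
    also have "\<dots> = (\<Sum>u \<in> ?V. frag_cmul (mult S u v) (\<mu> u))"
      unfolding M_def d_def sum_subtractf[symmetric] frag_cmul_diff_distrib[symmetric]
      by (rule poly_mapping_eqI) (auto simp: lookup_sum lookup_minus left_diff_distrib[symmetric] intro!: sum.cong)
    finally have zero: "\<forall>u \<in> ?V. mult S u v = 0" using S unfolding seed_leads_def by metis
    define c where "c = (\<lambda>j. if j = v then 1 else 0 :: int)"
    have "\<forall>u \<in> ?V. (\<Sum>j \<in> mutable_verts S. mult S u j * c j) = 0"
      using zero by (auto simp: c_def intro!: sum.neutral)
    then have "c v = 0" using rank v unfolding full_rank_def by blast
    then show False by (simp add: c_def)
  qed
  then consider "M (-1) < M 1" | "M 1 < M (-1)" by (metis linorder_neqE)
  then obtain e where e: "e = 1 \<or> e = -1"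
    "leads (exchange_monom 1 S v ?V + exchange_monom (-1) S v ?V) 1 (M e)"
    using leads_add[OF leadM[of 1] leadM[of "-1"]] leads_add[OF leadM[of "-1"] leadM[of 1]]
    by cases (auto simp: add.commute)
  \<comment> \<open>\<open>M e\<close> does not involve \<open>\<mu> v\<close>, so the change from
    \<mu> to \<mu>' is unimodular. Below, \<open>c'\<close> is its effect on the coefficients of a
    relation.\<close>
  define \<mu>' where "\<mu>' = \<mu>(v := M e - \<mu> v)"
  have "leads (cvar (mutate v S) u) 1 (\<mu>' u)" if "u \<in> ?V" for u
  proof (cases "u = v")
    case True
    then show ?thesis
      using leads_divide[OF e(2) lead[OF vV]] by (simp add: exchange_monoms[OF fin sk] \<mu>'_def)
  next
    case False
    then show ?thesis using lead[OF that] by (simp add: cvar_mutate_other \<mu>'_def)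
  qed
  moreover have "\<forall>u \<in> ?V. c u = 0" if c: "(\<Sum>u \<in> ?V. frag_cmul (c u) (\<mu>' u)) = 0" for c
  proof -
    define c' where "c' = (\<lambda>u. if u = v then - c v else c u + c v * d e u)"
    define V' where "V' = ?V - {v}"
    have V': "?V = insert v V'" "v \<notin> V'" "finite V'" using vV fin by (auto simp: V'_def)
    have dv: "d e v = 0" using skew_diag[OF sk, of v] by (simp add: d_def)
    have "(\<Sum>u \<in> ?V. frag_cmul (c u) (\<mu>' u)) = (\<Sum>u \<in> ?V. frag_cmul (c' u) (\<mu> u))"
    proof -
      have "(\<Sum>u \<in> V'. frag_cmul (c u) (\<mu>' u)) = (\<Sum>u \<in> V'. frag_cmul (c u) (\<mu> u))"
        by (rule sum.cong) (use V' in \<open>auto simp: \<mu>'_def\<close>)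
      moreover have "frag_cmul (c v) (\<mu>' v) = (\<Sum>u \<in> V'. frag_cmul (c v * d e u) (\<mu> u)) - frag_cmul (c v) (\<mu> v)"
        using V' dv by (simp add: \<mu>'_def M_def V'(1) frag_cmul_sum)
          (rule poly_mapping_eqI, simp add: lookup_minus lookup_sum sum_distrib_left algebra_simps)
      moreover have "(\<Sum>u \<in> V'. frag_cmul (c' u) (\<mu> u)) = (\<Sum>u \<in> V'. frag_cmul (c u) (\<mu> u)) + (\<Sum>u \<in> V'. frag_cmul (c v * d e u) (\<mu> u))"
        unfolding sum.distrib[symmetric] frag_cmul_distrib[symmetric]
        by (rule sum.cong) (use V' in \<open>auto simp: c'_def\<close>)
      ultimately show ?thesis using V' by (simp add: c'_def)
    qed
    then have c0: "\<forall>u \<in> ?V. c' u = 0" using c S unfolding seed_leads_def by metis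
    then have cv: "c v = 0" using vV by (auto simp: c'_def)
    show ?thesis
    proof
      fix u assume "u \<in> ?V"
      then have "c' u = 0" using c0 by blast
      then show "c u = 0" using cv by (cases "u = v") (auto simp: c'_def)
    qed
  qed
  ultimately have "seed_leads (mutate v S) \<mu>'" by (auto simp: seed_leads_def)
  then show ?thesis by blast
qed

lemma mutation_class_invariants:
  assumes S: "S \<in> mutation_class S0"
    and S0: "finite (verts S0)" "skew S0" "full_rank S0" "seed_leads S0 \<mu>"
  shows "finite (verts S) \<and> skew S \<and> full_rank S \<and> (\<exists>\<mu>. seed_leads S \<mu>)"
  using S
proof induction
  case initial
  then show ?case using S0 by blast
next
  case (mutation S v)
  then show ?case using skew_mutate full_rank_mutate seed_leads_mutate by (metis verts_mutate)
qed

lemma mutation_class_good: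
  assumes "S \<in> mutation_class S0"
    and "finite (verts S0)" "skew S0" "full_rank S0" "seed_leads S0 \<mu>"
  shows "good_seed S"
  using mutation_class_invariants[OF assms] alg_independent_of_leads unfolding good_seed_def by blast


section \<open>Minors\<close>

definition perm_monom :: "nat list \<Rightarrow> (nat \<Rightarrow> nat) \<Rightarrow> monomial" where
  "perm_monom rs q = (\<Sum>a < length rs. single (rs ! a, q a + 1) 1)"

text \<open>The rows form a list, in any order and possibly with repetitions. This makes the sign of
  a row permutation and the vanishing at a repeated row available for the Pluecker relation.\<close>

definition row_minor :: "nat list \<Rightarrow> mpoly" where
  "row_minor rs = det (mat (length rs) (length rs) (\<lambda>(a, b). Var (rs ! a, b + 1)))"

lemma flag_minor_row_minor: "flag_minor I = row_minor (sorted_list_of_set I)"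
  by (simp add: flag_minor_def row_minor_def)

lemma prod_singles: "(\<Prod>a \<in> A. single (m a) (1 :: 'c::comm_semiring_1)) = single (\<Sum>a \<in> A. m a) 1"
  for m :: "'a \<Rightarrow> 'm::comm_monoid_add"
  by (induction A rule: infinite_finite_induct) (auto simp: mult_single)

lemma signof_single:
  "(signof q :: mpoly) * single m 1 = single m (signof q)"
  by (simp add: sign_def single_uminus)

lemma row_minor_expand:
  "row_minor rs = (\<Sum>q | q permutes {0..<length rs}. single (perm_monom rs q) (signof q))"
proof -
  let ?k = "length rs"
  let ?A = "mat ?k ?k (\<lambda>(a, b). Var (rs ! a, b + 1))"
  have "row_minor rs = (\<Sum>q | q permutes {0..<?k}. signof q * (\<Prod>i = 0..<?k. ?A $$ (i, q i)))"
    unfolding row_minor_def by (rule det_def') simp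
  also have "\<dots> = (\<Sum>q | q permutes {0..<?k}. single (perm_monom rs q) (signof q))"
  proof (rule sum.cong[OF refl])
    fix q assume "q \<in> {q. q permutes {0..<?k}}"
    then have q: "q permutes {0..<?k}" by simp
    have "(\<Prod>i = 0..<?k. ?A $$ (i, q i)) = (\<Prod>i = 0..<?k. single (single (rs ! i, q i + 1) 1) 1)"
      by (rule prod.cong) (use permutes_in_image[OF q] in \<open>auto simp: Var_def\<close>)
    also have "\<dots> = single (perm_monom rs q) 1"
      by (simp add: prod_singles perm_monom_def atLeast0LessThan)
    finally show "signof q * (\<Prod>i = 0..<?k. ?A $$ (i, q i)) = single (perm_monom rs q) (signof q)"
      by (simp add: signof_single)
  qed
  finally show ?thesis .
qed

lemma lookup_perm_monom:
  assumes "distinct rs"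
  shows "a < length rs \<Longrightarrow> lookup (perm_monom rs q) (rs ! a, c) = (if c = q a + 1 then 1 else 0)"
    and "r \<notin> set rs \<Longrightarrow> lookup (perm_monom rs q) (r, c) = 0"
proof -
  assume a: "a < length rs"
  have "lookup (perm_monom rs q) (rs ! a, c) = (\<Sum>b < length rs. if b = a then (if c = q a + 1 then 1 else 0) else 0)"
    unfolding perm_monom_def lookup_sum
    by (rule sum.cong) (use assms a in \<open>auto simp: lookup_single when_def nth_eq_iff_index_eq\<close>)
  then show "lookup (perm_monom rs q) (rs ! a, c) = (if c = q a + 1 then 1 else 0)"
    using a by simp
next
  assume "r \<notin> set rs"
  then show "lookup (perm_monom rs q) (r, c) = 0"
    unfolding perm_monom_def lookup_sum by (intro sum.neutral) (auto simp: lookup_single when_def)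
qed

lemma keys_perm_monom: "keys (perm_monom rs q) \<subseteq> (\<lambda>a. (rs ! a, q a + 1)) ` {..<length rs}"
proof
  fix v assume "v \<in> keys (perm_monom rs q)"
  then have "(\<Sum>a < length rs. lookup (single (rs ! a, q a + 1) (1::nat)) v) \<noteq> 0"
    by (simp add: in_keys_iff perm_monom_def lookup_sum)
  then obtain a where "a < length rs" "lookup (single (rs ! a, q a + 1) (1::nat)) v \<noteq> 0"
    by (meson lessThan_iff sum.neutral)
  then show "v \<in> (\<lambda>a. (rs ! a, q a + 1)) ` {..<length rs}"
    by (auto simp: lookup_single when_def split: if_splits)
qed

lemma is_lead_row_minor:
  assumes q0: "q0 permutes {0..<length rs}"
    and less: "\<And>q. q permutes {0..<length rs} \<Longrightarrow> q \<noteq> q0 \<Longrightarrow>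
      Poly_Mapping.map_key p (perm_monom rs q) < Poly_Mapping.map_key p (perm_monom rs q0)"
  shows "is_lead p (row_minor rs) (perm_monom rs q0)"
    and "lookup (row_minor rs) (perm_monom rs q0) = signof q0"
proof -
  let ?P = "{q. q permutes {0..<length rs}}"
  have fin: "finite ?P" by (simp add: finite_permutations)
  have lk: "lookup (row_minor rs) m = (\<Sum>q \<in> ?P. if perm_monom rs q = m then signof q else 0)" for m
    by (simp add: row_minor_expand lookup_sum lookup_single when_def)
  have "lookup (row_minor rs) (perm_monom rs q0) = (\<Sum>q \<in> ?P. if q = q0 then signof q else 0)"
    unfolding lk
  proof (rule sum.cong[OF refl])
    fix q assume "q \<in> ?P"
    then have "perm_monom rs q = perm_monom rs q0 \<longleftrightarrow> q = q0"
      using less[of q] by (cases "q = q0") (auto dest: less_imp_neq)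
    then show "(if perm_monom rs q = perm_monom rs q0 then signof q else 0) = (if q = q0 then signof q else (0::complex))"
      by simp
  qed
  then show 1: "lookup (row_minor rs) (perm_monom rs q0) = signof q0"
    using q0 fin by simp
  have "k = perm_monom rs q0 \<or> Poly_Mapping.map_key p k < Poly_Mapping.map_key p (perm_monom rs q0)"
    if k: "k \<in> keys (row_minor rs)" for k
  proof -
    have "(\<Sum>q \<in> ?P. if perm_monom rs q = k then signof q else (0::complex)) \<noteq> 0"
      using k unfolding in_keys_iff lk .
    then obtain q where "q \<in> ?P" "(if perm_monom rs q = k then signof q else (0::complex)) \<noteq> 0"
      by (rule sum.not_neutral_contains_not_neutral)
    then have "q \<in> ?P" "perm_monom rs q = k" by (auto split: if_splits)
    then show ?thesis using less by (cases "q = q0") auto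
  qed
  moreover have "perm_monom rs q0 \<in> keys (row_minor rs)"
    using 1 by (simp add: in_keys_iff)
  ultimately show "is_lead p (row_minor rs) (perm_monom rs q0)" by (auto simp: is_lead_def)
qed

lemma permutes_first_difference:
  fixes k :: nat
  assumes q: "q permutes {0..<k}" and q0: "q0 permutes {0..<k}" and ne: "q \<noteq> q0"
  obtains a where "a < k" "q a \<noteq> q0 a" "\<And>b. b < a \<Longrightarrow> q b = q0 b"
proof -
  have ex: "\<exists>a. q a \<noteq> q0 a" using ne by auto
  define a where "a = (LEAST a. q a \<noteq> q0 a)"
  have a: "q a \<noteq> q0 a" unfolding a_def using LeastI_ex[OF ex] .
  have "q b = q0 b" if "b < a" for b using not_less_Least that unfolding a_def by blast
  moreover have "a < k" using a q q0 by (metis atLeastLessThan_iff permutes_not_in zero_le)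
  ultimately show ?thesis using that a by blast
qed

definition diag_monom :: "nat list \<Rightarrow> monomial" where
  "diag_monom rs = perm_monom rs id"

text \<open>At the first row \<open>a\<close> where a permutation leaves the identity it must go to
  the right, as the columns to the left are taken. There the diagonal has the variable
  \<open>(rs ! a, a + 1)\<close> and the permutation does not, while all larger variables have the
  same exponents in both.\<close>

lemma plead_row_minor:
  assumes "sorted_wrt (<) rs"
  shows "plead (row_minor rs) 1 (diag_monom rs)"
proof -
  let ?k = "length rs"
  have dist: "distinct rs" using assms strict_sorted_iff by blast
  have "Poly_Mapping.map_key id (perm_monom rs q) < Poly_Mapping.map_key id (perm_monom rs id)"
    if q: "q permutes {0..<?k}" and ne: "q \<noteq> id" for q
  proof -
    obtain a where a: "a < ?k" "q a \<noteq> id a" "\<And>b. b < a \<Longrightarrow> q b = id b"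
      using permutes_first_difference[OF q permutes_id ne] by metis
    have "q a > a"
    proof (rule ccontr)
      assume "\<not> q a > a"
      then have "q a < a" using a(2) by simp
      then have "q (q a) = q a" using a(3) by simp
      then have "q a = a" using permutes_inj[OF q] by (metis injD)
      then show False using a(2) by simp
    qed
    have "lookup (perm_monom rs q) v' = lookup (perm_monom rs id) v'"
      if "v' < (rs ! a, a + 1)" for v'
    proof -
      obtain r c where v': "v' = (r, c)" by force
      show ?thesis
      proof (cases "r \<in> set rs")
        case True
        then obtain b where b: "b < ?k" "r = rs ! b" by (metis in_set_conv_nth)
        have "b \<le> a"
        proof (rule ccontr)
          assume "\<not> b \<le> a"
          then have "rs ! a < rs ! b" using assms b(1) by (simp add: sorted_wrt_iff_nth_less)
          then show False using that by (simp add: v' b less_prod_def')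
        qed
        then consider "b < a" | "b = a" by linarith
        then show ?thesis
        proof cases
          case 1
          then show ?thesis using b a(3) by (simp add: v' lookup_perm_monom[OF dist])
        next
          case 2
          then have "c < a + 1" using that b by (simp add: v' less_prod_def')
          then show ?thesis using b 2 \<open>q a > a\<close> by (simp add: v' lookup_perm_monom[OF dist])
        qed
      qed (simp add: v' lookup_perm_monom[OF dist])
    qed
    moreover have "lookup (perm_monom rs q) (rs ! a, a + 1) < lookup (perm_monom rs id) (rs ! a, a + 1)"
      using a by (simp add: lookup_perm_monom[OF dist])
    ultimately show ?thesis unfolding map_key_id_eq monomial_less_iff by blast
  qed
  from is_lead_row_minor[OF permutes_id this]
  show ?thesis by (simp add: plead_iff diag_monom_def sign_id)
qed

text \<open>Reversing the order of the columns makes the antidiagonal the leading monomial of a minor.\<close>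

definition rev_cols :: "nat \<Rightarrow> nat \<times> nat \<Rightarrow> nat \<times> nat" where
  "rev_cols K = (\<lambda>(r, c). (r, if c \<le> K then K - c else c))"

lemma bij_rev_cols: "bij (rev_cols K)"
  by (rule o_bij[of "rev_cols K"]) (auto simp: rev_cols_def fun_eq_iff)

lemma antidiag_permutes:
  fixes k :: nat
  shows "(\<lambda>a. if a < k then k - 1 - a else a) permutes {0..<k}"
proof (rule bij_imp_permutes)
  show "bij_betw (\<lambda>a. if a < k then k - 1 - a else a) {0..<k} {0..<k}"
    by (rule bij_betw_byWitness[of _ "\<lambda>a. if a < k then k - 1 - a else a"]) auto
qed simp

definition antidiag_monom :: "nat list \<Rightarrow> monomial" where
  "antidiag_monom rs = perm_monom rs (\<lambda>a. if a < length rs then length rs - 1 - a else a)"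

text \<open>The mirror image of \<open>plead_row_minor\<close>: at the first deviation from the
  antidiagonal the columns to the right are taken. The bound \<open>K\<close> has to cover all
  columns of the minor, so that their order is reversed.\<close>

lemma is_lead_antidiag:
  assumes "sorted_wrt (<) rs" "length rs \<le> K"
  shows "is_lead (rev_cols K) (row_minor rs) (antidiag_monom rs)"
proof -
  let ?k = "length rs"
  define q0 where "q0 = (\<lambda>a. if a < ?k then ?k - 1 - a else a)"
  have q0: "q0 permutes {0..<?k}" unfolding q0_def by (rule antidiag_permutes)
  have dist: "distinct rs" using assms(1) strict_sorted_iff by blast
  have "Poly_Mapping.map_key (rev_cols K) (perm_monom rs q) < Poly_Mapping.map_key (rev_cols K) (perm_monom rs q0)"
    if q: "q permutes {0..<?k}" and ne: "q \<noteq> q0" for q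
  proof -
    obtain a where a: "a < ?k" "q a \<noteq> q0 a" "\<And>b. b < a \<Longrightarrow> q b = q0 b"
      using permutes_first_difference[OF q q0 ne] by metis
    have qa: "q a < ?k - 1 - a"
    proof (rule ccontr)
      assume "\<not> q a < ?k - 1 - a"
      then have gt: "q a > ?k - 1 - a" using a(1,2) by (simp add: q0_def)
      have qk: "q a < ?k" using permutes_in_image[OF q, of a] a(1) by simp
      define b where "b = ?k - 1 - q a"
      have b: "b < a" using gt qk a(1) by (simp add: b_def)
      then have "q b = q a" using a(3)[OF b] a(1) qk by (simp add: q0_def b_def)
      then show False using permutes_inj[OF q] b by (metis injD less_irrefl)
    qed
    let ?v = "(rs ! a, K - (?k - a))"
    have pv: "rev_cols K ?v = (rs ! a, ?k - a)" using assms(2) by (simp add: rev_cols_def)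
    have "lookup (perm_monom rs q) (rev_cols K v') = lookup (perm_monom rs q0) (rev_cols K v')"
      if "v' < ?v" for v'
    proof -
      obtain r c where v': "v' = (r, c)" by force
      obtain c' where rc: "rev_cols K v' = (r, c')" by (simp add: v' rev_cols_def)
      show ?thesis
      proof (cases "r \<in> set rs")
        case True
        then obtain b where b: "b < ?k" "r = rs ! b" by (metis in_set_conv_nth)
        have "b \<le> a"
        proof (rule ccontr)
          assume "\<not> b \<le> a"
          then have "rs ! a < rs ! b" using assms(1) b(1) by (simp add: sorted_wrt_iff_nth_less)
          then show False using that by (simp add: v' b less_prod_def')
        qed
        then consider "b < a" | "b = a" by linarith
        then show ?thesis
        proof cases
          case 1
          then show ?thesis using b a(3) by (simp add: rc lookup_perm_monom[OF dist])
        next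
          case 2
          then have "c < K - (?k - a)" using that b by (simp add: v' less_prod_def')
          then have "c' > ?k - a" using rc by (auto simp: v' rev_cols_def)
          then have "c' \<noteq> q a + 1" "c' \<noteq> q0 a + 1" using qa a(1) by (auto simp: q0_def)
          then show ?thesis using b 2 by (simp add: rc lookup_perm_monom[OF dist])
        qed
      qed (simp add: rc lookup_perm_monom[OF dist])
    qed
    moreover have "lookup (perm_monom rs q) (rev_cols K ?v) < lookup (perm_monom rs q0) (rev_cols K ?v)"
      unfolding pv using a qa by (simp add: lookup_perm_monom[OF dist] q0_def)
    ultimately show ?thesis unfolding map_key_less_iff[OF bij_is_inj[OF bij_rev_cols]] by blast
  qed
  from is_lead_row_minor(1)[OF q0 this] show ?thesis by (simp add: antidiag_monom_def q0_def)
qed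

lemma row_minor_Nil [simp]: "row_minor [] = 1"
  by (simp add: row_minor_def)

text \<open>The minors on the rows \<open>Y @ [x]\<close> depend linearly on the row \<open>x\<close>. Appending their values as a
  last column to the rows \<open>p # Y @ [r, s]\<close> gives a singular matrix, whose determinant is expanded
  along that column.\<close>

lemma plucker_three_term:
  "row_minor (Y @ [r]) * row_minor (p # Y @ [s]) =
    row_minor (p # Y) * row_minor (Y @ [r, s]) + row_minor (Y @ [s]) * row_minor (p # Y @ [r])"
proof -
  define m where "m = length Y"
  define A where "A = (\<lambda>rs. mat (length rs) (length rs) (\<lambda>(a, b). Var (rs ! a, b + 1)))"
  have A: "A rs \<in> carrier_mat (length rs) (length rs)" for rs by (simp add: A_def)
  have minor: "row_minor rs = det (A rs)" for rs by (simp add: row_minor_def A_def)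
  have sq: "(-1) ^ m * ((-1) ^ m * a) = a" for a :: mpoly
    by (simp add: mult.assoc[symmetric] power_mult_distrib[symmetric])
  \<comment> \<open>The cofactors along the last row of \<open>Y @ [x]\<close> do not see
    \<open>x\<close>; the choice of \<open>p\<close> is arbitrary.\<close>
  define C where "C = (\<lambda>c. cofactor (A (Y @ [p])) m c)"
  have del: "mat_delete (A (Y @ [x])) m c = mat_delete (A (Y @ [p])) m c" for x c
    by (rule eq_matI) (auto simp: mat_delete_def A_def m_def nth_append)
  have psi: "row_minor (Y @ [x]) = (\<Sum>c < m + 1. Var (x, c + 1) * C c)" for x
  proof -
    have "row_minor (Y @ [x]) = (\<Sum>c < m + 1. A (Y @ [x]) $$ (m, c) * cofactor (A (Y @ [x])) m c)"
      unfolding minor by (rule laplace_expansion_row) (use A[of "Y @ [x]"] in \<open>auto simp: m_def\<close>)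
    also have "\<dots> = (\<Sum>c < m + 1. Var (x, c + 1) * C c)"
    proof (rule sum.cong[OF refl])
      fix c assume "c \<in> {..<m + 1}"
      then have "A (Y @ [x]) $$ (m, c) = Var (x, c + 1)" by (simp add: A_def m_def)
      moreover have "cofactor (A (Y @ [x])) m c = C c" unfolding C_def cofactor_def del[of x c] ..
      ultimately show "A (Y @ [x]) $$ (m, c) * cofactor (A (Y @ [x])) m c = Var (x, c + 1) * C c" by simp
    qed
    finally show ?thesis .
  qed
  have shift: "row_minor (Y @ [p]) = (-1) ^ m * row_minor (p # Y)"
  proof -
    have del0: "mat_delete (A (p # Y)) 0 c = mat_delete (A (Y @ [p])) m c" for c
      by (rule eq_matI) (auto simp: mat_delete_def A_def m_def nth_append)
    have "row_minor (p # Y) = (\<Sum>c < m + 1. A (p # Y) $$ (0, c) * cofactor (A (p # Y)) 0 c)"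
      unfolding minor by (rule laplace_expansion_row) (use A[of "p # Y"] in \<open>auto simp: m_def\<close>)
    also have "\<dots> = (\<Sum>c < m + 1. (-1) ^ m * (Var (p, c + 1) * C c))"
    proof (rule sum.cong[OF refl])
      fix c assume "c \<in> {..<m + 1}"
      then have "A (p # Y) $$ (0, c) = Var (p, c + 1)" by (simp add: A_def m_def)
      moreover have "cofactor (A (p # Y)) 0 c = (-1) ^ m * C c"
        by (simp add: cofactor_def del0 C_def power_add sq)
      ultimately show "A (p # Y) $$ (0, c) * cofactor (A (p # Y)) 0 c = (-1) ^ m * (Var (p, c + 1) * C c)"
        by simp
    qed
    also have "\<dots> = (-1) ^ m * row_minor (Y @ [p])" unfolding psi sum_distrib_left ..
    finally show ?thesis by (simp add: sq)
  qed
  \<comment> \<open>The rows from \<open>Y\<close> therefore drop out of the expansion along the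
    last column, which leaves the three terms for \<open>p\<close>, \<open>r\<close> and
    \<open>s\<close>.\<close>
  have psi0: "row_minor (Y @ [y]) = 0" if y: "y \<in> set Y" for y
  proof -
    obtain a where a: "a < m" "y = Y ! a" using y by (metis in_set_conv_nth m_def)
    have "row (A (Y @ [y])) a = row (A (Y @ [y])) m"
      by (rule eq_vecI) (use a in \<open>auto simp: A_def m_def nth_append\<close>)
    then show ?thesis unfolding minor
      by (intro det_identical_rows[OF A, of a m]) (use a in \<open>auto simp: m_def\<close>)
  qed
  define R where "R = p # Y @ [r, s]"
  have lenR: "length R = m + 3" by (simp add: R_def m_def)
  define N where "N = mat (m + 3) (m + 3) (\<lambda>(a, b). if b < m + 2 then Var (R ! a, b + 1) else row_minor (Y @ [R ! a]))"
  have N: "N \<in> carrier_mat (m + 3) (m + 3)" by (simp add: N_def)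
  have "det N = 0"
  proof -
    \<comment> \<open>A kernel vector: by \<open>psi\<close> the last column of \<open>N\<close> is
      the combination of the first \<open>m + 1\<close> columns with coefficients
      \<open>C c\<close>. Column \<open>m + 1\<close>, counted from 0, does not take part.\<close>
    define v where "v = vec (m + 3) (\<lambda>c. if c < m + 1 then C c else if c = m + 1 then 0 else - 1 :: mpoly)"
    have v: "v \<in> carrier_vec (m + 3)" by (simp add: v_def)
    have "v $ (m + 2) = - 1" by (simp add: v_def)
    then have "v \<noteq> 0\<^sub>v (m + 3)" by auto
    moreover have "N *\<^sub>v v = 0\<^sub>v (m + 3)"
    proof (rule eq_vecI)
      fix a assume "a < dim_vec (0\<^sub>v (m + 3) :: mpoly vec)"
      then have a: "a < m + 3" by simp
      have "(N *\<^sub>v v) $ a = (\<Sum>c < m + 3. N $$ (a, c) * v $ c)"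
        using a N v by (simp add: scalar_prod_def atLeast0LessThan)
      also have "\<dots> = (\<Sum>c < m + 1. N $$ (a, c) * v $ c) + N $$ (a, m + 1) * v $ (m + 1) + N $$ (a, m + 2) * v $ (m + 2)"
        by (simp add: numeral_3_eq_3)
      also have "\<dots> = (\<Sum>c < m + 1. Var (R ! a, c + 1) * C c) - row_minor (Y @ [R ! a])"
        using a by (simp add: N_def v_def)
      also have "\<dots> = 0" by (simp add: psi)
      finally show "(N *\<^sub>v v) $ a = 0\<^sub>v (m + 3) $ a" using a by simp
    qed (use N in simp)
    ultimately show ?thesis using v det_0_iff_vec_prod_zero[OF N] by blast
  qed
  moreover have "det N = (\<Sum>a < m + 3. N $$ (a, m + 2) * cofactor N a (m + 2))"
    by (rule laplace_expansion_column[OF N]) simp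
  moreover have "\<dots> = N $$ (0, m + 2) * cofactor N 0 (m + 2) + N $$ (m + 1, m + 2) * cofactor N (m + 1) (m + 2)
      + N $$ (m + 2, m + 2) * cofactor N (m + 2) (m + 2)"
  proof -
    have "(\<Sum>a < m + 3. N $$ (a, m + 2) * cofactor N a (m + 2)) = (\<Sum>a \<in> {0, m + 1, m + 2}. N $$ (a, m + 2) * cofactor N a (m + 2))"
    proof (rule sum.mono_neutral_right)
      show "\<forall>a \<in> {..<m + 3} - {0, m + 1, m + 2}. N $$ (a, m + 2) * cofactor N a (m + 2) = 0"
      proof
        fix a assume a: "a \<in> {..<m + 3} - {0, m + 1, m + 2}"
        then obtain b where b: "a = Suc b" "b < m" by (cases a) auto
        then have "R ! a \<in> set Y" by (simp add: R_def nth_append m_def)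
        then show "N $$ (a, m + 2) * cofactor N a (m + 2) = 0" using a psi0 by (simp add: N_def)
      qed
    qed auto
    then show ?thesis by (simp add: add.assoc)
  qed
  moreover have "cofactor N 0 (m + 2) = (-1) ^ m * row_minor (Y @ [r, s])"
  proof -
    have "mat_delete N 0 (m + 2) = A (Y @ [r, s])"
      by (rule eq_matI) (auto simp: mat_delete_def A_def m_def N_def R_def)
    then show ?thesis by (simp add: cofactor_def minor)
  qed
  moreover have "cofactor N (m + 1) (m + 2) = - row_minor (p # Y @ [s])"
  proof -
    have "mat_delete N (m + 1) (m + 2) = A (p # Y @ [s])"
      by (rule eq_matI) (auto simp: mat_delete_def A_def m_def N_def R_def nth_append nth_Cons split: nat.splits)
    moreover have "(-1 :: mpoly) ^ (m + 1 + (m + 2)) = - 1" by (simp add: power_add sq)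
    ultimately show ?thesis by (simp add: cofactor_def minor)
  qed
  moreover have "cofactor N (m + 2) (m + 2) = row_minor (p # Y @ [r])"
  proof -
    have "mat_delete N (m + 2) (m + 2) = A (p # Y @ [r])"
      by (rule eq_matI) (auto simp: mat_delete_def A_def m_def N_def R_def nth_append nth_Cons split: nat.splits)
    moreover have "(-1 :: mpoly) ^ (m + 2 + (m + 2)) = 1" by (simp add: power_add sq)
    ultimately show ?thesis by (simp add: cofactor_def minor)
  qed
  moreover have "N $$ (0, m + 2) = (-1) ^ m * row_minor (p # Y)" "N $$ (m + 1, m + 2) = row_minor (Y @ [r])"
    "N $$ (m + 2, m + 2) = row_minor (Y @ [s])"
    by (simp_all add: N_def R_def shift nth_append m_def)
  ultimately have "((-1) ^ m * (-1) ^ m) * (row_minor (p # Y) * row_minor (Y @ [r, s]))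
      - row_minor (Y @ [r]) * row_minor (p # Y @ [s]) + row_minor (Y @ [s]) * row_minor (p # Y @ [r]) = 0"
    by (simp add: mult_ac)
  moreover have "((-1 :: mpoly) ^ m * (-1) ^ m) = 1" using sq[of 1] by simp
  ultimately show ?thesis by (simp add: algebra_simps)
qed


section \<open>Interval minors\<close>

text \<open>For \<open>j = 0\<close> this is the empty minor 1, which stands in for missing vertices
  of the quiver. Row 0 occurs in the enlarged quiver.\<close>

definition interval_minor :: "nat \<Rightarrow> nat \<Rightarrow> mpoly" where
  "interval_minor i j = row_minor [i..<i + j]"

definition interval_monom :: "nat \<Rightarrow> nat \<Rightarrow> monomial" where
  "interval_monom i j = diag_monom [i..<i + j]"

lemma flag_minor_interval: "flag_minor {i..<i + j} = interval_minor i j"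
  by (simp add: flag_minor_row_minor interval_minor_def)

lemma plead_interval: "plead (interval_minor i j) 1 (interval_monom i j)"
  unfolding interval_minor_def interval_monom_def by (rule plead_row_minor) simp

lemma interval_monom_Suc: "interval_monom i (Suc j) = interval_monom i j + single (i + j, j + 1) 1"
  by (simp add: interval_monom_def diag_monom_def perm_monom_def nth_append)

lemma interval_monom_0: "interval_monom i 0 = 0"
  by (simp add: interval_monom_def diag_monom_def perm_monom_def)

lemma lookup_interval_monom:
  "lookup (interval_monom i j) (r, c) = (if c \<ge> 1 \<and> c \<le> j \<and> r + 1 = i + c then 1 else 0)"
  by (induction j) (auto simp: interval_monom_0 interval_monom_Suc lookup_add lookup_single when_def)

lemma keys_antidiag_interval:
  "v \<in> keys (antidiag_monom [i..<i + j]) \<Longrightarrow> fst v + snd v = i + j"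
  using keys_perm_monom[of "[i..<i + j]"] by (fastforce simp: antidiag_monom_def)

text \<open>On the diagonal of an interval minor, row minus column is \<open>i - 1\<close>; on its
  antidiagonal, row plus column is \<open>i + j\<close>. The diagonal order separates minors with
  different \<open>i\<close>, the antidiagonal order those with equal \<open>i\<close>.\<close>

lemma coprime_interval_minors:
  assumes "(i, j) \<noteq> (i', j')"
  shows "coprime_in (range to_fract) (to_fract (interval_minor i j)) (to_fract (interval_minor i' j'))"
proof (cases "i = i'")
  case True
  have disj: "keys (antidiag_monom [i..<i + j]) \<inter> keys (antidiag_monom [i'..<i' + j']) = {}"
  proof -
    have "i + j \<noteq> i' + j'" using assms True by auto
    then show ?thesis using keys_antidiag_interval[of _ i j] keys_antidiag_interval[of _ i' j'] by (metis disjoint_iff)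
  qed
  show ?thesis
    unfolding interval_minor_def
    by (rule coprime_in_of_leads[OF bij_rev_cols[of "j + j'"] is_lead_antidiag is_lead_antidiag disj]) auto
next
  case False
  have "keys (interval_monom i j) \<inter> keys (interval_monom i' j') = {}"
    using False by (auto simp: in_keys_iff lookup_interval_monom split: if_splits)
  then show ?thesis
    using plead_interval by (intro coprime_in_of_leads[OF bij_id]) (auto simp: plead_iff)
qed

text \<open>\<open>X\<close> is what mutation at \<open>(i, j)\<close> makes of the interval minor.
  Its leading monomial avoids the diagonal of that minor, and so the two are coprime.\<close>

lemma interval_exchange:
  assumes "i \<ge> 1" "j \<ge> 1"
  obtains X m where "interval_minor i j * X =
      interval_minor (i - 1) j * interval_minor i (j + 1) * interval_minor (i + 1) (j - 1) +
      interval_minor (i + 1) j * interval_minor i (j - 1) * interval_minor (i - 1) (j + 1)"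
    and "plead X 1 m" and "keys m \<inter> keys (interval_monom i j) = {}"
proof -
  \<comment> \<open>Minors on an interval with a gap before the last row. Two three-term relations
    share the minor \<open>E i (j - 1)\<close>, and eliminating it yields the exchange
    relation.\<close>
  define E where "E = (\<lambda>i j. row_minor ([i..<i + j] @ [i + j + 1]))"
  have pl: "interval_minor i j * E (i - 1) j =
      interval_minor (i - 1) j * interval_minor i (j + 1) + E i (j - 1) * interval_minor (i - 1) (j + 1)"
    if ge1: "i \<ge> 1" "j \<ge> 1" for i j
  proof -
    obtain i' j' where ij: "i = Suc i'" "j = Suc j'" using ge1 by (cases i; cases j) auto
    define Y where "Y = [Suc i'..<Suc (i' + j')]"
    have Y: "[i'..<Suc (i' + j')] = i' # Y" by (simp add: Y_def upt_conv_Cons del: upt_Suc)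
    have "interval_minor i j = row_minor (Y @ [Suc (i' + j')])"
      "interval_minor (i - 1) j = row_minor (i' # Y)"
      "interval_minor i (j + 1) = row_minor (Y @ [Suc (i' + j'), Suc (Suc (i' + j'))])"
      "interval_minor (i - 1) (j + 1) = row_minor (i' # Y @ [Suc (i' + j')])"
      unfolding interval_minor_def ij using Y by (auto simp: Y_def)
    moreover have "E (i - 1) j = row_minor (i' # Y @ [Suc (Suc (i' + j'))])"
      "E i (j - 1) = row_minor (Y @ [Suc (Suc (i' + j'))])"
      unfolding E_def ij using Y by (auto simp: Y_def)
    ultimately show ?thesis using plucker_three_term[of Y "Suc (i' + j')" i' "Suc (Suc (i' + j'))"] by simp
  qed
  define M1 where "M1 = interval_minor (i - 1) j * interval_minor i (j + 1) * interval_minor (i + 1) (j - 1)"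
  define M2 where "M2 = interval_minor (i + 1) j * interval_minor i (j - 1) * interval_minor (i - 1) (j + 1)"
  have "\<exists>X. interval_minor i j * X = M1 + M2"
  proof (cases "j = 1")
    \<comment> \<open>Here the gap minor \<open>E i 0\<close> is itself an interval minor, so a
      single three-term relation is the exchange relation.\<close>
    case True
    have "interval_minor (i + 1) 1 = E i 0" by (simp add: E_def interval_minor_def)
    moreover have "interval_minor i 0 = 1" "interval_minor (i + 1) 0 = 1" by (simp_all add: interval_minor_def)
    ultimately have "interval_minor i j * E (i - 1) j = M1 + M2"
      using pl[OF assms] True by (simp add: M1_def M2_def)
    then show ?thesis by blast
  next
    case False
    then have j: "j - 1 \<ge> 1" "j - 1 + 1 = j" "i + 1 - 1 = i" using assms by auto
    have "interval_minor i j * (interval_minor (i + 1) (j - 1) * E (i - 1) j - interval_minor (i - 1) (j + 1) * E (i + 1) (j - 1 - 1))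
      = interval_minor (i + 1) (j - 1) * (interval_minor i j * E (i - 1) j)
        - interval_minor (i - 1) (j + 1) * (E (i + 1) (j - 1 - 1) * interval_minor i j)"
      by (simp add: algebra_simps)
    also have "E (i + 1) (j - 1 - 1) * interval_minor i j =
        interval_minor (i + 1) (j - 1) * E i (j - 1) - interval_minor i (j - 1) * interval_minor (i + 1) j"
      using pl[of "i + 1" "j - 1"] j by simp
    also have "interval_minor i j * E (i - 1) j =
      interval_minor (i - 1) j * interval_minor i (j + 1) + E i (j - 1) * interval_minor (i - 1) (j + 1)"
      by (rule pl[OF assms])
    also have "interval_minor (i + 1) (j - 1) * (interval_minor (i - 1) j * interval_minor i (j + 1) + E i (j - 1) * interval_minor (i - 1) (j + 1))
        - interval_minor (i - 1) (j + 1) * (interval_minor (i + 1) (j - 1) * E i (j - 1) - interval_minor i (j - 1) * interval_minor (i + 1) j) = M1 + M2"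
      unfolding M1_def M2_def by (simp only: ring_distribs mult_ac) simp
    finally show ?thesis by blast
  qed
  then obtain X where X: "interval_minor i j * X = M1 + M2" by blast
  obtain i' j' where ij: "i = Suc i'" "j = Suc j'" using assms by (cases i; cases j) auto
  \<comment> \<open>\<open>B\<close> is common to the leading monomials of both products. What
    remains are the diagonal and the antidiagonal of the block with rows \<open>i + j - 1\<close>,
    \<open>i + j\<close> and columns \<open>j\<close>, \<open>j + 1\<close>; the diagonal is
    larger.\<close>
  define B where "B = interval_monom i' j + interval_monom i j' + interval_monom (i + 1) j'"
  have lead1: "plead M1 1 (B + (single (i + j', j) 1 + single (i + j, j + 1) 1))"
  proof -
    have "plead M1 (1 * 1 * 1) (interval_monom i' j + interval_monom i (Suc j) + interval_monom (i + 1) j')"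
      using plead_mult[OF plead_mult[OF plead_interval[of i' j] plead_interval[of i "Suc j"]] plead_interval[of "i + 1" j']]
      by (simp add: M1_def ij)
    then show ?thesis unfolding interval_monom_Suc ij(2) by (simp add: B_def ij interval_monom_Suc add_ac)
  qed
  have lead2: "plead M2 1 (B + (single (i + j', j + 1) 1 + single (i + j, j) 1))"
  proof -
    have "plead M2 (1 * 1 * 1) (interval_monom (i + 1) j + interval_monom i j' + interval_monom i' (Suc j))"
      using plead_mult[OF plead_mult[OF plead_interval[of "i + 1" j] plead_interval[of i j']] plead_interval[of i' "Suc j"]]
      by (simp add: M2_def ij)
    then show ?thesis unfolding interval_monom_Suc ij(2) by (simp add: B_def ij interval_monom_Suc add_ac)
  qed
  have "single (i + j', j + 1) 1 + single (i + j, j) 1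
      < (single (i + j', j) 1 + single (i + j, j + 1) (1::nat))"
    unfolding monomial_less_iff
    by (intro exI[of _ "(i + j', j)"]) (auto simp: lookup_add lookup_single when_def ij less_prod_def')
  then have "B + (single (i + j', j + 1) 1 + single (i + j, j) 1)
      < B + (single (i + j', j) 1 + single (i + j, j + 1) (1::nat))"
    by (rule add_strict_left_mono)
  from plead_add[OF lead1 lead2 this]
  have M: "plead (M1 + M2) 1 (B + (single (i + j', j) 1 + single (i + j, j + 1) 1))" .
  then have "X \<noteq> 0" using X plead_nonzero[OF M] by auto
  then obtain c m where cm: "plead X c m" using plead_exists by blast
  from plead_unique[OF plead_mult[OF plead_interval[of i j] cm, unfolded X] M]
  have c: "c = 1" and m: "interval_monom i j + m = B + (single (i + j', j) 1 + single (i + j, j + 1) 1)"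
    by auto
  have "interval_monom i j + m = interval_monom i j + (interval_monom i' j + interval_monom (i + 1) j' + single (i + j, j + 1) 1)"
    unfolding m B_def unfolding ij(2) interval_monom_Suc by (simp add: add_ac)
  \<comment> \<open>The two interval monomials lie on the neighbouring diagonals; the last variable
    lies on the diagonal of the interval minor, one place beyond its end.\<close>
  then have m': "m = interval_monom i' j + interval_monom (i + 1) j' + single (i + j, j + 1) 1" by simp
  have "keys m \<inter> keys (interval_monom i j) = {}"
  proof (rule ccontr)
    assume "keys m \<inter> keys (interval_monom i j) \<noteq> {}"
    then obtain r c where "lookup m (r, c) \<noteq> 0" "lookup (interval_monom i j) (r, c) \<noteq> 0"
      by (auto simp: in_keys_iff)
    then show False
      unfolding m' lookup_add lookup_interval_monom lookup_single by (auto simp: ij when_def split: if_splits)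
  qed
  then show ?thesis using that X cm c M1_def M2_def by blast
qed


section \<open>Interval seeds\<close>

text \<open>The quiver of intervals in \<open>{e..N}\<close>. For \<open>e = 1\<close> and \<open>N = n\<close> this is the initial seed. In the
  quiver for \<open>e = 0\<close> and \<open>N = n + 1\<close> all its vertices are mutable.\<close>

definition interval_verts :: "nat \<Rightarrow> nat \<Rightarrow> (nat \<times> nat) set" where
  "interval_verts e N = {(i, j). i \<ge> e \<and> j \<ge> 1 \<and> i + j \<le> N + 1}"

definition interval_frozen :: "nat \<Rightarrow> nat \<Rightarrow> (nat \<times> nat) set" where
  "interval_frozen e N = {(i, j) \<in> interval_verts e N. i = e \<or> i + j = N + 1}"

definition interval_edge :: "nat \<Rightarrow> nat \<Rightarrow> nat \<times> nat \<Rightarrow> nat \<times> nat \<Rightarrow> bool" where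
  "interval_edge e N = (\<lambda>(i, j) (k, l). (i, j) \<in> interval_verts e N \<and> (k, l) \<in> interval_verts e N \<and>
     (k = i + 1 \<and> l = j \<or> k = i \<and> j = l + 1 \<or> i = k + 1 \<and> l = j + 1))"

definition interval_seed :: "nat \<Rightarrow> nat \<Rightarrow> (nat \<times> nat, ratfun) seed" where
  "interval_seed e N = \<lparr>
     frozen_verts = interval_frozen e N,
     mutable_verts = interval_verts e N - interval_frozen e N,
     mult = (\<lambda>a b. if interval_edge e N a b then 1 else if interval_edge e N b a then - 1 else 0),
     cvar = (\<lambda>(i, j). to_fract (interval_minor i j)) \<rparr>"

lemma initial_seed_interval: "initial_seed n = interval_seed 1 n"
proof -
  have v: "Q_verts n = interval_verts 1 n" by (auto simp: Q_verts_def interval_verts_def)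
  then have f: "Q_frozen n = interval_frozen 1 n" by (auto simp: Q_frozen_def interval_frozen_def)
  have e: "Q_edge n = interval_edge 1 n"
    by (intro ext) (auto simp: Q_edge_def interval_edge_def v)
  show ?thesis by (simp only: initial_seed_def interval_seed_def flag_minor_interval v f e)
qed

lemma interval_seed_simps:
  "verts (interval_seed e N) = interval_verts e N"
  "mutable_verts (interval_seed e N) = {(i, j). i > e \<and> j \<ge> 1 \<and> i + j \<le> N}"
  "cvar (interval_seed e N) (i, j) = to_fract (interval_minor i j)"
  by (auto simp: interval_seed_def verts_def interval_frozen_def interval_verts_def)

lemma finite_interval_verts: "finite (interval_verts e N)"
  by (rule finite_subset[of _ "{..N + 1} \<times> {..N + 1}"]) (auto simp: interval_verts_def)

lemma interval_edge_asym: "interval_edge e N a b \<Longrightarrow> \<not> interval_edge e N b a"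
  by (auto simp: interval_edge_def)

lemma skew_interval_seed: "skew (interval_seed e N)"
  unfolding skew_def using interval_edge_asym by (auto simp: interval_seed_def)

text \<open>Triangularity: the row of \<open>(i - 1, j)\<close> has entry 1 at
  \<open>(i, j)\<close>, and all other neighbours of that vertex precede \<open>(i, j)\<close>
  lexicographically. The least vertex with a nonzero coefficient then contradicts the equation of
  this row.\<close>

lemma full_rank_interval_seed: "full_rank (interval_seed e N)"
  unfolding full_rank_def
proof (intro allI impI, rule ccontr)
  let ?S = "interval_seed e N"
  fix c :: "nat \<times> nat \<Rightarrow> int"
  assume zero: "\<forall>u \<in> verts ?S. (\<Sum>v \<in> mutable_verts ?S. mult ?S u v * c v) = 0"
    and "\<not> (\<forall>v \<in> mutable_verts ?S. c v = 0)"
  then have ex: "\<exists>v. v \<in> mutable_verts ?S \<and> c v \<noteq> 0" by blast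
  define w where "w = (LEAST v. v \<in> mutable_verts ?S \<and> c v \<noteq> 0)"
  have w: "w \<in> mutable_verts ?S" "c w \<noteq> 0" using LeastI_ex[OF ex] by (auto simp: w_def)
  have min: "c v = 0" if "v \<in> mutable_verts ?S" "v < w" for v
    using not_less_Least[of v] that unfolding w_def by blast
  obtain i j where ij: "w = (i, j)" by force
  have bounds: "i > e" "j \<ge> 1" "i + j \<le> N" using w(1) by (auto simp: ij interval_seed_simps)
  let ?u = "(i - 1, j)"
  have u: "?u \<in> verts ?S" using bounds by (auto simp: interval_seed_simps interval_verts_def)
  have fin: "finite (mutable_verts ?S)"
    using finite_subset[OF mutable_subset_verts[of ?S]] finite_interval_verts by (simp add: interval_seed_simps)
  have "(\<Sum>v \<in> mutable_verts ?S. mult ?S ?u v * c v) = (\<Sum>v \<in> {w}. mult ?S ?u v * c v)"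
  proof (rule sum.mono_neutral_right[OF fin])
    show "\<forall>v \<in> mutable_verts ?S - {w}. mult ?S ?u v * c v = 0"
    proof
      fix v assume v: "v \<in> mutable_verts ?S - {w}"
      show "mult ?S ?u v * c v = 0"
      proof (cases "mult ?S ?u v = 0")
        case False
        then have "interval_edge e N ?u v \<or> interval_edge e N v ?u"
          by (auto simp: interval_seed_def split: if_splits)
        then have "v < w"
          using v bounds by (cases v) (auto simp: interval_edge_def ij less_prod_def')
        then show ?thesis using min v by simp
      qed simp
    qed
  qed (use w in simp)
  moreover have "mult ?S ?u w = 1"
    using bounds by (auto simp: interval_seed_def interval_edge_def interval_verts_def ij)
  ultimately show False using zero u w(2) by simp
qed

text \<open>In a relation, the exponent of the \<open>k\<close>-th variable on the diagonal of
  \<open>i\<close> is the sum of the \<open>c (i, j')\<close> with \<open>j' \<ge> k\<close>. The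
  difference for \<open>k = j\<close> and \<open>k = j + 1\<close> isolates
  \<open>c (i, j)\<close>.\<close>

lemma seed_leads_interval_seed:
  "seed_leads (interval_seed e N) (\<lambda>(i, j). int_monomial (interval_monom i j))"
  unfolding seed_leads_def
proof (intro conjI ballI allI impI)
  let ?S = "interval_seed e N" and ?V = "interval_verts e N"
  let ?\<mu> = "\<lambda>(i, j). int_monomial (interval_monom i j)"
  show "leads (cvar ?S u) 1 (?\<mu> u)" for u
    by (cases u) (simp add: interval_seed_simps leads_to_fract plead_interval)
  fix c u assume c: "(\<Sum>u \<in> verts ?S. frag_cmul (c u) (?\<mu> u)) = 0" and u: "u \<in> verts ?S"
  obtain i j where ij: "u = (i, j)" by force
  have j: "j \<ge> 1" using u by (auto simp: ij interval_seed_simps interval_verts_def)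
  have T: "(\<Sum>(i', j') \<in> ?V. c (i', j') * (if i' = i \<and> j' \<ge> k then 1 else 0)) = 0" if k: "k \<ge> 1" for k
  proof -
    have "(\<Sum>(i', j') \<in> ?V. c (i', j') * (if i' = i \<and> j' \<ge> k then 1 else 0))
        = lookup (\<Sum>u \<in> verts ?S. frag_cmul (c u) (?\<mu> u)) (i + k - 1, k)"
      unfolding lookup_sum interval_seed_simps(1)
      by (rule sum.cong) (use k in \<open>auto simp: lookup_int_monomial lookup_interval_monom\<close>)
    then show ?thesis using c by simp
  qed
  have "(\<Sum>(i', j') \<in> ?V. c (i', j') * (if i' = i \<and> j' \<ge> j then 1 else 0))
      - (\<Sum>(i', j') \<in> ?V. c (i', j') * (if i' = i \<and> j' \<ge> j + 1 then 1 else 0)) = (\<Sum>v \<in> ?V. if v = u then c u else 0)"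
    unfolding sum_subtractf[symmetric] by (rule sum.cong) (auto simp: ij split: if_splits)
  also have "\<dots> = c u" using u finite_interval_verts by (simp add: interval_seed_simps)
  finally show "c u = 0" using T[of j] T[of "j + 1"] j by simp
qed

lemma interval_seed_class_good:
  assumes "S \<in> mutation_class (interval_seed e N)"
  shows "good_seed S"
  by (rule mutation_class_good[OF assms _ skew_interval_seed full_rank_interval_seed seed_leads_interval_seed])
    (simp add: interval_seed_simps finite_interval_verts)

lemma interval_seed_class_laurent:
  assumes "S \<in> mutation_class (interval_seed e N)" "set vs \<subseteq> mutable_verts S" "u \<in> verts S"
  shows "cvar (fold mutate vs S) u \<in> seed_ring S"
proof (rule laurent_phenomenon[where \<S> = "mutation_class (interval_seed e N)"])
  show "good_seed S'" if "S' \<in> mutation_class (interval_seed e N)" for S'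
    using interval_seed_class_good that .
  show "mutate v S' \<in> mutation_class (interval_seed e N)"
    if "S' \<in> mutation_class (interval_seed e N)" "v \<in> mutable_verts S'" for v S'
    using that by (rule mutation_class.mutation)
qed (rule assms)+

section \<open>Mutation sequences and comparison of the two quivers\<close>

lemma mutation_class_mutable:
  "S \<in> mutation_class S0 \<Longrightarrow> mutable_verts S = mutable_verts S0 \<and> verts S = verts S0"
  by (induction rule: mutation_class.induct) auto

lemma mutation_class_fold:
  assumes "S \<in> mutation_class S0"
  shows "\<exists>vs. set vs \<subseteq> mutable_verts S0 \<and> S = fold mutate vs S0"
  using assms
proof induction
  case initial
  show ?case by (intro exI[of _ "[]"]) simp
next
  case (mutation S v)
  then obtain vs where vs: "set vs \<subseteq> mutable_verts S0" "S = fold mutate vs S0" by blast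
  then show ?case
    using mutation mutation_class_mutable[OF mutation.hyps(1)] by (intro exI[of _ "vs @ [v]"]) auto
qed

text \<open>\<open>S\<close> is the full subquiver on its vertices, and no other vertex of
  \<open>T\<close> is joined to a mutable vertex of \<open>S\<close>. Which vertices are mutable in
  \<open>T\<close> is left open, so frozen vertices of \<open>S\<close> may be mutable
  there.\<close>

definition subseed :: "('v, 'k::field) seed \<Rightarrow> ('v, 'k) seed \<Rightarrow> bool" where
  "subseed S T \<longleftrightarrow> skew S \<and> skew T \<and> verts S \<subseteq> verts T \<and>
     (\<forall>a \<in> verts S. \<forall>b \<in> verts S. mult S a b = mult T a b) \<and>
     (\<forall>a \<in> mutable_verts S. \<forall>b \<in> verts T - verts S. mult T a b = 0) \<and>
     (\<forall>a \<in> verts S. cvar S a = cvar T a)"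

lemma subseed_mutate:
  assumes "subseed S T" and v: "v \<in> mutable_verts S"
  shows "subseed (mutate v S) (mutate v T)"
proof -
  have sk: "skew S" "skew T" and sub: "verts S \<subseteq> verts T"
    and m: "\<And>a b. a \<in> verts S \<Longrightarrow> b \<in> verts S \<Longrightarrow> mult S a b = mult T a b"
    and z: "\<And>a b. a \<in> mutable_verts S \<Longrightarrow> b \<in> verts T - verts S \<Longrightarrow> mult T a b = 0"
    and c: "\<And>a. a \<in> verts S \<Longrightarrow> cvar S a = cvar T a"
    using assms by (auto simp: subseed_def)
  have vS: "v \<in> verts S" using v by (auto simp: verts_def)
  have out: "out_nbrs T v = out_nbrs S v"
    using sub vS m z[OF v] by (fastforce simp: out_nbrs_def)
  have z': "mult T b v = 0" if "b \<in> verts T - verts S" for b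
    using z[OF v that] skewD[OF sk(2), of b v] by simp
  have in': "in_nbrs T v = in_nbrs S v"
    using sub vS m z' by (fastforce simp: in_nbrs_def)
  have sub': "out_nbrs S v \<subseteq> verts S" "in_nbrs S v \<subseteq> verts S" by (auto simp: out_nbrs_def in_nbrs_def)
  have "mult (mutate v S) a b = mult (mutate v T) a b" if "a \<in> verts S" "b \<in> verts S" for a b
    using that vS by (simp add: mutate_def in' out m)
  moreover have "mult (mutate v T) a b = 0" if a: "a \<in> mutable_verts S" and b: "b \<in> verts T - verts S" for a b
    using z[OF a b] z[OF v b] b sub' mult_mutate_diag[of v T] by (auto simp: mutate_def in' out)
  moreover have "cvar (mutate v S) a = cvar (mutate v T) a" if "a \<in> verts S" for a
  proof -
    have "(\<Prod>u \<in> in_nbrs S v. cvar S u ^ nat (mult S u v)) = (\<Prod>u \<in> in_nbrs S v. cvar T u ^ nat (mult T u v))"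
      "(\<Prod>u \<in> out_nbrs S v. cvar S u ^ nat (mult S v u)) = (\<Prod>u \<in> out_nbrs S v. cvar T u ^ nat (mult T v u))"
      by (rule prod.cong; use sub' vS m c in auto)+
    then show ?thesis using that vS c by (simp add: mutate_def in' out)
  qed
  ultimately show ?thesis using sk sub skew_mutate unfolding subseed_def by auto
qed

lemma subseed_fold:
  "subseed S T \<Longrightarrow> set vs \<subseteq> mutable_verts S \<Longrightarrow> subseed (fold mutate vs S) (fold mutate vs T)"
  by (induction vs arbitrary: S T) (auto simp: subseed_mutate)

lemma subseed_interval: "subseed (interval_seed 1 n) (interval_seed 0 (n + 1))"
  unfolding subseed_def
  by (auto simp: skew_interval_seed interval_seed_simps interval_verts_def)
    (auto simp: interval_seed_def interval_edge_def interval_verts_def split: if_splits)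

text \<open>For \<open>j = 1\<close> the vertices with second coordinate 0 are missing from the
  quiver; the empty minor takes their place in the products.\<close>

lemma exchange_monom_interval:
  assumes "i > e" "j \<ge> 1" "i + j \<le> N"
  shows "exchange_monom 1 (interval_seed e N) (i, j) (interval_verts e N) =
      to_fract (interval_minor (i - 1) j * interval_minor i (j + 1) * interval_minor (i + 1) (j - 1))"
    and "exchange_monom (-1) (interval_seed e N) (i, j) (interval_verts e N) =
      to_fract (interval_minor (i + 1) j * interval_minor i (j - 1) * interval_minor (i - 1) (j + 1))"
proof -
  let ?S = "interval_seed e N" and ?V = "interval_verts e N"
  have prod3: "(\<Prod>u \<in> ?V. if u \<in> {a, b, d} then cvar ?S u else 1) = cvar ?S a * cvar ?S b * (if d \<in> ?V then cvar ?S d else 1)"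
    if "a \<in> ?V" "b \<in> ?V" "a \<noteq> b" "a \<noteq> d" "b \<noteq> d" for a b d
  proof -
    have "(\<Prod>u \<in> ?V. if u \<in> {a, b, d} then cvar ?S u else 1) = (\<Prod>u \<in> ?V \<inter> {a, b, d}. cvar ?S u)"
      by (simp add: prod.inter_restrict[OF finite_interval_verts])
    also have "?V \<inter> {a, b, d} = (if d \<in> ?V then {a, b, d} else {a, b})" using that by auto
    finally show ?thesis using that by (simp add: mult.assoc)
  qed
  have d: "(if (i + 1, j - 1) \<in> ?V then cvar ?S (i + 1, j - 1) else 1) = to_fract (interval_minor (i + 1) (j - 1))"
    "(if (i, j - 1) \<in> ?V then cvar ?S (i, j - 1) else 1) = to_fract (interval_minor i (j - 1))"
    using assms by (cases "j = 1"; auto simp: interval_verts_def interval_seed_simps interval_minor_def)+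
  have e1: "interval_edge e N u (i, j) \<longleftrightarrow> u \<in> {(i - 1, j), (i, j + 1), (i + 1, j - 1)}" if "u \<in> ?V" for u
    using assms that by (cases u) (auto simp: interval_edge_def interval_verts_def)
  have e2: "interval_edge e N (i, j) u \<longleftrightarrow> u \<in> {(i + 1, j), (i - 1, j + 1), (i, j - 1)}" if "u \<in> ?V" for u
    using assms that by (cases u) (auto simp: interval_edge_def interval_verts_def)
  have mult: "mult ?S u (i, j) = (if interval_edge e N u (i, j) then 1 else if interval_edge e N (i, j) u then - 1 else 0)" for u
    by (simp add: interval_seed_def)
  have "exchange_monom 1 ?S (i, j) ?V = (\<Prod>u \<in> ?V. if u \<in> {(i - 1, j), (i, j + 1), (i + 1, j - 1)} then cvar ?S u else 1)"
    unfolding exchange_monom_def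
  proof (rule prod.cong[OF refl])
    fix u assume u: "u \<in> ?V"
    show "cvar ?S u ^ nat (1 * mult ?S u (i, j)) = (if u \<in> {(i - 1, j), (i, j + 1), (i + 1, j - 1)} then cvar ?S u else 1)"
      unfolding e1[OF u, symmetric] mult by simp
  qed
  also have "\<dots> = cvar ?S (i - 1, j) * cvar ?S (i, j + 1) * (if (i + 1, j - 1) \<in> ?V then cvar ?S (i + 1, j - 1) else 1)"
    by (rule prod3) (use assms in \<open>auto simp: interval_verts_def\<close>)
  finally show "exchange_monom 1 ?S (i, j) ?V =
      to_fract (interval_minor (i - 1) j * interval_minor i (j + 1) * interval_minor (i + 1) (j - 1))"
    unfolding d by (simp add: interval_seed_simps)
  have "exchange_monom (-1) ?S (i, j) ?V = (\<Prod>u \<in> ?V. if u \<in> {(i + 1, j), (i - 1, j + 1), (i, j - 1)} then cvar ?S u else 1)"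
    unfolding exchange_monom_def
  proof (rule prod.cong[OF refl])
    fix u assume u: "u \<in> ?V"
    show "cvar ?S u ^ nat (- 1 * mult ?S u (i, j)) = (if u \<in> {(i + 1, j), (i - 1, j + 1), (i, j - 1)} then cvar ?S u else 1)"
      unfolding e2[OF u, symmetric] mult using interval_edge_asym[of e N u "(i, j)"] by simp
  qed
  also have "\<dots> = cvar ?S (i + 1, j) * cvar ?S (i - 1, j + 1) * (if (i, j - 1) \<in> ?V then cvar ?S (i, j - 1) else 1)"
    by (rule prod3) (use assms in \<open>auto simp: interval_verts_def\<close>)
  finally show "exchange_monom (-1) ?S (i, j) ?V =
      to_fract (interval_minor (i + 1) j * interval_minor i (j - 1) * interval_minor (i - 1) (j + 1))"
    unfolding d by (simp add: interval_seed_simps mult_ac)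
qed

lemma interval_seed_mutated_var:
  assumes "i > e" "j \<ge> 1" "i + j \<le> N"
  obtains X where "cvar (mutate (i, j) (interval_seed e N)) (i, j) = to_fract X"
    "coprime_in (range to_fract) (to_fract (interval_minor i j)) (to_fract X)"
proof -
  have ij: "i \<ge> 1" using assms by simp
  obtain X m where X: "interval_minor i j * X =
      interval_minor (i - 1) j * interval_minor i (j + 1) * interval_minor (i + 1) (j - 1) +
      interval_minor (i + 1) j * interval_minor i (j - 1) * interval_minor (i - 1) (j + 1)"
    and m: "plead X 1 m" "keys m \<inter> keys (interval_monom i j) = {}"
    using interval_exchange[OF ij assms(2)] .
  have nz: "interval_minor i j \<noteq> 0" using plead_nonzero[OF plead_interval] .
  have "cvar (mutate (i, j) (interval_seed e N)) (i, j) = to_fract (interval_minor i j * X) / to_fract (interval_minor i j)"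
    unfolding X using exchange_monoms[OF _ skew_interval_seed, of e N "(i, j)"] finite_interval_verts
    by (simp add: interval_seed_simps exchange_monom_interval[OF assms])
  then have "cvar (mutate (i, j) (interval_seed e N)) (i, j) = to_fract X" using nz by simp
  moreover have "coprime_in (range to_fract) (to_fract (interval_minor i j)) (to_fract X)"
    using plead_interval[of i j] m coprime_in_of_leads[OF bij_id, of "interval_minor i j" "interval_monom i j" X m]
    by (auto simp: plead_iff Int_commute)
  ultimately show ?thesis using that by blast
qed

theorem cluster_var_polynomial:
  assumes "P \<in> cluster_vars (initial_seed n)"
  shows "P \<in> range to_fract"
proof -
  let ?S = "interval_seed 1 n" and ?T = "interval_seed 0 (n + 1)" and ?R = "range (to_fract :: mpoly \<Rightarrow> ratfun)"
  note R = is_subring_range_to_fract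
  obtain S u where S: "S \<in> mutation_class ?S" "u \<in> verts S" "P = cvar S u"
    using assms by (auto simp: cluster_vars_def initial_seed_interval)
  then obtain vs where vs: "set vs \<subseteq> mutable_verts ?S" "S = fold mutate vs ?S"
    using mutation_class_fold by blast
  have uS: "u \<in> interval_verts 1 n" using S(2) mutation_class_mutable[OF S(1)] by (simp add: interval_seed_simps)
  have sub: "interval_verts 1 n \<subseteq> mutable_verts ?T" "mutable_verts ?S \<subseteq> mutable_verts ?T"
    by (auto simp: interval_seed_simps interval_verts_def)
  have PT: "P = cvar (fold mutate vs ?T) u"
    using subseed_fold[OF subseed_interval vs(1)] S(2) unfolding S(3) vs(2) subseed_def by blast
  let ?x = "cvar ?S"
  have xR: "?x v \<in> ?R" for v by (cases v) (simp add: interval_seed_simps)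
  have x0: "?x v \<noteq> 0" for v
    using plead_nonzero[OF plead_interval] by (cases v) (simp add: interval_seed_simps)
  have xT: "cvar ?T v = ?x v" for v by (cases v) (simp add: interval_seed_simps)
  have cop: "coprime_in ?R (?x v) (?x w)" if "v \<noteq> w" for v w
    using that coprime_interval_minors by (cases v; cases w) (auto simp: interval_seed_simps)
  have PS: "P \<in> laurent ?x (interval_verts 1 n)"
    unfolding interval_seed_simps(1)[symmetric]
    unfolding S(3) vs(2)
    by (rule interval_seed_class_laurent[OF mutation_class.initial vs(1)]) (use uS in \<open>simp add: interval_seed_simps\<close>)
  have invR: "inverse (?x v) * (\<Prod>w \<in> interval_verts 1 n. ?x w) \<in> ?R" if "v \<in> interval_verts 1 n" for v
  proof -
    have "(\<Prod>w \<in> interval_verts 1 n. ?x w) = ?x v * (\<Prod>w \<in> interval_verts 1 n - {v}. ?x w)"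
      by (rule prod.remove[OF finite_interval_verts that])
    then have "inverse (?x v) * (\<Prod>w \<in> interval_verts 1 n. ?x w) = (\<Prod>w \<in> interval_verts 1 n - {v}. ?x w)"
      using x0[of v] by simp
    moreover have "(\<Prod>w \<in> interval_verts 1 n - {v}. ?x w) \<in> ?R" by (rule subring_prod[OF R xR])
    ultimately show ?thesis by simp
  qed
  \<comment> \<open>The Laurent expansion in the initial seed allows a power of the product of all
    interval minors as denominator. The remaining argument removes these minors one at a
    time.\<close>
  have "\<exists>N. P * (\<Prod>w \<in> interval_verts 1 n. ?x w) ^ N \<in> ?R"
    by (rule laurent_denominator[OF R xR subring_prod[OF R xR] invR PS])
  then obtain N where N: "P * (\<Prod>w \<in> interval_verts 1 n. ?x w) ^ N \<in> ?R" ..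
  \<comment> \<open>In the larger quiver \<open>v\<close> is mutable. The seed after mutation at
    \<open>v\<close> has \<open>X\<close> in place of \<open>?x v\<close>, so a denominator
    \<open>Q\<close> can be built from \<open>X\<close> and the other interval minors, all coprime
    to \<open>?x v\<close>.\<close>
  have denom: "\<exists>Q M. coprime_in ?R (?x v) Q \<and> Q \<in> ?R \<and> Q ^ M * P \<in> ?R" if v: "v \<in> interval_verts 1 n" for v
  proof -
    obtain i j where ij: "v = (i, j)" by force
    have bounds: "i > 0" "j \<ge> 1" "i + j \<le> n + 1" using v by (auto simp: ij interval_verts_def)
    let ?T' = "mutate v ?T" and ?W = "interval_verts 0 (n + 1)"
    obtain X where X: "cvar ?T' v = to_fract X" "coprime_in ?R (?x v) (to_fract X)"
      using interval_seed_mutated_var[OF bounds] by (auto simp: ij interval_seed_simps)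
    have vT: "v \<in> mutable_verts ?T" using v sub by blast
    have T': "?T' \<in> mutation_class ?T" using mutation_class.mutation[OF mutation_class.initial vT] .
    have "v \<in> verts ?T'" using vT by (auto simp: verts_def)
    then have X0: "to_fract X \<noteq> 0" using good_seedD(5)[OF interval_seed_class_good[OF T']] X(1) by metis
    have "mutate v ?T' = ?T"
      by (rule mutate_involution[OF skew_interval_seed]) (use X X0 x0 xT in \<open>auto simp: interval_seed_simps finite_interval_verts\<close>)
    \<comment> \<open>Mutating back at \<open>v\<close> first, the same sequence \<open>vs\<close>
      leads to \<open>P\<close>.\<close>
    then have P': "P = cvar (fold mutate (v # vs) ?T') u" using PT by simp
    have "P \<in> seed_ring ?T'"
      unfolding P'
    proof (rule interval_seed_class_laurent[OF T'])
      show "set (v # vs) \<subseteq> mutable_verts ?T'" using vs(1) sub(2) vT by auto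
      show "u \<in> verts ?T'" using uS sub(1) mutable_subset_verts[of ?T] by auto
    qed
    define Q where "Q = to_fract X * (\<Prod>w \<in> ?W - {v}. ?x w)"
    have pR: "(\<Prod>w \<in> ?W - {v}. ?x w) \<in> ?R" using xR by (intro subring_prod[OF R])
    have Q: "Q \<in> ?R" unfolding Q_def by (intro subring_mult[OF R] pR) simp
    have "\<exists>M. P * Q ^ M \<in> ?R"
    proof (rule laurent_denominator[OF R _ Q _ \<open>P \<in> seed_ring ?T'\<close>])
      fix w assume "w \<in> verts ?T'"
      then have w: "w \<in> ?W" by (simp add: interval_seed_simps)
      show "cvar ?T' w \<in> ?R" using X(1) xR xT by (cases "w = v") (auto simp: cvar_mutate_other)
      show "inverse (cvar ?T' w) * Q \<in> ?R"
      proof (cases "w = v")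
        case True
        show ?thesis unfolding True X(1) Q_def using X0 pR by (simp add: mult.assoc[symmetric])
      next
        case False
        have c: "cvar ?T' w = ?x w" using cvar_mutate_other[OF False, of ?T] xT[of w] by argo
        have p: "(\<Prod>w \<in> ?W - {v}. ?x w) = ?x w * (\<Prod>w \<in> ?W - {v} - {w}. ?x w)"
          using w False finite_interval_verts by (intro prod.remove) auto
        have "inverse (cvar ?T' w) * Q = to_fract X * (\<Prod>w \<in> ?W - {v} - {w}. ?x w)"
          unfolding c Q_def p using x0[of w] by simp
        moreover have "\<dots> \<in> ?R" using xR by (intro subring_mult[OF R] subring_prod[OF R]) auto
        ultimately show ?thesis by simp
      qed
    qed
    moreover have "coprime_in ?R (?x v) Q"
      unfolding Q_def by (rule coprime_in_mult[OF R X(2) coprime_in_prod[OF R cop xR]]) auto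
    ultimately show ?thesis using Q by (auto simp: mult.commute)
  qed
  have "P \<in> ?R" if "U \<subseteq> interval_verts 1 n" "P * (\<Prod>w \<in> U. ?x w) ^ N \<in> ?R" "finite U" for U
    using that(3,1,2)
  proof (induction U rule: finite_induct)
    case (insert v U)
    define y where "y = P * (\<Prod>w \<in> U. ?x w) ^ N"
    obtain Q M where Q: "coprime_in ?R (?x v) Q" "Q \<in> ?R" "Q ^ M * P \<in> ?R" using denom insert.prems by blast
    have "?x v ^ N * y \<in> ?R"
      using insert by (simp add: y_def power_mult_distrib mult_ac)
    moreover have "Q ^ M * P * (\<Prod>w \<in> U. ?x w) ^ N \<in> ?R"
      by (rule subring_mult[OF R Q(3) subring_power[OF R subring_prod[OF R xR]]])
    then have "Q ^ M * y \<in> ?R" by (simp add: y_def mult.assoc)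
    ultimately have "y \<in> ?R"
      using coprime_inD[OF coprime_in_powers[OF R Q(1) xR Q(2)]] by blast
    then show ?case using insert by (simp add: y_def)
  qed simp
  then show ?thesis using N finite_interval_verts by blast
qed


section \<open>Substitutions\<close>

definition monom_at :: "(nat \<times> nat \<Rightarrow> mpoly) \<Rightarrow> monomial \<Rightarrow> mpoly" where
  "monom_at \<sigma> m = (\<Prod>v \<in> keys m. \<sigma> v ^ lookup m v)"

abbreviation subst :: "(nat \<times> nat \<Rightarrow> mpoly) \<Rightarrow> mpoly \<Rightarrow> mpoly" where
  "subst \<sigma> \<equiv> pm_eval Const (monom_at \<sigma>)"

lemma monom_at_superset:
  "finite A \<Longrightarrow> keys m \<subseteq> A \<Longrightarrow> monom_at \<sigma> m = (\<Prod>v \<in> A. \<sigma> v ^ lookup m v)"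
  unfolding monom_at_def by (rule prod.mono_neutral_left) (auto simp: in_keys_iff)

lemma pm_hom_subst: "pm_hom Const (monom_at \<sigma>)"
proof
  fix m m' :: monomial
  let ?A = "keys m \<union> keys m'"
  have "monom_at \<sigma> (m + m') = (\<Prod>v \<in> ?A. \<sigma> v ^ lookup (m + m') v)"
    by (rule monom_at_superset) (auto simp: Poly_Mapping.keys_add)
  also have "\<dots> = (\<Prod>v \<in> ?A. \<sigma> v ^ lookup m v) * (\<Prod>v \<in> ?A. \<sigma> v ^ lookup m' v)"
    by (simp add: lookup_add power_add prod.distrib)
  also have "\<dots> = monom_at \<sigma> m * monom_at \<sigma> m'"
    by (subst (1 2) monom_at_superset[of ?A]) auto
  finally show "monom_at \<sigma> (m + m') = monom_at \<sigma> m * monom_at \<sigma> m'" .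
qed (auto simp: Const_def single_add mult_single monom_at_def)

interpretation subst: pm_hom Const "monom_at \<sigma>" for \<sigma> by (rule pm_hom_subst)

lemma subst_Const: "subst \<sigma> (Const c) = Const c"
  using subst.ev_single[of \<sigma> 0 c] by (simp add: Const_def[symmetric] monom_at_def)

lemma subst_Var: "subst \<sigma> (Var v) = \<sigma> v"
  unfolding Var_def by (simp add: subst.ev_single subst.h_1 monom_at_def)

lemma subst_cong:
  assumes "\<And>m v. m \<in> keys f \<Longrightarrow> v \<in> keys m \<Longrightarrow> \<sigma> v = \<tau> v"
  shows "subst \<sigma> f = subst \<tau> f"
  unfolding pm_eval_def monom_at_def
  by (intro sum.cong prod.cong arg_cong2[of _ _ _ _ "(*)"]) (use assms in auto)

lemma subst_subst: "subst \<tau> (subst \<sigma> f) = subst (\<lambda>v. subst \<tau> (\<sigma> v)) f"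
proof -
  have "subst \<tau> (subst \<sigma> f) = (\<Sum>m \<in> keys f. subst \<tau> (Const (lookup f m)) * subst \<tau> (monom_at \<sigma> m))"
    unfolding pm_eval_def[of Const "monom_at \<sigma>"] by (simp add: subst.ev_sum subst.ev_mult)
  also have "\<dots> = subst (\<lambda>v. subst \<tau> (\<sigma> v)) f"
    unfolding pm_eval_def[of Const "monom_at (\<lambda>v. subst \<tau> (\<sigma> v))"]
    by (simp add: subst_Const monom_at_def subst.ev_prod subst.ev_power)
  finally show ?thesis .
qed

lemma poly_at_subst: "poly_at f A = subst (\<lambda>(i, j). A $$ (i - 1, j - 1)) f"
  unfolding poly_at_def pm_eval_def monom_at_def
  by (intro sum.cong prod.cong arg_cong2[of _ _ _ _ "(*)"]) auto

lemma Const_monom: "Const c * single m a = single m (c * a)"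
  by (simp add: Const_def mult_single)

lemma single_power: "single (single v 1) (a :: complex) ^ k = single (single v k) (a ^ k)"
  for v :: "nat \<times> nat"
  by (induction k) (auto simp: mult_single single_add[symmetric])

lemma monom_at_scaled:
  "monom_at (\<lambda>v. Const (s v) * Var (p v)) m =
    single (\<Sum>v \<in> keys m. single (p v) (lookup m v))
      (\<Prod>v \<in> keys m. s v ^ lookup m v)"
proof -
  have "(\<Prod>v \<in> A. (Const (s v) * Var (p v)) ^ e v) = single (\<Sum>v \<in> A. single (p v) (e v)) (\<Prod>v \<in> A. s v ^ e v)"
    if "finite A" for A and e :: "nat \<times> nat \<Rightarrow> nat"
    using that
    by (induction rule: finite_induct) (auto simp: Var_def Const_monom single_power mult_single simp del: One_nat_def)
  then show ?thesis by (simp add: monom_at_def)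
qed

text \<open>When foreign variables are sent to 0, each monomial is either kept or killed. Membership
  in \<open>poly_ring n\<close> thus becomes a fixed-point condition of the same kind as
  invariance.\<close>

lemma subst_restrict_fixed:
  assumes "subst (\<lambda>v. if v \<in> {1..n} \<times> {1..n} then Var v else 0) f = f"
  shows "f \<in> poly_ring n"
proof -
  define D where "D = {1..n} \<times> {1..n}"
  let ?\<sigma> = "\<lambda>v. if v \<in> D then Var v else 0"
  have mono: "monom_at ?\<sigma> m = (if keys m \<subseteq> D then single m 1 else 0)" for m
  proof (cases "keys m \<subseteq> D")
    case True
    have "monom_at ?\<sigma> m = monom_at (\<lambda>v. Const 1 * Var v) m"
      unfolding monom_at_def by (rule prod.cong) (use True in \<open>auto simp: subst.h_1\<close>)
    also have "\<dots> = single m 1"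
      unfolding monom_at_scaled using poly_mapping_sum_singles[of m] by simp
    finally show ?thesis using True by simp
  next
    case False
    then obtain v where "v \<in> keys m" "v \<notin> D" by blast
    then show ?thesis using False by (auto simp: monom_at_def in_keys_iff intro!: prod_zero)
  qed
  have "lookup f m = 0" if m: "\<not> keys m \<subseteq> D" for m
  proof -
    have "lookup f m = lookup (subst ?\<sigma> f) m" using assms by (simp only: D_def)
    also have "\<dots> = (\<Sum>k \<in> keys f. lookup (Const (lookup f k) * monom_at ?\<sigma> k) m)"
      by (simp add: pm_eval_def lookup_sum)
    also have "\<dots> = 0"
    proof (rule sum.neutral, rule ballI)
      fix k
      show "lookup (Const (lookup f k) * monom_at ?\<sigma> k) m = 0"
        using m by (cases "k = m") (auto simp: mono Const_monom lookup_single)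
    qed
    finally show ?thesis .
  qed
  then show ?thesis unfolding poly_ring_def D_def in_keys_iff by blast
qed


section \<open>Invariance\<close>

lemma comm_ring_hom_subst: "comm_ring_hom (subst \<sigma>)"
  by unfold_locales (auto simp: subst.ev_add subst.ev_mult subst.ev_0 subst.ev_1)

lemma subst_row_minor:
  "subst \<sigma> (row_minor rs) = det (mat (length rs) (length rs) (\<lambda>(a, b). \<sigma> (rs ! a, b + 1)))"
proof -
  have "subst \<sigma> (row_minor rs) = det (map_mat (subst \<sigma>) (mat (length rs) (length rs) (\<lambda>(a, b). Var (rs ! a, b + 1))))"
    unfolding row_minor_def by (rule comm_ring_hom.hom_det[OF comm_ring_hom_subst, symmetric])
  also have "map_mat (subst \<sigma>) (mat (length rs) (length rs) (\<lambda>(a, b). Var (rs ! a, b + 1)))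
      = mat (length rs) (length rs) (\<lambda>(a, b). \<sigma> (rs ! a, b + 1))"
    by (rule eq_matI) (auto simp: subst_Var)
  finally show ?thesis .
qed

lemma generic_times_index:
  assumes "u \<in> carrier_mat n n" "i \<in> {1..n}" "j \<in> {1..n}"
  shows "(generic_mat n * map_mat Const u) $$ (i - 1, j - 1) = (\<Sum>c < n. Var (i, c + 1) * Const (u $$ (c, j - 1)))"
  using assms by (auto simp: generic_mat_def scalar_prod_def atLeast0LessThan intro!: sum.cong)

text \<open>As \<open>u\<close> is upper triangular, the first columns of the product are the same
  first columns of the generic matrix times the leading block of \<open>u\<close>, whose determinant
  is 1.\<close>

lemma row_minor_invariant:
  assumes u: "u \<in> unipotent_group n" and rs: "set rs \<subseteq> {1..n}" "length rs \<le> n"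
  shows "subst (\<lambda>(i, j). (generic_mat n * map_mat Const u) $$ (i - 1, j - 1)) (row_minor rs) = row_minor rs"
proof -
  let ?k = "length rs"
  have uc: "u \<in> carrier_mat n n" and ut: "upper_triangular u" and ud: "\<And>i. i < n \<Longrightarrow> u $$ (i, i) = 1"
    using u by (auto simp: unipotent_group_def)
  define M where "M = mat ?k ?k (\<lambda>(a, b). Var (rs ! a, b + 1))"
  define U where "U = mat ?k ?k (\<lambda>(a, b). Const (u $$ (a, b)))"
  have M: "M \<in> carrier_mat ?k ?k" and U: "U \<in> carrier_mat ?k ?k" by (auto simp: M_def U_def)
  have "mat ?k ?k (\<lambda>(a, b). case (rs ! a, b + 1) of (i, j) \<Rightarrow> (generic_mat n * map_mat Const u) $$ (i - 1, j - 1)) = M * U"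
  proof (rule eq_matI)
    fix a b assume "a < dim_row (M * U)" "b < dim_col (M * U)"
    then have ab: "a < ?k" "b < ?k" using M U by auto
    have i: "rs ! a \<in> {1..n}" using rs(1) nth_mem[OF ab(1)] by blast
    have j: "b + 1 \<in> {1..n}" using ab rs(2) by simp
    have "(\<Sum>c < n. Var (rs ! a, c + 1) * Const (u $$ (c, b))) = (\<Sum>c < ?k. Var (rs ! a, c + 1) * Const (u $$ (c, b)))"
    proof (rule sum.mono_neutral_right)
      show "\<forall>c \<in> {..<n} - {..<?k}. Var (rs ! a, c + 1) * Const (u $$ (c, b)) = 0"
        using ut ab uc by (auto simp: upper_triangular_def subst.h_0)
    qed (use rs in auto)
    also have "\<dots> = (M * U) $$ (a, b)"
      using ab by (simp add: M_def U_def scalar_prod_def atLeast0LessThan)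
    finally show "mat ?k ?k (\<lambda>(a, b). case (rs ! a, b + 1) of (i, j) \<Rightarrow> (generic_mat n * map_mat Const u) $$ (i - 1, j - 1)) $$ (a, b)
        = (M * U) $$ (a, b)"
      using ab generic_times_index[OF uc i j] by simp
  qed (use M U in auto)
  moreover have "det U = 1"
  proof -
    have "upper_triangular U"
      using ut uc rs by (auto simp: U_def upper_triangular_def subst.h_0)
    then have "det U = prod_list (diag_mat U)" by (rule det_upper_triangular[OF _ U])
    also have "diag_mat U = map (\<lambda>_. 1) [0..<?k]"
      using ud rs by (auto simp: diag_mat_def U_def subst.h_1)
    also have "prod_list \<dots> = 1" by (simp add: map_replicate_const)
    finally show ?thesis .
  qed
  ultimately show ?thesis
    unfolding subst_row_minor using det_mult[OF M U] by (simp add: row_minor_def M_def)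
qed

lemma row_minor_restrict:
  assumes "set rs \<subseteq> {1..n}" "length rs \<le> n"
  shows "subst (\<lambda>v. if v \<in> {1..n} \<times> {1..n} then Var v else 0) (row_minor rs) = row_minor rs"
proof -
  have "mat (length rs) (length rs) (\<lambda>(a, b). if (rs ! a, b + 1) \<in> {1..n} \<times> {1..n} then Var (rs ! a, b + 1) else 0)
      = mat (length rs) (length rs) (\<lambda>(a, b). Var (rs ! a, b + 1))"
  proof (rule eq_matI)
    fix a b assume "a < dim_row (mat (length rs) (length rs) (\<lambda>(a, b). Var (rs ! a, b + 1)))"
      "b < dim_col (mat (length rs) (length rs) (\<lambda>(a, b). Var (rs ! a, b + 1)))"
    then have ab: "a < length rs" "b < length rs" by auto
    have "rs ! a \<in> {1..n}" using assms(1) nth_mem[OF ab(1)] by blast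
    then have "(rs ! a, b + 1) \<in> {1..n} \<times> {1..n}" using assms(2) ab by simp
    then show "mat (length rs) (length rs) (\<lambda>(a, b). if (rs ! a, b + 1) \<in> {1..n} \<times> {1..n} then Var (rs ! a, b + 1) else 0) $$ (a, b)
      = mat (length rs) (length rs) (\<lambda>(a, b). Var (rs ! a, b + 1)) $$ (a, b)"
      using ab by simp
  qed auto
  then show ?thesis unfolding subst_row_minor by (simp add: row_minor_def)
qed

definition quotient_of_fixed :: "(mpoly \<Rightarrow> mpoly) \<Rightarrow> ratfun \<Rightarrow> bool" where
  "quotient_of_fixed \<phi> x \<longleftrightarrow> (\<exists>a b. \<phi> a = a \<and> \<phi> b = b \<and> b \<noteq> 0 \<and> x = to_fract a / to_fract b)"

context
  fixes \<sigma> :: "nat \<times> nat \<Rightarrow> mpoly"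
begin

lemma quotient_of_fixed_1: "quotient_of_fixed (subst \<sigma>) 1"
  unfolding quotient_of_fixed_def by (intro exI[of _ 1]) (simp add: subst.ev_1)

lemma quotient_of_fixed_add:
  assumes "quotient_of_fixed (subst \<sigma>) x" "quotient_of_fixed (subst \<sigma>) y"
  shows "quotient_of_fixed (subst \<sigma>) (x + y)"
proof -
  obtain a b c d where *: "subst \<sigma> a = a" "subst \<sigma> b = b" "b \<noteq> 0" "x = to_fract a / to_fract b"
    "subst \<sigma> c = c" "subst \<sigma> d = d" "d \<noteq> 0" "y = to_fract c / to_fract d"
    using assms unfolding quotient_of_fixed_def by blast
  then have "x + y = to_fract (a * d + c * b) / to_fract (b * d)" by (simp add: field_simps)
  moreover have "subst \<sigma> (a * d + c * b) = a * d + c * b" "subst \<sigma> (b * d) = b * d" "b * d \<noteq> 0"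
    using * by (auto simp: subst.ev_add subst.ev_mult)
  ultimately show ?thesis unfolding quotient_of_fixed_def by blast
qed

lemma quotient_of_fixed_mult:
  assumes "quotient_of_fixed (subst \<sigma>) x" "quotient_of_fixed (subst \<sigma>) y"
  shows "quotient_of_fixed (subst \<sigma>) (x * y)"
proof -
  obtain a b c d where *: "subst \<sigma> a = a" "subst \<sigma> b = b" "b \<noteq> 0" "x = to_fract a / to_fract b"
    "subst \<sigma> c = c" "subst \<sigma> d = d" "d \<noteq> 0" "y = to_fract c / to_fract d"
    using assms unfolding quotient_of_fixed_def by blast
  then have "x * y = to_fract (a * c) / to_fract (b * d)" by simp
  moreover have "subst \<sigma> (a * c) = a * c" "subst \<sigma> (b * d) = b * d" "b * d \<noteq> 0"
    using * by (auto simp: subst.ev_mult)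
  ultimately show ?thesis unfolding quotient_of_fixed_def by blast
qed

lemma quotient_of_fixed_inverse:
  assumes "quotient_of_fixed (subst \<sigma>) x"
  shows "quotient_of_fixed (subst \<sigma>) (inverse x)"
proof -
  obtain a b where *: "subst \<sigma> a = a" "subst \<sigma> b = b" "b \<noteq> 0" "x = to_fract a / to_fract b"
    using assms unfolding quotient_of_fixed_def by blast
  show ?thesis
  proof (cases "a = 0")
    case True
    then show ?thesis using * assms by simp
  next
    case False
    have "inverse x = to_fract b / to_fract a" using * by simp
    then show ?thesis using * False unfolding quotient_of_fixed_def by blast
  qed
qed

lemma quotient_of_fixed_prod_power:
  "(\<And>u. u \<in> A \<Longrightarrow> quotient_of_fixed (subst \<sigma>) (x u)) \<Longrightarrow> quotient_of_fixed (subst \<sigma>) (\<Prod>u \<in> A. x u ^ e u)"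
proof (induction A rule: infinite_finite_induct)
  case (insert a A)
  have "quotient_of_fixed (subst \<sigma>) (x a ^ k)" for k
    by (induction k) (auto simp: insert quotient_of_fixed_1 quotient_of_fixed_mult)
  then show ?case using insert by (auto intro: quotient_of_fixed_mult)
qed (auto simp: quotient_of_fixed_1)

lemma quotient_of_fixed_polynomial:
  assumes "quotient_of_fixed (subst \<sigma>) (to_fract f)" shows "subst \<sigma> f = f"
proof -
  obtain a b where *: "subst \<sigma> a = a" "subst \<sigma> b = b" "b \<noteq> 0" "to_fract f = to_fract a / to_fract b"
    using assms unfolding quotient_of_fixed_def by blast
  have "to_fract (f * b) = to_fract a" using * by simp
  then have fb: "f * b = a" by (rule to_fract_eq_iff[THEN iffD1])
  then have "subst \<sigma> f * b = f * b" using * by (metis subst.ev_mult)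
  then show ?thesis using \<open>b \<noteq> 0\<close> by simp
qed

lemma quotient_of_fixed_class:
  assumes S: "S \<in> mutation_class S0" and S0: "\<And>u. u \<in> verts S0 \<Longrightarrow> quotient_of_fixed (subst \<sigma>) (cvar S0 u)"
    and u: "u \<in> verts S"
  shows "quotient_of_fixed (subst \<sigma>) (cvar S u)"
  using S u
proof (induction arbitrary: u)
  case initial
  then show ?case using S0 by blast
next
  case (mutation S v)
  show ?case
  proof (cases "u = v")
    case True
    have "quotient_of_fixed (subst \<sigma>) (\<Prod>u \<in> in_nbrs S v. cvar S u ^ nat (mult S u v))"
      "quotient_of_fixed (subst \<sigma>) (\<Prod>u \<in> out_nbrs S v. cvar S u ^ nat (mult S v u))"
      using mutation.IH by (intro quotient_of_fixed_prod_power; simp add: in_nbrs_def out_nbrs_def)+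
    moreover have "quotient_of_fixed (subst \<sigma>) (cvar S v)"
      using mutation.IH[of v] mutation.hyps(2) by (auto simp: verts_def)
    ultimately show ?thesis
      unfolding True by (simp add: mutate_def divide_inverse quotient_of_fixed_add quotient_of_fixed_mult quotient_of_fixed_inverse)
  next
    case False
    then show ?thesis using mutation.IH mutation.prems by (simp add: cvar_mutate_other)
  qed
qed

end

lemma quotient_of_fixed_to_fract:
  "subst \<sigma> f = f \<Longrightarrow> quotient_of_fixed (subst \<sigma>) (to_fract f)"
  unfolding quotient_of_fixed_def by (intro exI[of _ f] exI[of _ 1]) (simp add: subst.ev_1)

lemma cluster_var_fixed:
  assumes P: "to_fract f \<in> cluster_vars (initial_seed n)"
    and \<sigma>: "\<And>rs. set rs \<subseteq> {1..n} \<Longrightarrow> length rs \<le> n \<Longrightarrow> subst \<sigma> (row_minor rs) = row_minor rs"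
  shows "subst \<sigma> f = f"
proof -
  obtain S u where S: "S \<in> mutation_class (interval_seed 1 n)" "u \<in> verts S" "to_fract f = cvar S u"
    using P by (auto simp: cluster_vars_def initial_seed_interval)
  have "quotient_of_fixed (subst \<sigma>) (cvar S u)"
  proof (rule quotient_of_fixed_class[OF S(1) _ S(2)])
    fix v assume "v \<in> verts (interval_seed 1 n)"
    then obtain i j where "v = (i, j)" "i \<ge> 1" "j \<ge> 1" "i + j \<le> n + 1"
      by (auto simp: interval_seed_simps interval_verts_def)
    then show "quotient_of_fixed (subst \<sigma>) (cvar (interval_seed 1 n) v)"
      by (auto simp: interval_seed_simps interval_minor_def intro!: quotient_of_fixed_to_fract \<sigma>)
  qed
  then show ?thesis unfolding S(3)[symmetric] by (rule quotient_of_fixed_polynomial)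
qed

text \<open>Invariance under each \<open>u\<close> and absence of foreign variables both say that a
  certain substitution fixes \<open>f\<close>, and each of these substitutions fixes the
  minors.\<close>

lemma invariant_ringI:
  assumes "\<And>\<sigma>. (\<And>rs. set rs \<subseteq> {1..n} \<Longrightarrow> length rs \<le> n \<Longrightarrow> subst \<sigma> (row_minor rs) = row_minor rs) \<Longrightarrow> subst \<sigma> f = f"
  shows "f \<in> invariant_ring n"
proof -
  have "f \<in> poly_ring n"
    by (rule subst_restrict_fixed) (rule assms, rule row_minor_restrict)
  moreover have "poly_at f (generic_mat n * map_mat Const u) = f" if "u \<in> unipotent_group n" for u
    unfolding poly_at_subst by (rule assms) (rule row_minor_invariant[OF that])
  ultimately show ?thesis by (simp add: invariant_ring_def)
qed


section \<open>Translation-invariant polynomials\<close>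

text \<open>Dividing \<open>H(y, t) = (y + t)\<^bsup>v\<^esup> K(y, t)\<close> by the power of \<open>y + t\<close> lowers the degree in both
  variables, so that \<open>K(- t, t)\<close>, the lowest coefficient of \<open>H\<close> in powers of \<open>y + t\<close>, has small degree.\<close>

lemma lowest_coefficient_degree:
  fixes g :: "'a \<Rightarrow> complex poly"
  assumes B: "finite B" and e: "\<And>x. x \<in> B \<Longrightarrow> v \<le> e x \<and> e x \<le> d"
    and H: "\<And>y. \<exists>p. degree p \<le> s \<and> (\<forall>t. poly p t = (\<Sum>x \<in> B. (y + t) ^ e x * poly (g x) t))"
    and nz: "(\<Sum>x \<in> {x \<in> B. e x = v}. g x) \<noteq> 0"
  shows "v \<le> s" "degree (\<Sum>x \<in> {x \<in> B. e x = v}. g x) + 2 * v \<le> s + d"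
proof -
  \<comment> \<open>These are polynomials in \<open>t\<close> with coefficients in \<open>y\<close>:
    \<open>W\<close> is \<open>y + t\<close>, \<open>lift\<close> reads a polynomial in
    \<open>t\<close> as constant in \<open>y\<close>, \<open>K\<close> is the sum divided by
    \<open>W ^ v\<close>, and \<open>spec y\<close> inserts a number for \<open>y\<close>.\<close>
  define W :: "complex poly poly" where "W = [:[:0, 1:], 1:]"
  define lift :: "complex poly \<Rightarrow> complex poly poly" where "lift = map_poly (\<lambda>c. [:c:])"
  define K where "K = (\<Sum>x \<in> B. W ^ (e x - v) * lift (g x))"
  define G where "G = (\<Sum>x \<in> {x \<in> B. e x = v}. g x)"
  define spec :: "complex \<Rightarrow> complex poly poly \<Rightarrow> complex poly" where "spec = (\<lambda>y. map_poly (\<lambda>q. poly q y))"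
  have coeff_spec: "coeff (spec y F) N = poly (coeff F N) y" for y F N
    by (simp add: spec_def coeff_map_poly)
  have spec_add: "spec y (F + F') = spec y F + spec y F'" for y F F'
    by (rule poly_eqI) (simp add: coeff_spec)
  have spec_mult: "spec y (F * F') = spec y F * spec y F'" for y F F'
    by (rule poly_eqI) (simp add: coeff_spec coeff_mult poly_sum)
  have spec_sum: "spec y (\<Sum>x \<in> A. F x) = (\<Sum>x \<in> A. spec y (F x))" for y A and F :: "'a \<Rightarrow> _"
    by (rule poly_eqI) (simp add: coeff_spec coeff_sum poly_sum)
  have spec_W: "spec y W = [:y, 1:]" for y
    by (rule poly_eqI) (auto simp: coeff_spec W_def coeff_pCons split: nat.splits)
  have spec_1: "spec y 1 = 1" for y by (rule poly_eqI) (simp add: coeff_spec coeff_1)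
  have spec_power: "spec y (F ^ k) = spec y F ^ k" for y F k
    by (induction k) (simp_all add: spec_1 spec_mult)
  have spec_lift: "spec y (lift q) = q" for y q
    by (rule poly_eqI) (simp add: coeff_spec lift_def coeff_map_poly)
  have spec_K: "poly (spec y K) t = (\<Sum>x \<in> B. (y + t) ^ (e x - v) * poly (g x) t)" for y t
    by (simp add: K_def spec_sum spec_mult spec_power spec_W spec_lift poly_sum)
  \<comment> \<open>The bound on the degree in \<open>t\<close> is known for each number
    \<open>y\<close>. A higher coefficient vanishes at all of them, hence as a polynomial in
    \<open>y\<close>.\<close>
  have degH: "degree (W ^ v * K) \<le> s"
  proof (rule degree_le, intro allI impI)
    fix N assume N: "s < N"
    have "poly (coeff (W ^ v * K) N) y = 0" for y
    proof -
      obtain p where p: "degree p \<le> s" "\<forall>t. poly p t = (\<Sum>x \<in> B. (y + t) ^ e x * poly (g x) t)" using H by blast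
      have "poly (spec y (W ^ v * K)) t = poly p t" for t
      proof -
        have "poly (spec y (W ^ v * K)) t = (\<Sum>x \<in> B. (y + t) ^ v * ((y + t) ^ (e x - v) * poly (g x) t))"
          by (simp add: spec_mult spec_power spec_W spec_K sum_distrib_left)
        also have "\<dots> = (\<Sum>x \<in> B. (y + t) ^ e x * poly (g x) t)"
        proof (rule sum.cong[OF refl])
          fix x assume "x \<in> B"
          then have "(y + t) ^ e x = (y + t) ^ v * (y + t) ^ (e x - v)"
            using e by (simp add: power_add[symmetric])
          then show "(y + t) ^ v * ((y + t) ^ (e x - v) * poly (g x) t) = (y + t) ^ e x * poly (g x) t" by simp
        qed
        finally show ?thesis using p by simp
      qed
      then have "spec y (W ^ v * K) = p" using poly_eq_poly_eq_iff by blast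
      then show ?thesis using p(1) N by (metis coeff_spec coeff_eq_0 le_less_trans)
    qed
    then show "coeff (W ^ v * K) N = 0" using poly_all_0_iff_0 by blast
  qed
  have G: "poly G t = poly (spec (- t) K) t" for t
  proof -
    have "poly (spec (- t) K) t = (\<Sum>x \<in> B. if e x = v then poly (g x) t else 0)"
      unfolding spec_K
    proof (rule sum.cong[OF refl])
      fix x assume "x \<in> B"
      then have "v \<le> e x" using e by blast
      then show "(- t + t) ^ (e x - v) * poly (g x) t = (if e x = v then poly (g x) t else 0)"
        by (cases "e x = v") (auto simp: power_0_left)
    qed
    then show ?thesis using B by (auto simp: G_def poly_sum sum.inter_filter intro!: sum.cong)
  qed
  have "K \<noteq> 0"
  proof
    assume "K = 0"
    then have "poly G t = 0" for t unfolding G by (simp add: spec_def)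
    then have "G = 0" using poly_all_0_iff_0 by blast
    then show False using nz by (simp add: G_def)
  qed
  moreover have "W \<noteq> 0" "degree W = 1" by (auto simp: W_def)
  ultimately have "degree (W ^ v * K) = v + degree K"
    by (simp add: degree_mult_eq degree_power_eq)
  then have vK: "v + degree K \<le> s" using degH by simp
  then show "v \<le> s" by simp
  \<comment> \<open>A bound on the degree in \<open>y\<close>. As the degree of \<open>K\<close> in
    \<open>t\<close> is at most \<open>s - v\<close>, inserting \<open>y = - t\<close> gives degree
    at most \<open>(d - v) + (s - v)\<close>.\<close>
  define low where "low = (\<lambda>D (F :: complex poly poly). \<forall>N. degree (coeff F N) \<le> D)"
  have low_mult: "low (D + D') (F * F')" if "low D F" "low D' F'" for D D' F F'
    unfolding low_def coeff_mult
  proof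
    fix N
    show "degree (\<Sum>i\<le>N. coeff F i * coeff F' (N - i)) \<le> D + D'"
      by (rule degree_sum_le) (use that degree_mult_le in \<open>auto simp: low_def intro: order_trans[OF degree_mult_le] add_mono\<close>)
  qed
  have low_W: "low k (W ^ k)" for k
  proof (induction k)
    case (Suc k)
    have "low 1 W" by (auto simp: low_def W_def coeff_pCons split: nat.splits)
    then show ?case using low_mult[of 1 W, OF _ Suc] by simp
  qed (simp add: low_def coeff_1)
  have "low (d - v) K"
    unfolding low_def K_def coeff_sum
  proof
    fix N
    show "degree (\<Sum>x \<in> B. coeff (W ^ (e x - v) * lift (g x)) N) \<le> d - v"
    proof (rule degree_sum_le[OF B])
      fix x assume x: "x \<in> B"
      have "low 0 (lift (g x))" by (simp add: low_def lift_def coeff_map_poly)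
      then have "low (e x - v + 0) (W ^ (e x - v) * lift (g x))" by (rule low_mult[OF low_W])
      then show "degree (coeff (W ^ (e x - v) * lift (g x)) N) \<le> d - v"
        using e[OF x] by (auto simp: low_def intro: order_trans diff_le_mono)
    qed
  qed
  define G' where "G' = (\<Sum>N \<le> degree K. pcompose (coeff K N) [:0, -1:] * monom 1 N)"
  have "poly G' t = poly G t" for t
  proof -
    have "degree (spec (- t) K) \<le> degree K" unfolding spec_def by (rule map_poly_degree_leq)
    then have "poly (spec (- t) K) t = (\<Sum>N \<le> degree K. coeff (spec (- t) K) N * t ^ N)"
      unfolding poly_altdef by (intro sum.mono_neutral_left) (auto simp: coeff_eq_0)
    then show ?thesis by (simp add: G G'_def poly_sum poly_pcompose poly_monom coeff_spec)
  qed
  then have "poly G = poly G'" by auto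
  then have "G = G'" by (simp only: poly_eq_poly_eq_iff)
  have "degree G' \<le> (d - v) + degree K"
    unfolding G'_def
  proof (rule degree_sum_le)
    fix N assume N: "N \<in> {..degree K}"
    have "degree (pcompose (coeff K N) [:0, -1:] * monom 1 N) \<le> degree (pcompose (coeff K N) [:0, -1:]) + degree (monom 1 N :: complex poly)"
      by (rule degree_mult_le)
    also have "\<dots> \<le> (d - v) + degree K"
      using N \<open>low (d - v) K\<close> by (intro add_mono) (auto simp: degree_pcompose low_def degree_monom_eq)
    finally show "degree (pcompose (coeff K N) [:0, -1:] * monom 1 N) \<le> (d - v) + degree K" .
  qed simp
  moreover have "v \<le> d"
  proof -
    have "{x \<in> B. e x = v} \<noteq> {}"
    proof
      assume empty: "{x \<in> B. e x = v} = {}"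
      have "(\<Sum>x \<in> {x \<in> B. e x = v}. g x) = 0" unfolding empty by simp
      then show False using nz by blast
    qed
    then obtain x where "x \<in> B" "e x = v" by blast
    then show ?thesis using e[of x] by simp
  qed
  ultimately have "degree G + 2 * v \<le> s + d" using vK \<open>G = G'\<close> by simp
  then show "degree (\<Sum>x \<in> {x \<in> B. e x = v}. g x) + 2 * v \<le> s + d" by (simp add: G_def)
qed

text \<open>Terms are indexed by \<open>x\<close> and not by their exponents, so that the induction
  can drop the first variable while coefficients stay attached to their terms.\<close>

definition lex_min :: "nat \<Rightarrow> 'a set \<Rightarrow> ('a \<Rightarrow> nat \<Rightarrow> nat) \<Rightarrow> 'a \<Rightarrow> bool" where
  "lex_min n B \<beta> x0 \<longleftrightarrow> x0 \<in> B \<and>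
     (\<forall>x \<in> B. x \<noteq> x0 \<longrightarrow> (\<exists>k < n. \<beta> x0 k < \<beta> x k \<and> (\<forall>l < k. \<beta> x l = \<beta> x0 l)))"

lemma lex_min_Suc:
  assumes "lex_min (Suc n) B \<beta> x0"
  shows "\<And>x. x \<in> B \<Longrightarrow> \<beta> x0 0 \<le> \<beta> x 0"
    and "lex_min n {x \<in> B. \<beta> x 0 = \<beta> x0 0} (\<lambda>x k. \<beta> x (Suc k)) x0"
proof -
  show "\<beta> x0 0 \<le> \<beta> x 0" if x: "x \<in> B" for x
  proof (cases "x = x0")
    case False
    then obtain k where k: "\<beta> x0 k < \<beta> x k" "\<forall>l < k. \<beta> x l = \<beta> x0 l"
      using assms x unfolding lex_min_def by blast
    then show ?thesis by (cases k) auto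
  qed simp
  show "lex_min n {x \<in> B. \<beta> x 0 = \<beta> x0 0} (\<lambda>x k. \<beta> x (Suc k)) x0"
    unfolding lex_min_def
  proof (intro conjI ballI impI)
    show "x0 \<in> {x \<in> B. \<beta> x 0 = \<beta> x0 0}" using assms by (simp add: lex_min_def)
    fix x assume x: "x \<in> {x \<in> B. \<beta> x 0 = \<beta> x0 0}" "x \<noteq> x0"
    then obtain k where k: "k < Suc n" "\<beta> x0 k < \<beta> x k" "\<forall>l < k. \<beta> x l = \<beta> x0 l"
      using assms unfolding lex_min_def by blast
    then obtain k' where "k = Suc k'" using x(1) by (cases k) auto
    then show "\<exists>k < n. \<beta> x0 (Suc k) < \<beta> x (Suc k) \<and> (\<forall>l < k. \<beta> x (Suc l) = \<beta> x0 (Suc l))"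
      using k by (intro exI[of _ k']) auto
  qed
qed

lemma sum_insert_first:
  fixes c :: "'a \<Rightarrow> complex"
  shows "(\<Sum>x \<in> B. c x * (\<Prod>k < Suc n. case_nat y b k ^ \<beta> x k)) = (\<Sum>x \<in> B. y ^ \<beta> x 0 * (c x * (\<Prod>k < n. b k ^ \<beta> x (Suc k))))"
  by (rule sum.cong) (simp_all add: prod.lessThan_Suc_shift mult_ac del: prod.lessThan_Suc)

text \<open>By induction the terms with the least exponent in the first variable have a nonzero sum
  at some values of the other variables. This sum is a coefficient of a polynomial in the first
  variable, which therefore is nonzero somewhere.\<close>

lemma lex_min_nonzero:
  fixes c :: "'a \<Rightarrow> complex"
  assumes "finite B" "lex_min n B \<beta> x0" "c x0 \<noteq> 0"
  shows "\<exists>b. (\<Sum>x \<in> B. c x * (\<Prod>k < n. b k ^ \<beta> x k)) \<noteq> 0"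
  using assms
proof (induction n arbitrary: B \<beta>)
  case 0
  then have "B = {x0}" by (auto simp: lex_min_def)
  then show ?case using 0 by simp
next
  case (Suc n)
  let ?B = "{x \<in> B. \<beta> x 0 = \<beta> x0 0}"
  obtain b where b: "(\<Sum>x \<in> ?B. c x * (\<Prod>k < n. b k ^ \<beta> x (Suc k))) \<noteq> 0"
    using Suc.IH[of ?B "\<lambda>x k. \<beta> x (Suc k)"] lex_min_Suc(2)[OF Suc.prems(2)] Suc.prems by auto
  define q where "q = (\<Sum>x \<in> B. monom (c x * (\<Prod>k < n. b k ^ \<beta> x (Suc k))) (\<beta> x 0))"
  have "coeff q (\<beta> x0 0) = (\<Sum>x \<in> ?B. c x * (\<Prod>k < n. b k ^ \<beta> x (Suc k)))"
    using Suc.prems(1) by (simp add: q_def coeff_sum sum.inter_filter)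
  then have "q \<noteq> 0" using b by auto
  then obtain y where "poly q y \<noteq> 0" using poly_all_0_iff_0 by blast
  moreover have "poly q y = (\<Sum>x \<in> B. c x * (\<Prod>k < Suc n. case_nat y b k ^ \<beta> x k))"
    unfolding sum_insert_first q_def by (simp add: poly_sum poly_monom mult_ac)
  ultimately show ?case by metis
qed

text \<open>For \<open>s = 0\<close> the polynomial is invariant under translation. General
  \<open>s\<close> is forced by the induction: the lowest coefficient with respect to the first
  variable loses the invariance, but its degree under translation stays bounded.\<close>

lemma lex_min_degree_bound:
  fixes c :: "'a \<Rightarrow> complex"
  assumes "finite B" "lex_min n B \<beta> x0" "c x0 \<noteq> 0"
    and "\<And>x k. x \<in> B \<Longrightarrow> \<beta> x k \<le> d k"
    and "\<And>b. \<exists>p. degree p \<le> s \<and> (\<forall>t. poly p t = (\<Sum>x \<in> B. c x * (\<Prod>k < n. (b k + t) ^ \<beta> x k)))"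
    and "i < n"
  shows "(\<Sum>k \<le> i. \<beta> x0 k) \<le> s + (\<Sum>k < i. d k - \<beta> x0 k)"
  using assms
proof (induction n arbitrary: B \<beta> d s i)
  case 0
  then show ?case by simp
next
  case (Suc n)
  let ?v = "\<beta> x0 0"
  let ?B = "{x \<in> B. \<beta> x 0 = ?v}"
  define g where "g = (\<lambda>b x. smult (c x) (\<Prod>k < n. [:b k, 1:] ^ \<beta> x (Suc k)))"
  have poly_g: "poly (g b x) t = c x * (\<Prod>k < n. (b k + t) ^ \<beta> x (Suc k))" for b x t
    by (simp add: g_def poly_prod)
  have e: "x \<in> B \<Longrightarrow> ?v \<le> \<beta> x 0 \<and> \<beta> x 0 \<le> d 0" for x
    using lex_min_Suc(1)[OF Suc.prems(2)] Suc.prems(4) by blast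
  have H: "\<exists>p. degree p \<le> s \<and> (\<forall>t. poly p t = (\<Sum>x \<in> B. (y + t) ^ \<beta> x 0 * poly (g b x) t))" for b y
  proof -
    have "case_nat y b k + t = case_nat (y + t) (\<lambda>k. b k + t) k" for k t by (cases k) auto
    then show ?thesis
      using Suc.prems(5)[of "case_nat y b"] unfolding poly_g by (simp only: sum_insert_first)
  qed
  have x0: "x0 \<in> B" using Suc.prems(2) by (simp add: lex_min_def)
  obtain b where "(\<Sum>x \<in> ?B. c x * (\<Prod>k < n. b k ^ \<beta> x (Suc k))) \<noteq> 0"
    using lex_min_nonzero[of ?B n "\<lambda>x k. \<beta> x (Suc k)" x0 c] lex_min_Suc(2)[OF Suc.prems(2)] Suc.prems by auto
  then have "poly (\<Sum>x \<in> ?B. g b x) 0 \<noteq> 0" by (simp add: poly_sum poly_g)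
  then have "(\<Sum>x \<in> ?B. g b x) \<noteq> 0" by auto
  then have v: "?v \<le> s" using lowest_coefficient_degree(1)[OF Suc.prems(1) e H] by blast
  have vd: "?v \<le> d 0" using e x0 by blast
  \<comment> \<open>The bound from \<open>lowest_coefficient_degree\<close> becomes the
    \<open>s\<close> for the remaining variables. The subtraction does not truncate, by
    \<open>v\<close> and \<open>vd\<close>.\<close>
  define s' where "s' = s + d 0 - 2 * ?v"
  have "\<exists>p. degree p \<le> s' \<and> (\<forall>t. poly p t = (\<Sum>x \<in> ?B. c x * (\<Prod>k < n. (b k + t) ^ \<beta> x (Suc k))))" for b
  proof (intro exI conjI allI)
    show "degree (\<Sum>x \<in> ?B. g b x) \<le> s'"
    proof (cases "(\<Sum>x \<in> ?B. g b x) = 0")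
      case False
      then show ?thesis using lowest_coefficient_degree(2)[OF Suc.prems(1) e H] by (force simp: s'_def)
    qed simp
    show "poly (\<Sum>x \<in> ?B. g b x) t = (\<Sum>x \<in> ?B. c x * (\<Prod>k < n. (b k + t) ^ \<beta> x (Suc k)))" for t
      by (simp add: poly_sum poly_g)
  qed
  note IH = Suc.IH[of ?B "\<lambda>x k. \<beta> x (Suc k)" "\<lambda>k. d (Suc k)" s', OF _ lex_min_Suc(2)[OF Suc.prems(2)] Suc.prems(3) _ this]
  show ?case
  proof (cases i)
    case 0
    then show ?thesis using v by simp
  next
    case (Suc i')
    have "(\<Sum>k \<le> i'. \<beta> x0 (Suc k)) \<le> s' + (\<Sum>k < i'. d (Suc k) - \<beta> x0 (Suc k))"
      using IH[of i'] Suc.prems Suc by simp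
    moreover have "(\<Sum>k \<le> i. \<beta> x0 k) = ?v + (\<Sum>k \<le> i'. \<beta> x0 (Suc k))"
      unfolding Suc by (rule sum.atMost_Suc_shift)
    moreover have "(\<Sum>k < i. d k - \<beta> x0 k) = (d 0 - ?v) + (\<Sum>k < i'. d (Suc k) - \<beta> x0 (Suc k))"
      unfolding Suc by (rule sum.lessThan_Suc_shift)
    ultimately show ?thesis using v vd by (simp add: s'_def)
  qed
qed


section \<open>Leading monomials of invariants\<close>

lemma invariant_lead_interlacing:
  assumes f: "f \<in> invariant_ring n" and lead: "plead f c0 m" and j: "1 \<le> j" "j < n"
  shows "(\<Sum>k \<le> i. lookup m (k, j + 1)) \<le> (\<Sum>k < i. lookup m (k, j))"
proof -
  have keys: "keys k \<subseteq> {1..n} \<times> {1..n}" if "k \<in> keys f" for k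
    using f that by (auto simp: invariant_ring_def poly_ring_def)
  have mk: "m \<in> keys f" using lead by (auto simp: plead_def in_keys_iff)
  \<comment> \<open>\<open>p\<close> and \<open>s b\<close> encode the substitution of
    \<open>b k\<close> times the variable \<open>(k, j)\<close> for the variable
    \<open>(k, j + 1)\<close>, and \<open>coll\<close> is the resulting exponent, in which the
    columns \<open>j\<close> and \<open>j + 1\<close> are merged.\<close>
  define p where "p = (\<lambda>(k, l). if l = j + 1 then (k, j) else (k, l :: nat) :: nat \<times> nat)"
  define s where "s = (\<lambda>(b :: nat \<Rightarrow> complex) (k, l). if l = j + 1 then b k else 1)"
  define E where "E = (\<lambda>b. subst (\<lambda>v. Const (s b v) * Var (p v)))"
  have E_eq: "E b = subst (\<lambda>v. Const (s b v) * Var (p v))" for b by (simp add: E_def)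
  define coll where "coll = (\<lambda>k :: monomial. \<Sum>v \<in> keys k. single (p v) (lookup k v))"
  have inv: "E (\<lambda>k. b k + t) f = E b f" for b t
  proof -
    \<comment> \<open>Multiplication by \<open>u\<close> adds \<open>t\<close> times column
      \<open>j\<close> to column \<open>j + 1\<close> (matrix indices start at 0). Under the
      substitution this becomes the translation of all \<open>b k\<close> by
      \<open>t\<close>.\<close>
    define u where "u = mat n n (\<lambda>(x, y). if x = y then 1 else if x = j - 1 \<and> y = j then t else 0)"
    have u: "u \<in> unipotent_group n" using j by (auto simp: unipotent_group_def u_def upper_triangular_def)
    have uc: "u \<in> carrier_mat n n" by (simp add: u_def)
    define \<sigma> where "\<sigma> = (\<lambda>(k, l). (generic_mat n * map_mat Const u) $$ (k - 1, l - 1))"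
    have \<sigma>: "\<sigma> (k, l) = Var (k, l) + (if l = j + 1 then Const t * Var (k, j) else 0)" if kl: "k \<in> {1..n}" "l \<in> {1..n}" for k l
    proof -
      have u_entry: "u $$ (x, l - 1) = (if x = l - 1 then 1 else if l = j + 1 \<and> x = j - 1 then t else 0)" if "x < n" for x
        using that kl j by (auto simp: u_def)
      have "\<sigma> (k, l) = (\<Sum>x < n. Var (k, x + 1) * Const (u $$ (x, l - 1)))"
        unfolding \<sigma>_def using generic_times_index[OF uc kl] by simp
      also have "\<dots> = (\<Sum>x < n. (if x = l - 1 then Var (k, l) else 0) + (if x = j - 1 then if l = j + 1 then Const t * Var (k, j) else 0 else 0))"
      proof (rule sum.cong[OF refl])
        fix x assume "x \<in> {..<n}"
        then have x: "x < n" by simp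
        show "Var (k, x + 1) * Const (u $$ (x, l - 1)) =
          (if x = l - 1 then Var (k, l) else 0) + (if x = j - 1 then if l = j + 1 then Const t * Var (k, j) else 0 else 0)"
          unfolding u_entry[OF x] using kl j by (cases l; cases j) (auto simp: subst.h_0 subst.h_1 mult.commute)
      qed
      also have "\<dots> = Var (k, l) + (if l = j + 1 then Const t * Var (k, j) else 0)"
        unfolding sum.distrib using kl j by auto
      finally show ?thesis .
    qed
    have "E b f = E b (subst \<sigma> f)"
      using f u unfolding invariant_ring_def poly_at_subst \<sigma>_def by simp
    also have "\<dots> = subst (\<lambda>v. E b (\<sigma> v)) f" unfolding E_def by (rule subst_subst)
    also have "\<dots> = E (\<lambda>k. b k + t) f"
      unfolding E_eq[of "\<lambda>k. b k + t"]
    proof (rule subst_cong)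
      fix k v assume "k \<in> keys f" "v \<in> keys k"
      then have "v \<in> {1..n} \<times> {1..n}" using keys by blast
      then obtain r l where v: "v = (r, l)" "r \<in> {1..n}" "l \<in> {1..n}" by blast
      show "E b (\<sigma> v) = Const (s (\<lambda>k. b k + t) v) * Var (p v)"
        unfolding v(1) \<sigma>[OF v(2,3)]
        by (simp add: E_def subst.ev_add subst.ev_mult subst_Var subst_Const s_def p_def subst.h_0 subst.h_1 subst.ev_0
            subst.h_add algebra_simps)
    qed
    finally show ?thesis by simp
  qed
  \<comment> \<open>The terms that merge with the leading one. Together they give one coefficient of
    \<open>E b f\<close>, a polynomial in \<open>b\<close> that inherits the invariance under
    translation.\<close>
  define B where "B = {k \<in> keys f. coll k = coll m}"
  define \<beta> where "\<beta> = (\<lambda>(k :: monomial) r. lookup k (r, j + 1))"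
  have coeff: "lookup (E b f) (coll m) = (\<Sum>k \<in> B. lookup f k * (\<Prod>r < Suc n. b r ^ \<beta> k r))" for b
  proof -
    have prod: "(\<Prod>v \<in> keys k. s b v ^ lookup k v) = (\<Prod>r < Suc n. b r ^ \<beta> k r)"
      if k: "k \<in> keys f" for k
    proof -
      let ?A = "(\<lambda>r. (r, j + 1)) ` {..<Suc n}"
      have "(\<Prod>v \<in> keys k. s b v ^ lookup k v) = (\<Prod>v \<in> keys k \<union> ?A. s b v ^ lookup k v)"
        by (rule prod.mono_neutral_left) (auto simp: in_keys_iff)
      also have "\<dots> = (\<Prod>v \<in> ?A. s b v ^ lookup k v)"
      proof (rule prod.mono_neutral_right)
        show "\<forall>v \<in> keys k \<union> ?A - ?A. s b v ^ lookup k v = 1"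
          using keys[OF k] by (fastforce simp: s_def)
      qed auto
      also have "\<dots> = (\<Prod>r < Suc n. b r ^ \<beta> k r)"
        by (subst prod.reindex) (auto simp: inj_on_def s_def \<beta>_def)
      finally show ?thesis .
    qed
    have "lookup (E b f) (coll m) = (\<Sum>k \<in> keys f. if coll k = coll m then
        lookup f k * (\<Prod>v \<in> keys k. s b v ^ lookup k v) else 0)"
      unfolding E_def pm_eval_def lookup_sum monom_at_scaled Const_monom coll_def[symmetric]
      by (rule sum.cong) (auto simp: lookup_single when_def coll_def)
    also have "\<dots> = (\<Sum>k \<in> B. lookup f k * (\<Prod>v \<in> keys k. s b v ^ lookup k v))"
      unfolding B_def by (rule sum.inter_filter[symmetric]) simp
    also have "\<dots> = (\<Sum>k \<in> B. lookup f k * (\<Prod>r < Suc n. b r ^ \<beta> k r))"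
      by (rule sum.cong) (auto simp: B_def prod)
    finally show ?thesis .
  qed
  have lookup_coll: "lookup (coll k) w = (\<Sum>v \<in> A. if p v = w then lookup k v else 0)"
    if "finite A" "{v. p v = w} \<subseteq> A" for k w A
  proof -
    have "lookup (coll k) w = (\<Sum>v \<in> keys k. if p v = w then lookup k v else 0)"
      by (simp add: coll_def lookup_sum lookup_single when_def)
    also have "\<dots> = (\<Sum>v \<in> keys k \<union> A. if p v = w then lookup k v else 0)"
      by (rule sum.mono_neutral_left) (use that in \<open>auto simp: in_keys_iff\<close>)
    also have "\<dots> = (\<Sum>v \<in> A. if p v = w then lookup k v else 0)"
      by (rule sum.mono_neutral_right) (use that in auto)
    finally show ?thesis .
  qed
  have coll1: "lookup (coll k) (r, l) = lookup k (r, l)" if "l \<noteq> j" "l \<noteq> j + 1" for k r l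
    using that by (subst lookup_coll[of "{(r, l)}"]) (auto simp: p_def split: if_splits)
  have coll2: "lookup (coll k) (r, j) = lookup k (r, j) + lookup k (r, j + 1)" for k r
    by (subst lookup_coll[of "{(r, j), (r, j + 1)}"]) (auto simp: p_def split: if_splits)
  have B1: "lookup k (r, l) = lookup m (r, l)" if "k \<in> B" "l \<noteq> j" "l \<noteq> j + 1" for k r l
    using coll1[OF that(2,3)] that(1) unfolding B_def by (metis (mono_tags, lifting) mem_Collect_eq)
  have B2: "lookup k (r, j) + \<beta> k r = lookup m (r, j) + \<beta> m r" if "k \<in> B" for k r
    using that unfolding B_def \<beta>_def coll2[symmetric] by simp
  \<comment> \<open>For terms in \<open>B\<close> the total exponent of columns \<open>j\<close> and
    \<open>j + 1\<close> is fixed in each row. So at the first difference the largest term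
    \<open>m\<close> has more of column \<open>j\<close>, hence less of column
    \<open>j + 1\<close>.\<close>
  have "lex_min (Suc n) B \<beta> m"
    unfolding lex_min_def
  proof (intro conjI ballI impI)
    show "m \<in> B" using mk by (simp add: B_def)
    fix k assume k: "k \<in> B" "k \<noteq> m"
    then have kf: "k \<in> keys f" by (simp add: B_def)
    have "k < m" using k(2) kf lead by (auto simp: plead_def order_le_less)
    then obtain v where "lookup k v < lookup m v"
      "\<forall>v' < v. lookup k v' = lookup m v'"
      unfolding monomial_less_iff by blast
    moreover obtain r l where "v = (r, l)" by force
    ultimately have rl: "lookup k (r, l) < lookup m (r, l)"
      "\<And>v. v < (r, l) \<Longrightarrow> lookup k v = lookup m v"
      by blast+
    have "l = j"
    proof (rule ccontr)
      assume "l \<noteq> j"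
      then have l: "l = j + 1" using B1[OF k(1), of l r] rl(1) by fastforce
      then have "lookup k (r, j) = lookup m (r, j)" using rl(2) by (simp add: less_prod_def')
      then show False using B2[OF k(1), of r] rl(1) l by (simp add: \<beta>_def)
    qed
    moreover have "(r, l) \<in> keys m" using rl(1) by (simp add: in_keys_iff)
    then have "r \<le> n" using keys[OF mk] by auto
    moreover have "\<beta> k q = \<beta> m q" if "q < r" for q
      using rl(2)[of "(q, j + 1)"] that by (simp add: \<beta>_def less_prod_def')
    ultimately show "\<exists>r < Suc n. \<beta> m r < \<beta> k r \<and> (\<forall>q < r. \<beta> k q = \<beta> m q)"
      using rl(1) B2[OF k(1), of r] by (intro exI[of _ r]) auto
  qed
  moreover have "finite B" by (simp add: B_def)
  moreover have "lookup f m \<noteq> 0" using lead by (simp add: plead_def)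
  \<comment> \<open>The fixed total in row \<open>r\<close> serves as degree bound; what it leaves
    beyond \<open>\<beta> m r\<close> is the exponent of \<open>m\<close> in column
    \<open>j\<close>.\<close>
  moreover have "\<beta> k r \<le> lookup m (r, j) + \<beta> m r" if "k \<in> B" for k r
    using B2[OF that, of r] by simp
  moreover have "\<exists>q. degree q \<le> 0 \<and> (\<forall>t. poly q t = (\<Sum>k \<in> B. lookup f k * (\<Prod>r < Suc n. (b r + t) ^ \<beta> k r)))" for b
    using inv[of b] by (intro exI[of _ "[:lookup (E b f) (coll m):]"]) (simp add: coeff[symmetric] del: prod.lessThan_Suc)
  ultimately have bound: "(\<Sum>k \<le> i. \<beta> m k) \<le> 0 + (\<Sum>k < i. lookup m (k, j) + \<beta> m k - \<beta> m k)" if "i < Suc n" for i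
    using that by (intro lex_min_degree_bound[of B "Suc n" \<beta> m "lookup f"])
  show ?thesis
  proof (cases "i < Suc n")
    case True
    then show ?thesis using bound[of i] by (simp add: \<beta>_def)
  next
    case False
    have zero: "lookup m (k, l) = 0" if "k > n" for k l
      using keys[OF mk] that by (force simp: in_keys_iff)
    have "(\<Sum>k \<le> i. lookup m (k, j + 1)) = (\<Sum>k \<le> n. lookup m (k, j + 1))"
      by (rule sum.mono_neutral_right) (use False zero in auto)
    also have "\<dots> \<le> (\<Sum>k < n. lookup m (k, j))" using bound[of n] by (simp add: \<beta>_def)
    also have "\<dots> \<le> (\<Sum>k < i. lookup m (k, j))" by (rule sum_mono2) (use False in auto)
    finally show ?thesis .
  qed
qed


section \<open>Tableaux\<close>

text \<open>The row of a tableau with prescribed content.\<close>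

definition blocks :: "(nat \<Rightarrow> nat) \<Rightarrow> nat \<Rightarrow> nat list" where
  "blocks a N = concat (map (\<lambda>i. replicate (a i) i) [0..<N])"

lemma blocks_Suc: "blocks a (Suc N) = blocks a N @ replicate (a N) N"
  by (simp add: blocks_def)

lemma blocks_0 [simp]: "blocks a 0 = []"
  by (simp add: blocks_def)

lemma length_blocks: "length (blocks a N) = (\<Sum>k < N. a k)"
  by (induction N) (auto simp: blocks_Suc)

lemma set_blocks: "set (blocks a N) = {i. i < N \<and> a i > 0}"
  by (auto simp: blocks_def)

lemma sorted_blocks: "sorted (blocks a N)"
  by (induction N) (auto simp: blocks_Suc sorted_append set_blocks)

text \<open>In a sorted list the entries up to \<open>i\<close> form an initial segment, whose
  length is their number.\<close>

lemma blocks_nth_le_iff: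
  "c < length (blocks a N) \<Longrightarrow> blocks a N ! c \<le> i \<longleftrightarrow> c < (\<Sum>k \<le> i. a k)"
proof (induction N)
  case (Suc N)
  show ?case
  proof (cases "c < length (blocks a N)")
    case True
    then show ?thesis using Suc.IH by (simp add: blocks_Suc nth_append)
  next
    case False
    then have c: "(\<Sum>k < N. a k) \<le> c" "c < (\<Sum>k \<le> N. a k)"
      using Suc.prems by (auto simp: length_blocks lessThan_Suc_atMost)
    have N: "blocks a (Suc N) ! c = N"
      using False Suc.prems by (simp add: blocks_Suc nth_append)
    show ?thesis
    proof (cases "N \<le> i")
      case True
      then have "(\<Sum>k \<le> N. a k) \<le> (\<Sum>k \<le> i. a k)" by (intro sum_mono2) auto
      then show ?thesis using True c N by simp
    next
      case False
      then have "(\<Sum>k \<le> i. a k) \<le> (\<Sum>k < N. a k)" by (intro sum_mono2) auto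
      then show ?thesis using False c N by simp
    qed
  qed
qed simp

lemma sum_list_replicate_single:
  "sum_list (replicate k (single v (1::nat))) = single v k"
  by (induction k) (auto simp: single_add[symmetric])

lemma sum_singles_blocks:
  "(\<Sum>c < length (blocks a N). single (blocks a N ! c, j) (1::nat)) = (\<Sum>i < N. single (i, j) (a i))"
proof (induction N)
  case (Suc N)
  have "(\<Sum>c < length (blocks a (Suc N)). single (blocks a (Suc N) ! c, j) (1::nat)) =
      sum_list (map (\<lambda>i. single (i, j) 1) (blocks a (Suc N)))"
    by (simp add: sum_list_sum_nth atLeast0LessThan)
  also have "\<dots> = sum_list (map (\<lambda>i. single (i, j) 1) (blocks a N)) + single (N, j) (a N)"
    by (simp add: blocks_Suc sum_list_replicate_single del: One_nat_def)
  also have "sum_list (map (\<lambda>i. single (i, j) 1) (blocks a N)) = (\<Sum>i < N. single (i, j) (a i))"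
    using Suc by (simp add: sum_list_sum_nth atLeast0LessThan)
  finally show ?case by simp
qed simp

text \<open>The product of the diagonals of all column minors, collected by rows: an entry at height
  \<open>r\<close>, counted from 0, stands in matrix column \<open>r + 1\<close>.\<close>

definition tableau_monom :: "tableau \<Rightarrow> monomial" where
  "tableau_monom T = (\<Sum>r < length T. \<Sum>c < length (T ! r). single (T ! r ! c, r + 1) 1)"

text \<open>As row lengths decrease, a column occupies an initial segment of the rows, and by
  strictness reading it upwards lists its entries in increasing order.\<close>

lemma ssyt_columns:
  assumes T: "ssyt n T"
  obtains h where "\<And>r. r < length T \<and> c < length (T ! r) \<longleftrightarrow> r < h"
    and "sorted_list_of_set (col T c) = map (\<lambda>r. T ! r ! c) [0..<h]"
    and "sorted_wrt (<) (map (\<lambda>r. T ! r ! c) [0..<h])"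
    and "set (map (\<lambda>r. T ! r ! c) [0..<h]) \<subseteq> {1..n}"
proof -
  have len: "length (T ! r) \<ge> length (T ! r')" if "r < r'" "r' < length T" for r r'
    using T that by (auto simp: ssyt_def sorted_wrt_iff_nth_less)
  define P where "P = (\<lambda>r. r < length T \<and> c < length (T ! r))"
  define h where "h = (LEAST r. \<not> P r)"
  have "\<not> P (length T)" by (simp add: P_def)
  then have h: "\<not> P h" unfolding h_def by (rule LeastI)
  have P: "P r \<longleftrightarrow> r < h" for r
  proof
    assume "P r"
    show "r < h"
    proof (rule ccontr)
      assume "\<not> r < h"
      then consider "h = r" | "h < r" by linarith
      then show False
      proof cases
        case 2
        then have "P h" using \<open>P r\<close> len[of h r] by (auto simp: P_def)
        then show False using h by blast
      qed (use h \<open>P r\<close> in blast)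
    qed
  qed (use not_less_Least in \<open>auto simp: h_def\<close>)
  let ?l = "map (\<lambda>r. T ! r ! c) [0..<h]"
  have strict: "sorted_wrt (<) ?l"
    unfolding sorted_wrt_iff_nth_Suc_transp[OF transp_on_less]
  proof (intro allI impI)
    fix r assume "Suc r < length ?l"
    then have "Suc r < h" by simp
    then have "P (Suc r)" using P by blast
    then show "?l ! r < ?l ! Suc r" using T \<open>Suc r < h\<close> by (auto simp: ssyt_def P_def)
  qed
  have "col T c = set ?l" using P by (auto simp: col_def P_def)
  then have "sorted_list_of_set (col T c) = ?l"
    using strict by (metis List.finite_set sorted_list_of_set.idem_if_sorted_distinct strict_sorted_iff)
  moreover have "set ?l \<subseteq> {1..n}"
  proof
    fix x assume "x \<in> set ?l"
    then obtain r where "r < h" "x = T ! r ! c" by auto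
    moreover have "P r" using P \<open>r < h\<close> by blast
    ultimately have x: "x \<in> set (T ! r)" "T ! r \<in> set T" by (auto simp: P_def)
    have "\<forall>q \<in> set T. set q \<subseteq> {1..n}" using T by (simp add: ssyt_def)
    then show "x \<in> {1..n}" using x by blast
  qed
  ultimately show ?thesis using that P strict by (auto simp: P_def)
qed

lemma tableau_minor_fixed:
  assumes T: "ssyt n T"
    and \<sigma>: "\<And>rs. set rs \<subseteq> {1..n} \<Longrightarrow> length rs \<le> n \<Longrightarrow> subst \<sigma> (row_minor rs) = row_minor rs"
  shows "subst \<sigma> (tableau_minor T) = tableau_minor T"
proof -
  have "subst \<sigma> (flag_minor (col T c)) = flag_minor (col T c)" for c
  proof -
    obtain h where h: "sorted_list_of_set (col T c) = map (\<lambda>r. T ! r ! c) [0..<h]"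
      "sorted_wrt (<) (map (\<lambda>r. T ! r ! c) [0..<h])" "set (map (\<lambda>r. T ! r ! c) [0..<h]) \<subseteq> {1..n}"
      using ssyt_columns[OF T] by metis
    let ?l = "map (\<lambda>r. T ! r ! c) [0..<h]"
    have "length ?l = card (set ?l)" using h(2) by (metis distinct_card strict_sorted_iff)
    also have "\<dots> \<le> card {1..n}" by (rule card_mono) (use h(3) in auto)
    finally show ?thesis unfolding flag_minor_row_minor h(1) using h(3) by (intro \<sigma>) auto
  qed
  then show ?thesis by (simp add: tableau_minor_def subst.ev_prod)
qed

lemma plead_prod:
  "(\<And>i. i \<in> A \<Longrightarrow> plead (f i) 1 (m i)) \<Longrightarrow> plead (\<Prod>i \<in> A. f i) 1 (\<Sum>i \<in> A. m i)"
proof (induction A rule: infinite_finite_induct)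
  case (insert a A)
  then show ?case using plead_mult[of "f a" 1 "m a" "\<Prod>i \<in> A. f i" 1] by simp
qed (auto simp: plead_1)

lemma plead_tableau_minor:
  assumes T: "ssyt n T"
  shows "plead (tableau_minor T) 1 (tableau_monom T)"
proof -
  let ?g = "\<lambda>r c. single (T ! r ! c, r + 1) (1::nat)"
  have "plead (flag_minor (col T c)) 1 (\<Sum>r \<in> {r. r < length T \<and> c < length (T ! r)}. ?g r c)" for c
  proof -
    obtain h where h: "\<And>r. r < length T \<and> c < length (T ! r) \<longleftrightarrow> r < h"
      "sorted_list_of_set (col T c) = map (\<lambda>r. T ! r ! c) [0..<h]"
      "sorted_wrt (<) (map (\<lambda>r. T ! r ! c) [0..<h])"
      using ssyt_columns[OF T] by metis
    have "diag_monom (map (\<lambda>r. T ! r ! c) [0..<h]) = (\<Sum>r < h. ?g r c)"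
      by (simp add: diag_monom_def perm_monom_def)
    moreover have "{r. r < length T \<and> c < length (T ! r)} = {..<h}" using h(1) by auto
    ultimately show ?thesis
      unfolding flag_minor_row_minor h(2) using plead_row_minor[OF h(3)] by simp
  qed
  then have "plead (tableau_minor T) 1 (\<Sum>c < num_cols T. \<Sum>r \<in> {r. r < length T \<and> c < length (T ! r)}. ?g r c)"
    unfolding tableau_minor_def by (rule plead_prod)
  also have "(\<Sum>c < num_cols T. \<Sum>r \<in> {r. r < length T \<and> c < length (T ! r)}. ?g r c)
      = (\<Sum>c < num_cols T. \<Sum>r \<in> {..<length T}. if c < length (T ! r) then ?g r c else 0)"
    by (rule sum.cong[OF refl], subst sum.inter_filter[symmetric]) (auto intro: sum.cong)
  also have "\<dots> = (\<Sum>r < length T. \<Sum>c < num_cols T. if c < length (T ! r) then ?g r c else 0)"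
    by (rule sum.swap)
  also have "\<dots> = tableau_monom T"
    unfolding tableau_monom_def
  proof (rule sum.cong[OF refl])
    fix r assume "r \<in> {..<length T}"
    then have r: "r < length T" by simp
    have "length (T ! r) \<le> num_cols T"
    proof (cases r)
      case 0
      then show ?thesis using r by (cases T) (auto simp: num_cols_def)
    next
      case (Suc r')
      then have "length (T ! r) \<le> length (T ! 0)" using T r by (auto simp: ssyt_def sorted_wrt_iff_nth_less)
      then show ?thesis using r by (cases T) (auto simp: num_cols_def)
    qed
    then have "{c \<in> {..<num_cols T}. c < length (T ! r)} = {..<length (T ! r)}" by auto
    then show "(\<Sum>c < num_cols T. if c < length (T ! r) then ?g r c else 0) = (\<Sum>c < length (T ! r). ?g r c)"
      by (simp add: sum.inter_filter[symmetric])
  qed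
  finally show ?thesis .
qed

text \<open>Row \<open>j\<close> contains \<open>i\<close> as often as the variable
  \<open>(i, j)\<close> occurs in \<open>m\<close>. If \<open>x\<close> is the entry at position
  \<open>c\<close> of row \<open>j + 1\<close>, then more than \<open>c\<close> entries of that row
  are at most \<open>x\<close>; by interlacing more than \<open>c\<close> entries of row
  \<open>j\<close> are less than \<open>x\<close>, and so the entry below \<open>x\<close> is
  smaller.\<close>

lemma ssyt_of_monomial:
  assumes keys: "keys m \<subseteq> {1..n} \<times> {1..n}"
    and interlacing: "\<And>i j. 1 \<le> j \<Longrightarrow> j < n \<Longrightarrow>
      (\<Sum>k \<le> i. lookup m (k, j + 1)) \<le> (\<Sum>k < i. lookup m (k, j))"
  shows "\<exists>T. ssyt n T \<and> tableau_monom T = m"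
proof -
  define row where "row = (\<lambda>j. blocks (\<lambda>i. lookup m (i, j)) (Suc n))"
  define rows where "rows = map (\<lambda>r. row (Suc r)) [0..<n]"
  \<comment> \<open>Rows of a tableau are nonempty. Since lengths decrease, the empty rows come
    last, and cutting at the first of them loses nothing.\<close>
  define T where "T = takeWhile (\<lambda>r. r \<noteq> []) rows"
  have lenT: "length T \<le> n"
    using length_takeWhile_le[of "\<lambda>r. r \<noteq> []" rows] by (simp add: T_def rows_def)
  have Tnth: "T ! r = row (Suc r)" if "r < length T" for r
    using takeWhile_nth[of r "\<lambda>r. r \<noteq> []" rows] that lenT by (simp add: T_def[symmetric]) (simp add: rows_def)
  have Tne: "T ! r \<noteq> []" if "r < length T" for r
    using nth_mem[OF that] unfolding T_def by (auto dest: set_takeWhileD)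
  have zero: "lookup m (k, j) = 0" if "k = 0 \<or> k > n \<or> j = 0 \<or> j > n" for k j
    using keys that by (force simp: in_keys_iff)
  have len_row: "length (row j) = (\<Sum>k < Suc n. lookup m (k, j))" for j
    by (simp only: row_def length_blocks)
  have dec: "length (row (Suc j)) \<le> length (row j)" if "1 \<le> j" for j
  proof (cases "j < n")
    case True
    have "length (row (Suc j)) \<le> (\<Sum>k < n. lookup m (k, j))"
      unfolding len_row lessThan_Suc_atMost using interlacing[OF that True, of n] by simp
    also have "\<dots> \<le> length (row j)" unfolding len_row by simp
    finally show ?thesis .
  next
    case False
    then show ?thesis unfolding len_row by (simp add: zero)
  qed
  have dec': "length (row k) \<le> length (row j)" if "1 \<le> j" "j \<le> k" for j k
    using that(2) by (induction rule: dec_induct) (use dec that(1) in \<open>auto intro: order_trans\<close>)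
  have row_set: "set (row j) \<subseteq> {1..n}" for j
  proof
    fix x assume "x \<in> set (row j)"
    then have "x < Suc n" "lookup m (x, j) \<noteq> 0" by (auto simp: row_def set_blocks)
    then show "x \<in> {1..n}" using zero[of x j] by (cases x) auto
  qed
  have "ssyt n T"
    unfolding ssyt_def
  proof (intro conjI ballI allI impI)
    fix r assume "r \<in> set T"
    then obtain q where q: "q < length T" "r = T ! q" by (metis in_set_conv_nth)
    show "r \<noteq> []" using q Tne by simp
    show "set r \<subseteq> {1..n}" using q Tnth row_set by simp
    show "sorted r" using q Tnth by (simp add: row_def sorted_blocks)
  next
    show "sorted_wrt (\<ge>) (map length T)"
      by (auto simp: sorted_wrt_iff_nth_less Tnth intro!: dec')
  next
    fix r c assume rc: "Suc r < length T \<and> c < length (T ! Suc r)"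
    let ?x = "T ! Suc r ! c"
    have c: "c < length (row (Suc (Suc r)))" using rc Tnth[of "Suc r"] by simp
    have c': "c < length (row (Suc r))" using c dec[of "Suc r"] by simp
    have "c < (\<Sum>k \<le> ?x. lookup m (k, Suc (Suc r)))"
      using c blocks_nth_le_iff[of c "\<lambda>i. lookup m (i, Suc (Suc r))" "Suc n" ?x] rc Tnth[of "Suc r"]
      by (simp add: row_def)
    also have "\<dots> \<le> (\<Sum>k < ?x. lookup m (k, Suc r))"
      using interlacing[of "Suc r" ?x] rc lenT by simp
    finally have less: "c < (\<Sum>k < ?x. lookup m (k, Suc r))" .
    then obtain y where y: "?x = Suc y" by (cases ?x) auto
    then have "T ! r ! c \<le> y"
      using c' less blocks_nth_le_iff[of c "\<lambda>i. lookup m (i, Suc r)" "Suc n" y] rc Tnth[of r]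
      by (simp add: row_def lessThan_Suc_atMost)
    then show "T ! r ! c < T ! Suc r ! c" using y by simp
  qed
  moreover have "tableau_monom T = m"
  proof -
    have empty: "row (Suc r) = []" if "r \<ge> length T" "r < n" for r
    proof -
      have "length T < length rows" using that by (simp add: rows_def)
      then have "\<not> rows ! length T \<noteq> []" unfolding T_def by (rule nth_length_takeWhile)
      then have "row (Suc (length T)) = []" using that by (simp add: rows_def)
      then show ?thesis using dec'[of "Suc (length T)" "Suc r"] that by simp
    qed
    have "tableau_monom T = (\<Sum>r < length T. \<Sum>c < length (row (Suc r)). single (row (Suc r) ! c, Suc r) 1)"
      unfolding tableau_monom_def by (rule sum.cong) (auto simp: Tnth)
    also have "\<dots> = (\<Sum>r < n. \<Sum>c < length (row (Suc r)). single (row (Suc r) ! c, Suc r) 1)"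
      by (rule sum.mono_neutral_left) (use lenT empty in auto)
    also have "\<dots> = (\<Sum>r < n. \<Sum>i < Suc n. single (i, Suc r) (lookup m (i, Suc r)))"
      unfolding row_def by (simp only: sum_singles_blocks)
    also have "\<dots> = m"
    proof (rule poly_mapping_eqI)
      fix v :: "nat \<times> nat"
      obtain k j where v: "v = (k, j)" by force
      have "lookup (\<Sum>r < n. \<Sum>i < Suc n. single (i, Suc r) (lookup m (i, Suc r))) v
          = (\<Sum>r < n. \<Sum>i < Suc n. if i = k then (if Suc r = j then lookup m (k, j) else 0) else 0)"
        unfolding lookup_sum by (intro sum.cong refl) (auto simp: v lookup_single when_def)
      also have "\<dots> = (\<Sum>r < n. if Suc r = j then (if k < Suc n then lookup m (k, j) else 0) else 0)"
        by (rule sum.cong) (auto simp del: sum.lessThan_Suc)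
      also have "\<dots> = lookup m (k, j)"
      proof (cases j)
        case (Suc j')
        then show ?thesis by (auto simp: zero)
      qed (simp add: zero)
      finally show "lookup (\<Sum>r < n. \<Sum>i < Suc n. single (i, Suc r) (lookup m (i, Suc r))) v
          = lookup m v" by (simp add: v)
    qed
    finally show ?thesis .
  qed
  ultimately show ?thesis by blast
qed

text \<open>The common leading term cancels, and every other monomial of either polynomial is
  smaller.\<close>

lemma smaller_diff:
  assumes "plead f 1 m" "plead g 1 m"
  shows "smaller (f - g) g"
proof (cases "f - g = 0")
  case False
  then obtain c k where k: "plead (f - g) c k" using plead_exists by blast
  then have kk: "k \<in> keys (f - g)" by (auto simp: plead_def in_keys_iff)
  then have "k \<noteq> m" using assms by (auto simp: plead_def in_keys_iff lookup_minus)
  moreover have "k \<in> keys f \<or> k \<in> keys g"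
    using kk by (auto simp: in_keys_iff lookup_minus)
  then have "k \<le> m" using assms by (auto simp: plead_def)
  ultimately have "k < m" by (metis order_le_less)
  then show ?thesis using plead_lead_monomial[OF k] plead_lead_monomial[OF assms(2)] by (simp add: smaller_def)
qed (simp add: smaller_def)

theorem theoremM1:
  fixes n :: nat and P :: ratfun
  assumes "n \<ge> 1"
    and "P \<in> cluster_vars (initial_seed n)"
  shows "\<exists>T P'. ssyt n T \<and> P' \<in> invariant_ring n \<and> smaller P' (tableau_minor T) \<and>
           P = to_fract (tableau_minor T + P')"
proof -
  obtain f where f: "P = to_fract f" using cluster_var_polynomial[OF assms(2)] by blast
  obtain S u where S: "S \<in> mutation_class (interval_seed 1 n)" "u \<in> verts S" "P = cvar S u"
    using assms(2) by (auto simp: cluster_vars_def initial_seed_interval)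
  obtain \<mu> where "seed_leads S \<mu>"
    using mutation_class_invariants[OF S(1) _ skew_interval_seed full_rank_interval_seed seed_leads_interval_seed]
      finite_interval_verts by (auto simp: interval_seed_simps)
  then have "leads (to_fract f) 1 (\<mu> u)" using S(2,3) f by (simp add: seed_leads_def)
  then obtain m where m: "plead f 1 m" using leads_to_fractD by blast
  have fixed: "subst \<sigma> f = f"
    if "\<And>rs. set rs \<subseteq> {1..n} \<Longrightarrow> length rs \<le> n \<Longrightarrow> subst \<sigma> (row_minor rs) = row_minor rs" for \<sigma>
    using cluster_var_fixed assms(2) that unfolding f by blast
  then have inv: "f \<in> invariant_ring n" by (rule invariant_ringI)
  have "m \<in> keys f" using m by (simp add: plead_def in_keys_iff)
  then have "keys m \<subseteq> {1..n} \<times> {1..n}" using inv by (auto simp: invariant_ring_def poly_ring_def)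
  then obtain T where T: "ssyt n T" "tableau_monom T = m"
    using ssyt_of_monomial invariant_lead_interlacing[OF inv m] by metis
  have "f - tableau_minor T \<in> invariant_ring n"
  proof (rule invariant_ringI)
    fix \<sigma> assume *: "\<And>rs. set rs \<subseteq> {1..n} \<Longrightarrow> length rs \<le> n \<Longrightarrow> subst \<sigma> (row_minor rs) = row_minor rs"
    have "subst \<sigma> f = f" by (rule fixed) (rule *)
    moreover have "subst \<sigma> (tableau_minor T) = tableau_minor T" by (rule tableau_minor_fixed[OF T(1)]) (rule *)
    ultimately show "subst \<sigma> (f - tableau_minor T) = f - tableau_minor T" by (simp add: subst.ev_diff)
  qed
  moreover have "smaller (f - tableau_minor T) (tableau_minor T)"
    using smaller_diff[OF m] plead_tableau_minor[OF T(1)] T(2) by simp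
  moreover have "P = to_fract (tableau_minor T + (f - tableau_minor T))" by (simp add: f)
  ultimately show ?thesis using T(1) by blast
qed

end
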